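(* Consider the hybrid system $\mathcal H_1$ with state $x_1=(\tilde R,\eta,\mathsf x,\tau)\in SO(3)\times\mathbb R^3\times\mathbb R^6\times[0,T_M]$ given by $$\begin{cases}\dot{\tilde R}=\tilde R(-\eta)^\times,\quad \dot\eta=0_{3\times1},\quad \dot{\mathsf x}=A\mathsf x+\delta_g,\quad \dot\tau=-1, & \tau\in[0,T_M],\\ \tilde R^+=\tilde R,\quad \eta^+=k_R\,\psi(M\tilde R),\quad \mathsf x^+=(I_6-KC)\mathsf x,\quad \tau^+\in[T_m,T_M], & \tau\in\{0\},\end{cases}$$ where $\delta_g=[0_{1\times3},\ g^\top(I_3-\tilde R)]^\top$, $K=[k_pI_3,\ k_vI_3]^\top\in\mathbb R^{6\times 3}$, $k_R,k_p,k_v>0$, $A=\begin{bmatrix}0_{3\times3}&I_3\\0_{3\times3}&0_{3\times3}\end{bmatrix}$, $C=[I_3\ \ 0_{3\times3}]$. Suppose that $0<T_m\le T_M<\infty$, that at least three of the $N\ge3$ landmarks $p_1,\dots,p_N\in\mathbb R^3$ are non-collinear, and that there exists a symmetric positive definite matrix $P\in\mathbb R^{6\times6}$ satisfying $$\Xi_P(\tau):=A_g^\top\Phi(\tau)^\top P\,\Phi(\tau)A_g-P<0\qquad\text{for all }\tau\in[T_m,T_M],$$ with $\Phi(\tau)=\exp(A\tau)$ and $A_g=I_6-KC$ (where $<0$ means negative definite). Then, for any $0<\epsilon<1$, there exist constants $\eta^*,k_R^*>0$ such that, for any $0<k_R<k_R^*$, the closed set $$\mathcal A=\{(\tilde R,\eta,\mathsf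 x,\tau)\in SO(3)\times\mathbb R^3\times\mathbb R^6\times[0,T_M]:\ \tilde R=I_3,\ \|\eta\|=0,\ \|\mathsf x\|=0\}$$ is exponentially stable for $\mathcal H_1$ for all initial conditions with $|\tilde R(0)|_I\le\epsilon\sqrt{\varsigma_M}$, $\|\eta(0)\|\le\eta^*$ and $\mathsf x(0)\in\mathbb R^6$ (with $\tau(0)\in[0,T_M]$); that is, there exist $\kappa,\lambda>0$ such that every maximal solution $x_1$ of $\mathcal H_1$ from such an initial condition is complete and satisfies $|x_1(t,j)|_{\mathcal A}\le\kappa e^{-\lambda(t+j)}|x_1(0,0)|_{\mathcal A}$ for all $(t,j)\in\operatorname{dom}x_1$.
   Context: Notation. For $x\in\mathbb R^3$, $x^\times$ is the skew-symmetric $3\times3$ matrix with $x^\times y=x\times y$ for all $y$. For $B=[b_{ij}]\in\mathbb R^{3\times3}$, $\psi(B)=\tfrac12[b_{32}-b_{23},\,b_{13}-b_{31},\,b_{21}-b_{12}]^\top$. For $R\in SO(3)$, $|R|_I\in[0,1]$ is defined by $|R|_I^2=\tfrac14\operatorname{tr}(I_3-R)$. $g\in\mathbb R^3$ is the constant gravity vector. Landmarks. $p_1,\dots,p_N\in\mathbb R^3$ are fixed points; $k_1,\dots,k_N>0$ are scalars with $\sum_{i=1}^Nk_i=1$; $p_c=\sum_{i=1}^Nk_ip_i$; $M=\sum_{i=1}^Nk_i(p_i-p_c)(p_i-p_c)^\top$; $\bar M=\tfrac12(\operatorname{tr}(M)I_3-M)$ (positive definite); $\varsigma_M=\lambda_{\min}(\bar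 M)/\lambda_{\max}(\bar M)$. Timer. $\tau$ models sampling instants $t_j$ with $0\le t_1\le T_M$ and $T_m\le t_{j+1}-t_j\le T_M$. Hybrid systems. A hybrid time domain is a set $E\subset\mathbb R_{\ge0}\times\mathbb N$ which is a union of intervals $[t_j,t_{j+1}]\times\{j\}$ with $0=t_0\le t_1\le\cdots$ (finitely or infinitely many, the last one, if any, possibly of the form $[t_j,T)\times\{j\}$ with $T$ finite or $+\infty$). A solution is a function $x$ on a hybrid time domain $\operatorname{dom}x$, locally absolutely continuous in $t$ for each fixed $j$, satisfying the differential equation for almost all $t$ while staying in the flow set (here $\tau\in[0,T_M]$), and with $x^+=x(t,j+1)$ obtained from $x=x(t,j)$ in the jump set (here $\tau=0$) by the jump rule. It is maximal if it cannot be extended, and complete if its domain is unbounded. $x(0)$ denotes the value at $(t,j)=(0,0)$. Distance: $|x_1|_{\mathcal A}=\big(|\tilde R|_I^2+\|\eta\|^2+\|\mathsf x\|^2\big)^{1/2}$. Origin of the system (for information). $\mathcal H_1$ is the estimation-error system for the kinematics $\dot R=R\omega^\times$, $\dot p=v$, $\dot v=g+Ra$ with landmark measurements $y_i=R^\top(p_i-p)$ and the observer that flows according to $\dot{\hat R}=\hat R(\omega+\hat R^\top\eta)^\times$, $\dot\eta=0$, $\dot{\hat p}=\eta^\times(\hat p-p_c)+\hat v$, $\dot{\hat v}=\eta^\times\hat v+g+\hat Ra$ and jumps according to $\hat R^+=\hat R$, $\eta^+=k_R\sigma_R$, $\hat p^+=\hat p+k_py$, $\hat v^+=\hat v+k_vy$,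 where $\sigma_R=\tfrac12\sum_ik_i(p_i-p_c)^\times(p_i-\hat p-\hat Ry_i)$ and $y=\sum_ik_i(p_i-\hat p-\hat Ry_i)$. The errors are $\tilde R=R\hat R^\top$, $\tilde p=p-\tilde R\hat p-(I_3-\tilde R)p_c$, $\tilde v=v-\tilde R\hat v$, and $\mathsf x=[\tilde p^\top,\tilde v^\top]^\top$. *)

theory Defs
  imports "HOL-Analysis.Analysis"
begin

section \<open>Hybrid systems\<close>

record 'a hybrid_system =
  flow_set :: "'a set"
  flow_map :: "'a \<Rightarrow> 'a"
  jump_set :: "'a set"
  jump_map :: "'a \<Rightarrow> 'a set"

text \<open>
  The sequence \<^term>\<open>s\<close> of jump times is total; for finitely many jumps only its values up
  to \<^term>\<open>s (Suc J)\<close> matter, and \<^term>\<open>I\<close> is the last interval.  Hybrid time domains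
  are nonempty and contain \<^term>\<open>(0, 0)\<close>.
\<close>

definition hybrid_time_domain :: "(real \<times> nat) set \<Rightarrow> bool" where
  "hybrid_time_domain E \<longleftrightarrow>
     (\<exists>s :: nat \<Rightarrow> real. s 0 = 0 \<and> incseq s \<and>
        (E = (\<Union>j. {s j..s (Suc j)} \<times> {j}) \<or>
         (\<exists>J I. E = (\<Union>j<J. {s j..s (Suc j)} \<times> {j}) \<union> I \<times> {J} \<and>
                (I = {s J..s (Suc J)} \<or>
                 s J < s (Suc J) \<and> I = {s J..<s (Suc J)} \<or>
                 I = {s J..}))))"

definition complete_domain :: "(real \<times> nat) set \<Rightarrow> bool" where
  "complete_domain E \<longleftrightarrow> \<not> bounded ((\<lambda>(t, j). (t, real j)) ` E)"

definition time_slice :: "(real \<times> nat) set \<Rightarrow> nat \<Rightarrow> real set" where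
  "time_slice E j = {t. (t, j) \<in> E}"

text \<open>
  Absolute continuity on a compact interval: a division of a subset of \<^term>\<open>{a..b}\<close> is a
  finite family of nonoverlapping closed intervals.
\<close>

definition abs_cont_on_interval :: "real \<Rightarrow> real \<Rightarrow> (real \<Rightarrow> 'a::real_normed_vector) \<Rightarrow> bool" where
  "abs_cont_on_interval a b f \<longleftrightarrow>
     (\<forall>\<epsilon>>0. \<exists>\<delta>>0. \<forall>\<D> T. \<D> division_of T \<and> T \<subseteq> {a..b} \<and> (\<Sum>K\<in>\<D>. Sup K - Inf K) < \<delta> \<longrightarrow>
        (\<Sum>K\<in>\<D>. norm (f (Sup K) - f (Inf K))) < \<epsilon>)"

definition locally_abs_cont_on :: "real set \<Rightarrow> (real \<Rightarrow> 'a::real_normed_vector) \<Rightarrow> bool" where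
  "locally_abs_cont_on I f \<longleftrightarrow> (\<forall>a b. {a..b} \<subseteq> I \<longrightarrow> abs_cont_on_interval a b f)"

text \<open>
  A solution is a pair of a hybrid time domain \<^term>\<open>E\<close> and a hybrid arc \<^term>\<open>x\<close>; the
  values of \<^term>\<open>x\<close> outside \<^term>\<open>E\<close> are irrelevant.
\<close>

definition hybrid_solution ::
    "('a::real_normed_vector) hybrid_system \<Rightarrow> (real \<times> nat) set \<Rightarrow> (real \<Rightarrow> nat \<Rightarrow> 'a) \<Rightarrow> bool" where
  "hybrid_solution H E x \<longleftrightarrow>
     hybrid_time_domain E \<and>
     x 0 0 \<in> flow_set H \<union> jump_set H \<and>
     (\<forall>j. locally_abs_cont_on (time_slice E j) (\<lambda>t. x t j) \<and>
          (\<forall>t \<in> interior (time_slice E j). x t j \<in> flow_set H) \<and>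
          (AE t in lebesgue. t \<in> time_slice E j \<longrightarrow>
             ((\<lambda>t. x t j) has_vector_derivative flow_map H (x t j))
               (at t within time_slice E j))) \<and>
     (\<forall>t j. (t, j) \<in> E \<and> (t, Suc j) \<in> E \<longrightarrow>
          x t j \<in> jump_set H \<and> x t (Suc j) \<in> jump_map H (x t j))"

definition maximal_solution ::
    "('a::real_normed_vector) hybrid_system \<Rightarrow> (real \<times> nat) set \<Rightarrow> (real \<Rightarrow> nat \<Rightarrow> 'a) \<Rightarrow> bool" where
  "maximal_solution H E x \<longleftrightarrow>
     hybrid_solution H E x \<and>
     (\<forall>E' x'. hybrid_solution H E' x' \<and> E \<subseteq> E' \<and> (\<forall>(t, j)\<in>E. x' t j = x t j) \<longrightarrow> E' = E)"

text \<open>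
  Exponential stability of \<^term>\<open>\<A>\<close> for initial conditions in \<^term>\<open>X\<^sub>0\<close>.  The function
  \<^term>\<open>d\<close> is the distance to \<^term>\<open>\<A>\<close> in which the decay is measured; it has to vanish
  exactly on \<^term>\<open>\<A>\<close>.
\<close>

definition exponentially_stable_from ::
    "('a::real_normed_vector) hybrid_system \<Rightarrow> 'a set \<Rightarrow> ('a \<Rightarrow> real) \<Rightarrow> 'a set \<Rightarrow> bool" where
  "exponentially_stable_from H \<A> d X\<^sub>0 \<longleftrightarrow>
     closed \<A> \<and>
     (\<forall>x \<in> flow_set H \<union> jump_set H. d x = 0 \<longleftrightarrow> x \<in> \<A>) \<and>
     (\<exists>\<kappa>>0. \<exists>\<mu>>0. \<forall>E x. maximal_solution H E x \<and> x 0 0 \<in> X\<^sub>0 \<longrightarrow>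
        complete_domain E \<and>
        (\<forall>(t, j)\<in>E. d (x t j) \<le> \<kappa> * exp (- \<mu> * (t + real j)) * d (x 0 0)))"


section \<open>Matrices\<close>

definition vstack :: "'a^'m \<Rightarrow> 'a^'n \<Rightarrow> 'a^('m + 'n)" where
  "vstack u w = (\<chi> i. case i of Inl a \<Rightarrow> u $ a | Inr b \<Rightarrow> w $ b)"

definition hstack :: "'a^'m^'k \<Rightarrow> 'a^'n^'k \<Rightarrow> 'a^('m + 'n)^'k" where
  "hstack U W = (\<chi> i. vstack (U $ i) (W $ i))"

text \<open>The power series: the ring \<^typ>\<open>real^'n^'n\<close> with
  \<^term>\<open>(**)\<close> is not an instance of the class on which \<^const>\<open>exp\<close> is defined.\<close>

definition matrix_exp :: "real^'n^'n \<Rightarrow> real^'n^'n" where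
  "matrix_exp A = (\<Sum>n. inverse (fact n) *\<^sub>R (((**) A) ^^ n) (mat 1))"

definition sym_pos_def :: "real^'n^'n \<Rightarrow> bool" where
  "sym_pos_def P \<longleftrightarrow> transpose P = P \<and> (\<forall>x. x \<noteq> 0 \<longrightarrow> 0 < x \<bullet> (P *v x))"

definition sym_neg_def :: "real^'n^'n \<Rightarrow> bool" where
  "sym_neg_def P \<longleftrightarrow> transpose P = P \<and> (\<forall>x. x \<noteq> 0 \<longrightarrow> x \<bullet> (P *v x) < 0)"

definition eigenvalues :: "real^'n^'n \<Rightarrow> real set" where
  "eigenvalues B = {l. \<exists>v. v \<noteq> 0 \<and> B *v v = l *\<^sub>R v}"

definition skew :: "real^3 \<Rightarrow> real^3^3" where
  "skew x = matrix (\<lambda>y. cross3 x y)"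

definition psi :: "real^3^3 \<Rightarrow> real^3" where
  "psi B = (1/2) *\<^sub>R vector [B$3$2 - B$2$3, B$1$3 - B$3$1, B$2$1 - B$1$2]"

definition rot_norm :: "real^3^3 \<Rightarrow> real" where
  "rot_norm R = sqrt (trace (mat 1 - R) / 4)"


section \<open>Landmarks\<close>

definition landmark_center :: "nat \<Rightarrow> (nat \<Rightarrow> real) \<Rightarrow> (nat \<Rightarrow> real^3) \<Rightarrow> real^3" where
  "landmark_center N k p = (\<Sum>i=1..N. k i *\<^sub>R p i)"

definition outer :: "real^'n \<Rightarrow> real^'n^'n" where
  "outer v = (columnvector v :: real^1^'n) ** (rowvector v :: real^'n^1)"

definition landmark_matrix :: "nat \<Rightarrow> (nat \<Rightarrow> real) \<Rightarrow> (nat \<Rightarrow> real^3) \<Rightarrow> real^3^3" where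
  "landmark_matrix N k p = (\<Sum>i=1..N. k i *\<^sub>R outer (p i - landmark_center N k p))"

definition bar_matrix :: "real^3^3 \<Rightarrow> real^3^3" where
  "bar_matrix M = (1/2) *\<^sub>R (trace M *\<^sub>R mat 1 - M)"

definition eig_ratio :: "real^3^3 \<Rightarrow> real" where
  "eig_ratio M = Min (eigenvalues (bar_matrix M)) / Max (eigenvalues (bar_matrix M))"


section \<open>The estimation-error system\<close>

definition A_mat :: "real^(3 + 3)^(3 + 3)" where
  "A_mat = vstack (hstack 0 (mat 1)) (hstack 0 0)"

definition C_mat :: "real^(3 + 3)^3" where
  "C_mat = hstack (mat 1) 0"

definition K_mat :: "real \<Rightarrow> real \<Rightarrow> real^3^(3 + 3)" where
  "K_mat k\<^sub>p k\<^sub>v = vstack (k\<^sub>p *\<^sub>R mat 1) (k\<^sub>v *\<^sub>R mat 1)"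

definition Ag_mat :: "real \<Rightarrow> real \<Rightarrow> real^(3 + 3)^(3 + 3)" where
  "Ag_mat k\<^sub>p k\<^sub>v = mat 1 - K_mat k\<^sub>p k\<^sub>v ** C_mat"

definition Phi :: "real \<Rightarrow> real^(3 + 3)^(3 + 3)" where
  "Phi \<tau> = matrix_exp (\<tau> *\<^sub>R A_mat)"

definition Xi :: "real \<Rightarrow> real \<Rightarrow> real^(3 + 3)^(3 + 3) \<Rightarrow> real \<Rightarrow> real^(3 + 3)^(3 + 3)" where
  "Xi k\<^sub>p k\<^sub>v P \<tau> =
     transpose (Ag_mat k\<^sub>p k\<^sub>v) ** transpose (Phi \<tau>) ** P ** Phi \<tau> ** Ag_mat k\<^sub>p k\<^sub>v - P"

definition delta_g :: "real^3 \<Rightarrow> real^3^3 \<Rightarrow> real^(3 + 3)" where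
  "delta_g g R = vstack 0 (g v* (mat 1 - R))"

type_synonym state = "(real^3^3) \<times> (real^3) \<times> (real^(3 + 3)) \<times> real"

definition error_system ::
    "real^3^3 \<Rightarrow> real^3 \<Rightarrow> real \<Rightarrow> real \<Rightarrow> real \<Rightarrow> real \<Rightarrow> real \<Rightarrow> state hybrid_system" where
  "error_system M g k\<^sub>R k\<^sub>p k\<^sub>v T\<^sub>m T\<^sub>M =
     \<lparr> flow_set = {(R, \<eta>, x, \<tau>). rotation_matrix R \<and> \<tau> \<in> {0..T\<^sub>M}},
       flow_map = (\<lambda>(R, \<eta>, x, \<tau>). (R ** skew (- \<eta>), 0, A_mat *v x + delta_g g R, - 1)),
       jump_set = {(R, \<eta>, x, \<tau>). rotation_matrix R \<and> \<tau> = 0},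
       jump_map = (\<lambda>(R, \<eta>, x, \<tau>).
         {(R, k\<^sub>R *\<^sub>R psi (M ** R), (mat 1 - K_mat k\<^sub>p k\<^sub>v ** C_mat) *v x, \<tau>') | \<tau>'. \<tau>' \<in> {T\<^sub>m..T\<^sub>M}}) \<rparr>"

definition target_set :: "real \<Rightarrow> state set" where
  "target_set T\<^sub>M =
     {(R, \<eta>, x, \<tau>). rotation_matrix R \<and> \<tau> \<in> {0..T\<^sub>M} \<and> R = mat 1 \<and> norm \<eta> = 0 \<and> norm x = 0}"

definition target_dist :: "state \<Rightarrow> real" where
  "target_dist = (\<lambda>(R, \<eta>, x, \<tau>). sqrt ((rot_norm R)\<^sup>2 + (norm \<eta>)\<^sup>2 + (norm x)\<^sup>2))"

definition initial_set :: "real \<Rightarrow> real \<Rightarrow> real \<Rightarrow> state set" where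
  "initial_set r h T\<^sub>M =
     {(R, \<eta>, x, \<tau>). rotation_matrix R \<and> \<tau> \<in> {0..T\<^sub>M} \<and> rot_norm R \<le> r \<and> norm \<eta> \<le> h}"

end

theory Submission
  imports Defs
begin

text \<open>
  Between jumps \<^term>\<open>\<eta>\<close> is constant and \<^term>\<open>R\<close> rotates at constant angular velocity, so sampling
  the attitude error at the jumps gives a gradient descent with step size proportional to
  \<^term>\<open>k\<^sub>R\<close> for the potential $V(R) = \mathrm{tr}(M(I-R))$, whose derivative is
  $-2\psi(MR)\cdot\eta$.  Writing $R$ as a unit quaternion $(a,q)$ gives $V = 4\, q\cdot\bar M q$,
  $|R|_I = \|q\|$ and $\|\psi(MR)\| \ge 2|a|\|\bar M q\|$.  The initial condition puts
  $V$ below $4\epsilon^2\lambda_{\min}(\bar M)$, and a short first interval keeps it below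
  $4r\lambda_{\min}(\bar M)$ for some $r<1$; there $a$ stays away from $0$, so for small
  $k_R$ the potential contracts geometrically from jump to jump.  The remaining state is, from jump
  to jump, contracted in the norm of $P$ by $\Xi_P<0$ and perturbed by $O(|R|_I)$, so
  $x\cdot Px + D\,V(R)$ decays geometrically for large $D$.

  Solutions are only absolutely continuous; the fundamental theorem of calculus for such functions
  identifies them with the explicit flow (Rodrigues' formula for $R$), which also shows that a
  bounded hybrid time domain can always be extended.
\<close>

section \<open>Absolutely continuous functions\<close>

text \<open>Sampling just before the jumps closes the recursion: a jump overwrites \<eta> by a
  function of R, so R and x alone determine the next sample and the Lyapunov function needs no term
  in \<eta>. The initial \<eta> acts on the first interval only; that interval may last up to
  \<open>T\<^sub>M\<close>, and its effect is limited by the bound on \<eta>. With lm and lM the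
  extreme eigenvalues, the factor sqrt (lm / lM) in the initial condition turns the upper bound 4 lM
  |R|^2 of V into the level 4 \<epsilon>^2 lm. The level 4 lm is critical: a rotation by pi has a =
  0 and |q| = 1, hence V >= 4 lm, and there the lower bound on psi degenerates; below 4 r lm one has
  a^2 >= 1 - r. The bound on \<open>k\<^sub>R\<close> comes from the attitude alone. The contraction
  factor of V tends to 1 with \<open>k\<^sub>R\<close>, so the weight D is fixed only after
  \<open>k\<^sub>R\<close>. A solution has to lie in the flow set only in the interior of a time
  slice; what holds at the end points is recovered from the explicit flow and the jump rule. Decay
  per jump is decay in t + j because no interval is longer than \<open>T\<^sub>M\<close>.\<close>

lemma abs_cont_fundamental_theorem:
  fixes f :: "real \<Rightarrow> 'a::banach"
  assumes "a \<le> b" and ac: "abs_cont_on_interval a b f" and N: "negligible N"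
    and vecd: "\<And>t. t \<in> {a..b} - N \<Longrightarrow> (f has_vector_derivative f' t) (at t within {a..b})"
  shows "(f' has_integral (f b - f a)) {a..b}"
proof -
  \<comment> \<open>\<open>f'\<close> is arbitrary on N. Replaced by 0 there, it makes the pairs
    tagged in N contribute nothing to the Riemann sum, so only the increments of f over their
    intervals have to be small.\<close>
  define g where "g t = (if t \<in> N then 0 else f' t)" for t
  have "(g has_integral (f b - f a)) (cbox a b)"
  proof (cases "a = b")
    case True
    then show ?thesis by (simp only: diff_self has_integral_refl)
  next
    case False
    with \<open>a \<le> b\<close> have "a < b" by simp
    show ?thesis
      unfolding has_integral_factor_content
    proof safe
      fix e :: real
      assume "e > 0"
      define e' where "e' = e / 2"
      have "e' > 0" using \<open>e > 0\<close> by (simp add: e'_def)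
      have "\<forall>t. \<exists>d>0. t \<in> {a..b} - N \<longrightarrow>
         (\<forall>y\<in>{a..b}. norm (y-t) < d \<longrightarrow> norm (f y - f t - (y-t) *\<^sub>R f' t) \<le> e' * norm (y-t))"
        using vecd[unfolded has_vector_derivative_def has_derivative_within_alt] \<open>e' > 0\<close>
        by (blast intro: zero_less_one)
      then obtain d where d: "\<And>x. 0 < d x"
        "\<And>x y. \<lbrakk>x \<in> {a..b} - N; y \<in> {a..b}; norm (y-x) < d x\<rbrakk>
            \<Longrightarrow> norm (f y - f x - (y-x) *\<^sub>R f' x) \<le> e' * norm (y-x)"
        by metis
      have "e' * (b - a) > 0" using \<open>e' > 0\<close> \<open>a < b\<close> by simp
      then obtain \<delta> where "\<delta> > 0" and \<delta>: "\<And>\<D> T. \<D> division_of T \<Longrightarrow> T \<subseteq> {a..b} \<Longrightarrow>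
          (\<Sum>K\<in>\<D>. Sup K - Inf K) < \<delta> \<Longrightarrow> (\<Sum>K\<in>\<D>. norm (f (Sup K) - f (Inf K))) < e' * (b - a)"
        using ac unfolding abs_cont_on_interval_def by meson
      \<comment> \<open>The gauge will force intervals tagged in N into an open U of measure below
        the \<delta> of absolute continuity, so the increments over them sum to less than
        \<open>e' * (b - a)\<close>. Off N differentiability controls the increments. Each half of
        the division gets \<open>e' = e / 2\<close>.\<close>
      obtain U where U: "open U" "N \<subseteq> U" "U - N \<in> lmeasurable" "emeasure lebesgue (U - N) < ennreal \<delta>"
        using sets_lebesgue_outer_open[of N \<delta>] N \<open>\<delta> > 0\<close> negligible_imp_sets by blast
      have U_eq: "U = (U - N) \<union> N" using U by auto
      have UL: "U \<in> lmeasurable"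
        by (subst U_eq) (intro fmeasurable.Un U negligible_imp_measurable N)
      have "measure lebesgue U = measure lebesgue (U - N)"
        by (simp add: N measure_Diff_null_set negligible_iff_null_sets[symmetric] UL fmeasurableD)
      also have "\<dots> < \<delta>"
        using U(3,4) by (simp add: emeasure_eq_measure2 \<open>\<delta> > 0\<close> ennreal_less_iff)
      finally have mU: "measure lebesgue U < \<delta>" .
      have "\<forall>x. \<exists>r>0. x \<in> N \<longrightarrow> ball x r \<subseteq> U"
        using U by (meson openE subsetD zero_less_one)
      then obtain r where r: "\<And>x. r x > 0" "\<And>x. x \<in> N \<Longrightarrow> ball x (r x) \<subseteq> U"
        by metis
      define \<gamma> where "\<gamma> x = ball x (if x \<in> N then r x else d x)" for x
      show "\<exists>\<gamma>. gauge \<gamma> \<and> (\<forall>p. p tagged_division_of (cbox a b) \<and> \<gamma> fine p \<longrightarrow>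
        norm ((\<Sum>(x, k)\<in>p. measure lborel k *\<^sub>R g x) - (f b - f a)) \<le> e * measure lborel (cbox a b))"
      proof (rule exI, safe)
        show "gauge \<gamma>"
          unfolding \<gamma>_def using d(1) r(1) by (intro gauge_ball_dependent) auto
      next
        fix p
        assume ptag: "p tagged_division_of cbox a b" and finep: "\<gamma> fine p"
        have finp: "finite p" using ptag by blast
        define p1 where "p1 = {(x,K)\<in>p. x \<notin> N}"
        define p2 where "p2 = {(x,K)\<in>p. x \<in> N}"
        have p12: "p = p1 \<union> p2" "p1 \<inter> p2 = {}" by (auto simp: p1_def p2_def)
        have finp12: "finite p1" "finite p2" using finp p12 by auto
        have split: "sum h p = sum h p1 + sum h p2" for h :: "real \<times> real set \<Rightarrow> 'b::comm_monoid_add"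
          using p12 finp12 by (simp add: sum.union_disjoint)
        have ba: "b - a = (\<Sum>(x,K)\<in>p. Sup K - Inf K)" "f b - f a = (\<Sum>(x,K)\<in>p. f(Sup K) - f(Inf K))"
          using additive_tagged_division_1[where f= "\<lambda>x. x"] additive_tagged_division_1[where f= f]
            \<open>a \<le> b\<close> ptag by auto
        have Kint: "\<exists>u v. K = {u..v} \<and> u \<le> v \<and> x \<in> K \<and> K \<subseteq> {a..b}" if xK: "(x,K) \<in> p" for x K
        proof -
          have "x \<in> K" "K \<subseteq> cbox a b" using ptag that by blast+
          moreover obtain u v where "K = cbox u v" using tagged_division_ofD(4)[OF ptag xK] by blast
          ultimately show ?thesis by auto
        qed
        have "norm (\<Sum>(x, K) \<in> p1. (measure lborel K *\<^sub>R g x) - (f (Sup K) - f (Inf K)))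
          \<le> (\<Sum>n\<in>p1. e' * (case n of (x, k) \<Rightarrow> Sup k - Inf k))"
        proof (rule sum_norm_le, safe)
          fix x K
          assume xK1: "(x, K) \<in> p1"
          then have "x \<notin> N" and xK: "(x, K) \<in> p" by (auto simp: p1_def)
          then obtain u v where k: "K = {u..v}" and "x \<in> K" and kab: "K \<subseteq> {a..b}" and "u \<le> v"
            using Kint by blast
          have ball: "\<forall>y\<in>K. y \<in> ball x (d x)"
            using finep xK \<open>x \<notin> N\<close> unfolding fine_def \<gamma>_def by fastforce
          have "u \<in> K" "v \<in> K"
            by (simp_all add: \<open>u \<le> v\<close> k)
          have "norm ((v - u) *\<^sub>R f' x - (f v - f u)) = norm (f u - f x - (u - x) *\<^sub>R f' x - (f v - f x - (v - x) *\<^sub>R f' x))"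
            by (auto simp: algebra_simps)
          also have "\<dots> \<le> norm (f u - f x - (u - x) *\<^sub>R f' x) + norm (f v - f x - (v - x) *\<^sub>R f' x)"
            by (rule norm_triangle_ineq4)
          also have "\<dots> \<le> e' * norm (u - x) + e' * norm (v - x)"
          proof (rule add_mono)
            show "norm (f u - f x - (u - x) *\<^sub>R f' x) \<le> e' * norm (u - x)"
              by (rule d) (use \<open>u \<in> K\<close> \<open>x \<in> K\<close> kab ball \<open>x \<notin> N\<close> in \<open>auto simp: dist_real_def\<close>)
            show "norm (f v - f x - (v - x) *\<^sub>R f' x) \<le> e' * norm (v - x)"
              by (rule d) (use \<open>v \<in> K\<close> \<open>x \<in> K\<close> kab ball \<open>x \<notin> N\<close> in \<open>auto simp: dist_real_def\<close>)
          qed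
          also have "\<dots> = e' * (Sup K - Inf K)"
            using \<open>x \<in> K\<close> \<open>u \<le> v\<close> by (auto simp: k field_simps)
          finally show "norm (measure lborel K *\<^sub>R g x - (f (Sup K) - f (Inf K))) \<le> e' * (Sup K - Inf K)"
            using \<open>u \<le> v\<close> \<open>x \<notin> N\<close> by (simp add: k g_def)
        qed
        also have "\<dots> \<le> (\<Sum>n\<in>p. e' * (case n of (x, k) \<Rightarrow> Sup k - Inf k))"
        proof (rule sum_mono2[OF finp])
          fix n assume "n \<in> p - p1"
          then obtain u v where "snd n = {u..v}" "u \<le> v"
            using Kint[of "fst n" "snd n"] by auto
          then show "0 \<le> e' * (case n of (x, k) \<Rightarrow> Sup k - Inf k)"
            using \<open>e' > 0\<close> by (simp add: case_prod_beta)
        qed (use p12 in auto)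
        also have "\<dots> = e' * (b - a)"
          unfolding ba sum_distrib_left ..
        finally have 1: "norm (\<Sum>(x, K) \<in> p1. (measure lborel K *\<^sub>R g x) - (f (Sup K) - f (Inf K))) \<le> e' * (b - a)" .
        have p2tag: "p2 tagged_division_of (\<Union>(snd ` p2))"
          by (rule tagged_partial_division_of_Union_self)
            (use tagged_partial_division_subset[of p "cbox a b" p2] ptag p12 in \<open>auto simp: tagged_division_of_def\<close>)
        \<comment> \<open>Two tagged pairs may share an interval; passing to bare intervals is
          harmless for functions that vanish on degenerate ones. The guard for \<open>{}\<close>
          below is there because \<open>Sup {}\<close> and \<open>Inf {}\<close> have no prescribed
          value.\<close>
        have over: "sum (\<lambda>(x,K). h K) p2 = sum h (snd ` p2)"
          if "\<And>u. h {u} = 0" "h {} = 0" for h :: "real set \<Rightarrow> real"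
        proof (rule sum.over_tagged_division_lemma[OF p2tag])
          fix u v :: real assume "box u v = {}"
          then show "h (cbox u v) = 0" using that by (cases "u = v") auto
        qed
        have div: "snd ` p2 division_of (\<Union>(snd ` p2))"
          using division_of_tagged_division[OF p2tag] .
        have Kint2: "\<exists>u v. snd n = {u..v} \<and> u \<le> v" if "n \<in> p2" for n
          using that Kint[of "fst n" "snd n"] by (auto simp: p2_def)
        have sub: "\<Union>(snd ` p2) \<subseteq> {a..b}"
          using Kint by (auto simp: p2_def dest!: Kint)
        have subU: "\<Union>(snd ` p2) \<subseteq> U"
        proof safe
          fix y x K assume "(x,K) \<in> p2" "y \<in> snd (x,K)"
          then have "x \<in> N" "y \<in> \<gamma> x" using finep by (auto simp: p2_def fine_def)
          then show "y \<in> U" using r(2)[of x] by (auto simp: \<gamma>_def)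
        qed
        have "(\<Sum>K\<in>snd ` p2. Sup K - Inf K) = (\<Sum>K\<in>snd ` p2. measure lebesgue K)"
          by (rule sum.cong) (use Kint2 in force)+
        also have "\<dots> = measure lebesgue (\<Union>(snd ` p2))"
          by (rule content_division[OF div])
        also have "\<dots> \<le> measure lebesgue U"
          by (intro measure_mono_fmeasurable subU UL fmeasurableD lmeasurable_division[OF div])
        finally have "(\<Sum>K\<in>snd ` p2. norm (f (Sup K) - f (Inf K))) < e' * (b - a)"
          using \<delta>[OF div sub] mU by linarith
        moreover have "(\<Sum>(x,K)\<in>p2. norm (f (Sup K) - f (Inf K)))
            = (\<Sum>(x,K)\<in>p2. if K = {} then 0 else norm (f (Sup K) - f (Inf K)))"
          by (rule sum.cong) (use Kint2 in force)+
        moreover have "\<dots> = (\<Sum>K\<in>snd ` p2. if K = {} then 0 else norm (f (Sup K) - f (Inf K)))"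
          by (rule over) auto
        moreover have "\<dots> = (\<Sum>K\<in>snd ` p2. norm (f (Sup K) - f (Inf K)))"
          by (rule sum.cong) (use Kint2 in force)+
        ultimately have 2: "(\<Sum>(x,K)\<in>p2. norm (f (Sup K) - f (Inf K))) < e' * (b - a)"
          by simp
        have "norm (\<Sum>(x, K) \<in> p2. (measure lborel K *\<^sub>R g x) - (f (Sup K) - f (Inf K)))
            \<le> (\<Sum>(x,K)\<in>p2. norm (f (Sup K) - f (Inf K)))"
          by (rule sum_norm_le) (auto simp: p2_def g_def norm_minus_commute)
        with 1 2 have "norm (\<Sum>(x, K) \<in> p. (measure lborel K *\<^sub>R g x) - (f (Sup K) - f (Inf K))) \<le> e * (b - a)"
          unfolding split[of "\<lambda>(x, K). (measure lborel K *\<^sub>R g x) - (f (Sup K) - f (Inf K))"] e'_def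
          by (intro order.trans[OF norm_triangle_ineq]) (simp add: algebra_simps)
        then show "norm ((\<Sum>(x, K)\<in>p. measure lborel K *\<^sub>R g x) - (f b - f a)) \<le> e * measure lborel (cbox a b)"
          using \<open>a \<le> b\<close> by (simp add: ba(2) split_def sum_subtractf [symmetric])
      qed
    qed
  qed
  then show ?thesis
    using N by (auto intro: has_integral_spike[of N _ f' g] simp: g_def)
qed

lemma abs_cont_on_intervalD:
  assumes "abs_cont_on_interval a b f" "e > 0"
  obtains d where "d > 0"
    "\<And>s t. a \<le> s \<Longrightarrow> s \<le> t \<Longrightarrow> t \<le> b \<Longrightarrow> t - s < d \<Longrightarrow> norm (f t - f s) < e"
proof -
  obtain d where "d > 0" and d: "\<And>\<D> T. \<D> division_of T \<Longrightarrow> T \<subseteq> {a..b} \<Longrightarrow>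
        (\<Sum>K\<in>\<D>. Sup K - Inf K) < d \<Longrightarrow> (\<Sum>K\<in>\<D>. norm (f (Sup K) - f (Inf K))) < e"
    using assms unfolding abs_cont_on_interval_def by meson
  have "norm (f t - f s) < e" if "a \<le> s" "s \<le> t" "t \<le> b" "t - s < d" for s t
    using d[of "{{s..t}}" "{s..t}"] that division_of_self[of s t] by auto
  with that \<open>d > 0\<close> show thesis by blast
qed

lemma abs_cont_on_interval_imp_continuous:
  assumes "abs_cont_on_interval a b f"
  shows "continuous_on {a..b} f"
  unfolding continuous_on_iff
proof (intro ballI allI impI)
  fix s e assume "s \<in> {a..b}" "(0::real) < e"
  obtain d where "d > 0"
    and d: "\<And>s t. a \<le> s \<Longrightarrow> s \<le> t \<Longrightarrow> t \<le> b \<Longrightarrow> t - s < d \<Longrightarrow> norm (f t - f s) < e"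
    using abs_cont_on_intervalD[OF assms \<open>0 < e\<close>] by blast
  have "dist (f t) (f s) < e" if "t \<in> {a..b}" "dist t s < d" for t
    using d[of s t] d[of t s] that \<open>s \<in> {a..b}\<close>
    by (cases "s \<le> t") (auto simp: dist_norm norm_minus_commute)
  with \<open>d > 0\<close> show "\<exists>d>0. \<forall>t\<in>{a..b}. dist t s < d \<longrightarrow> dist (f t) (f s) < e" by blast
qed

lemma abs_cont_on_interval_subset:
  assumes "abs_cont_on_interval a b f" "{c..d} \<subseteq> {a..b}"
  shows "abs_cont_on_interval c d f"
  using assms unfolding abs_cont_on_interval_def by (meson order_trans)

text \<open>By the fundamental theorem f is its initial value plus the integral of
  \<open>F (f t)\<close>. That integrand is continuous, so the integral is differentiable everywhere
  and the exceptional null set disappears.\<close>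

lemma abs_cont_solution_classical:
  fixes f :: "real \<Rightarrow> 'a::banach"
  assumes ac: "abs_cont_on_interval a b f"
    and ae: "AE t in lebesgue. t \<in> {a..b} \<longrightarrow> (f has_vector_derivative F (f t)) (at t within {a..b})"
    and F: "continuous_on UNIV F" and t: "t \<in> {a..b}"
  shows "(f has_vector_derivative F (f t)) (at t within {a..b})"
proof -
  obtain N where N: "N \<in> null_sets lebesgue"
    "\<And>t. t \<in> {a..b} - N \<Longrightarrow> (f has_vector_derivative F (f t)) (at t within {a..b})"
    using ae by (auto elim!: AE_E3)
  have cont: "continuous_on {a..b} (\<lambda>t. F (f t))"
    using abs_cont_on_interval_imp_continuous[OF ac] F
    by (metis continuous_on_compose2 subset_UNIV)
  have int: "((\<lambda>t. F (f t)) has_integral (f c - f a)) {a..c}" if "c \<in> {a..b}" for c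
  proof (rule abs_cont_fundamental_theorem)
    show "abs_cont_on_interval a c f"
      using that by (intro abs_cont_on_interval_subset[OF ac]) auto
    show "negligible N" using N(1) by (simp add: negligible_iff_null_sets)
    show "(f has_vector_derivative F (f t)) (at t within {a..c})" if "t \<in> {a..c} - N" for t
      by (rule has_vector_derivative_within_subset[OF N(2)]) (use that \<open>c \<in> {a..b}\<close> in auto)
  qed (use that in auto)
  have "((\<lambda>c. f a + integral {a..c} (\<lambda>t. F (f t))) has_vector_derivative 0 + F (f t)) (at t within {a..b})"
    by (intro derivative_intros integral_has_vector_derivative cont t)
  then have "((\<lambda>c. f a + integral {a..c} (\<lambda>t. F (f t))) has_vector_derivative F (f t)) (at t within {a..b})"
    by simp
  then show ?thesis
    by (rule has_vector_derivative_transform[OF t, rotated]) (use integral_unique[OF int] in auto)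
qed

text \<open>The derivative is bounded by some B on the compact interval, so f is Lipschitz and
  \<delta> = e / B works. This certifies the explicit flow as an admissible arc when solutions are
  extended.\<close>

lemma C1_abs_cont:
  fixes f :: "real \<Rightarrow> 'a::banach"
  assumes f: "\<And>t. t \<in> {a..b} \<Longrightarrow> (f has_vector_derivative f' t) (at t within {a..b})"
    and cont: "continuous_on {a..b} f'"
  shows "abs_cont_on_interval a b f"
proof -
  have "bounded (f' ` {a..b})"
    by (intro compact_imp_bounded compact_continuous_image cont) auto
  then obtain B where "B > 0" and B: "\<And>t. t \<in> {a..b} \<Longrightarrow> norm (f' t) \<le> B"
    by (auto simp: bounded_pos)
  have lip: "norm (f t - f s) \<le> B * (t - s)" if "s \<le> t" "{s..t} \<subseteq> {a..b}" for s t
  proof -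
    have "(f' has_integral (f t - f s)) {s..t}"
      by (rule fundamental_theorem_of_calculus)
        (use that in \<open>auto intro!: has_vector_derivative_within_subset[OF f]\<close>)
    then show ?thesis
      using has_integral_bound[of B f' "f t - f s" s t] B that \<open>B > 0\<close> by (auto simp: subset_iff)
  qed
  show ?thesis
    unfolding abs_cont_on_interval_def
  proof (intro allI impI)
    fix e :: real assume "e > 0"
    have "(\<Sum>K\<in>\<D>. norm (f (Sup K) - f (Inf K))) < e"
      if "\<D> division_of T \<and> T \<subseteq> {a..b} \<and> (\<Sum>K\<in>\<D>. Sup K - Inf K) < e / B" for \<D> T
    proof -
      have "(\<Sum>K\<in>\<D>. norm (f (Sup K) - f (Inf K))) \<le> (\<Sum>K\<in>\<D>. B * (Sup K - Inf K))"
      proof (rule sum_mono)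
        fix K assume "K \<in> \<D>"
        have "\<D> division_of T" "T \<subseteq> {a..b}" using that by auto
        obtain u v where "K = {u..v}"
          using division_ofD(4)[OF \<open>\<D> division_of T\<close> \<open>K \<in> \<D>\<close>] by auto
        moreover have "K \<noteq> {}" "K \<subseteq> {a..b}"
          using division_ofD(2,3)[OF \<open>\<D> division_of T\<close> \<open>K \<in> \<D>\<close>] \<open>T \<subseteq> {a..b}\<close> by auto
        ultimately show "norm (f (Sup K) - f (Inf K)) \<le> B * (Sup K - Inf K)"
          using lip[of u v] by simp
      qed
      also have "\<dots> = B * (\<Sum>K\<in>\<D>. Sup K - Inf K)" by (simp add: sum_distrib_left)
      also have "\<dots> < e" using that \<open>B > 0\<close> by (simp add: field_simps)
      finally show ?thesis .
    qed
    then show "\<exists>\<delta>>0. \<forall>\<D> T. \<D> division_of T \<and> T \<subseteq> {a..b} \<and> (\<Sum>K\<in>\<D>. Sup K - Inf K) < \<delta> \<longrightarrow>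
        (\<Sum>K\<in>\<D>. norm (f (Sup K) - f (Inf K))) < e"
      using \<open>e > 0\<close> \<open>B > 0\<close> by (intro exI[of _ "e / B"]) auto
  qed
qed

section \<open>Rotations and quaternions\<close>

lemma bounded_bilinear_matrix_mult:
  "bounded_bilinear ((**) :: real^'n^'m \<Rightarrow> real^'p^'n \<Rightarrow> real^'p^'m)"
proof -
  have "bilinear ((**) :: real^'n^'m \<Rightarrow> real^'p^'n \<Rightarrow> real^'p^'m)"
    unfolding bilinear_def
    by (auto intro!: linearI simp: vec_eq_iff matrix_matrix_mult_def algebra_simps sum.distrib sum_distrib_left)
  then show ?thesis by (simp add: bilinear_conv_bounded_bilinear)
qed

interpretation mat_mult: bounded_bilinear "(**) :: real^'n^'m \<Rightarrow> real^'p^'n \<Rightarrow> real^'p^'m"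
  by (rule bounded_bilinear_matrix_mult)


lemma skew_component:
  "skew x $ 1 $ 1 = 0" "skew x $ 1 $ 2 = - x$3" "skew x $ 1 $ 3 = x$2"
  "skew x $ 2 $ 1 = x$3" "skew x $ 2 $ 2 = 0" "skew x $ 2 $ 3 = - x$1"
  "skew x $ 3 $ 1 = - x$2" "skew x $ 3 $ 2 = x$1" "skew x $ 3 $ 3 = 0"
  by (simp_all add: skew_def matrix_def cross3_def axis_def)

lemma psi_component:
  "psi B $ 1 = (B$3$2 - B$2$3) / 2" "psi B $ 2 = (B$1$3 - B$3$1) / 2" "psi B $ 3 = (B$2$1 - B$1$2) / 2"
  by (simp_all add: psi_def)

lemmas mat3_simps = skew_component psi_component vec_eq_iff forall_3 matrix_matrix_mult_def sum_3
  mat_def trace_def transpose_def inner_vec_def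

text \<open>The Euler-Rodrigues matrix of the quaternion with scalar part a and vector part q, in
  homogeneous form: with a^2 - |q|^2 in place of 1 - 2 |q|^2, its product with its transpose is (a^2
  + |q|^2)^2 times the identity for all a and q.\<close>

definition quat_mat :: "real \<Rightarrow> real^3 \<Rightarrow> real^3^3" where
  "quat_mat a q = (a\<^sup>2 - q \<bullet> q) *\<^sub>R mat 1 + 2 *\<^sub>R outer q + (2 * a) *\<^sub>R skew q"

lemma outer_component [simp]: "outer v $ i $ j = v $ i * v $ j"
  by (simp add: outer_def columnvector_def rowvector_def matrix_matrix_mult_def)

lemma rotation_matrix_3:
  fixes R :: "real^3^3"
  shows "rotation_matrix R \<longleftrightarrow>
    R ** transpose R = mat 1 \<and> det R = 1"
  by (auto simp: rotation_matrix_def orthogonal_matrix_def matrix_left_right_inverse)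

lemma rotation_quat_mat:
  assumes "a\<^sup>2 + q \<bullet> q = 1"
  shows "rotation_matrix (quat_mat a q)"
proof -
  obtain x y z where xyz: "x = q$1" "y = q$2" "z = q$3" by blast
  have "quat_mat a q ** transpose (quat_mat a q) = (a\<^sup>2 + q \<bullet> q)\<^sup>2 *\<^sub>R mat 1"
    unfolding quat_mat_def
    by (simp add: mat3_simps flip: xyz) (intro conjI; algebra)
  moreover have "det (quat_mat a q) = (a\<^sup>2 + q \<bullet> q)^3"
    by (simp add: quat_mat_def det_3 mat3_simps flip: xyz) algebra
  ultimately show ?thesis using assms by (simp add: rotation_matrix_3)
qed


text \<open>A rotation commutes with the cross product; applied to pairs of basis vectors this says
  that R is its own cofactor matrix. These nine equations encode det R = 1, which the orthogonality
  relations alone do not.\<close>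

lemma rotation_matrix_cofactors:
  fixes R :: "real^3^3"
  assumes "rotation_matrix R"
  shows "R$1$1 = R$2$2 * R$3$3 - R$2$3 * R$3$2" "R$1$2 = R$2$3 * R$3$1 - R$2$1 * R$3$3"
    "R$1$3 = R$2$1 * R$3$2 - R$2$2 * R$3$1" "R$2$1 = R$3$2 * R$1$3 - R$3$3 * R$1$2"
    "R$2$2 = R$3$3 * R$1$1 - R$3$1 * R$1$3" "R$2$3 = R$3$1 * R$1$2 - R$3$2 * R$1$1"
    "R$3$1 = R$1$2 * R$2$3 - R$1$3 * R$2$2" "R$3$2 = R$1$3 * R$2$1 - R$1$1 * R$2$3"
    "R$3$3 = R$1$1 * R$2$2 - R$1$2 * R$2$1"
proof -
  have "cross3 (R *v axis i 1) (R *v axis j 1) = R *v cross3 (axis i 1) (axis j 1)" for i j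
    by (rule cross_rotation_matrix[OF assms])
  from this[of 2 3] this[of 3 1] this[of 1 2]
  show "R$1$1 = R$2$2 * R$3$3 - R$2$3 * R$3$2" "R$1$2 = R$2$3 * R$3$1 - R$2$1 * R$3$3"
    "R$1$3 = R$2$1 * R$3$2 - R$2$2 * R$3$1" "R$2$1 = R$3$2 * R$1$3 - R$3$3 * R$1$2"
    "R$2$2 = R$3$3 * R$1$1 - R$3$1 * R$1$3" "R$2$3 = R$3$1 * R$1$2 - R$3$2 * R$1$1"
    "R$3$1 = R$1$2 * R$2$3 - R$1$3 * R$2$2" "R$3$2 = R$1$3 * R$2$1 - R$1$1 * R$2$3"
    "R$3$3 = R$1$1 * R$2$2 - R$1$2 * R$2$1"
    by (simp_all add: cross_basis vec_eq_iff forall_3 cross3_def matrix_vector_mul_component inner_vec_def sum_3 axis_def algebra_simps)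
qed

lemma rotation_eq_quat_mat:
  fixes R :: "real^3^3"
  assumes "rotation_matrix R"
  obtains a q where "a\<^sup>2 + q \<bullet> q = 1" "R = quat_mat a q"
proof -
  obtain a b c d e f g h i where abc: "a = R$1$1" "b = R$1$2" "c = R$1$3" "d = R$2$1" "e = R$2$2" "f = R$2$3"
    "g = R$3$1" "h = R$3$2" "i = R$3$3" by blast
  have orth: "R ** transpose R = mat 1" "transpose R ** R = mat 1"
    using assms by (auto simp: rotation_matrix_def orthogonal_matrix_def)
  have row: "(\<Sum>k\<in>UNIV. R$i$k * R$j$k) = (if i = j then 1 else 0)" for i j
    using arg_cong[OF orth(1), of "\<lambda>M. M$i$j"] by (simp add: matrix_matrix_mult_def transpose_def mat_def)
  have col: "(\<Sum>k\<in>UNIV. R$k$i * R$k$j) = (if i = j then 1 else 0)" for i j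
    using arg_cong[OF orth(2), of "\<lambda>M. M$i$j"] by (simp add: matrix_matrix_mult_def transpose_def mat_def)
  have r1: "a * a + b * b + c * c = 1" and r2: "d * d + e * e + f * f = 1" and r3: "g * g + h * h + i * i = 1"
    and r12: "a * d + b * e + c * f = 0" and r13: "a * g + b * h + c * i = 0" and r23: "d * g + e * h + f * i = 0"
    using row[of 1 1] row[of 2 2] row[of 3 3] row[of 1 2] row[of 1 3] row[of 2 3] unfolding abc sum_3 by simp_all
  have c1: "a * a + d * d + g * g = 1" and c2: "b * b + e * e + h * h = 1"
    and c12: "a * b + d * e + g * h = 0" and c13: "a * c + d * f + g * i = 0" and c23: "b * c + e * f + h * i = 0"
    using col[of 1 1] col[of 2 2] col[of 1 2] col[of 1 3] col[of 2 3] unfolding abc sum_3 by simp_all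
  have ka: "a = e * i - f * h" and kb: "b = f * g - d * i" and kc: "c = d * h - e * g"
    and kd: "d = h * c - i * b" and ke: "e = i * a - g * c" and kf: "f = g * b - h * a"
    and kg: "g = b * f - c * e" and kh: "h = c * d - a * f" and ki: "i = a * e - b * d"
    unfolding abc by (fact rotation_matrix_cofactors[OF assms])+
  txt \<open>\<open>K\<close> is four times the matrix of products $x_i x_j$ of the sought unit quaternion.  Its
    $2\times2$ minors vanish on $SO(3)$, so each row with positive diagonal entry determines
    \<open>x\<close> up to sign, and one such row exists because the trace is 4.\<close>
  define K00 K11 K22 K33 where K: "K00 = 1 + a + e + i" "K11 = 1 + a - e - i" "K22 = 1 - a + e - i" "K33 = 1 - a - e + i"
  define K01 K02 K03 K12 K13 K23 where K': "K01 = h - f" "K02 = c - g" "K03 = d - b"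
    "K12 = b + d" "K13 = c + g" "K23 = f + h"
  note KK = K K'
  have "K01 * K01 = K00 * K11"
    unfolding KK using r2 r3 c1 ka by algebra
  moreover have "K02 * K02 = K00 * K22"
    unfolding KK using r1 r3 c2 ke by algebra
  moreover have "K03 * K03 = K00 * K33"
    unfolding KK using r3 c1 c2 ki by algebra
  moreover have "K01 * K02 = K00 * K12"
    unfolding KK using r12 c12 kb kd by algebra
  moreover have "K01 * K03 = K00 * K13"
    unfolding KK using r13 c13 kc kg by algebra
  moreover have "K02 * K03 = K00 * K23"
    unfolding KK using r23 c23 kf kh by algebra
  moreover have "K12 * K12 = K11 * K22"
    unfolding KK using r3 c1 c2 ki by algebra
  moreover have "K13 * K13 = K11 * K33"
    unfolding KK using r1 r3 c2 ke by algebra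
  moreover have "K01 * K12 = K11 * K02"
    unfolding KK using r13 c13 kc kg by algebra
  moreover have "K01 * K13 = K11 * K03"
    unfolding KK using r12 c12 kb kd by algebra
  moreover have "K12 * K13 = K11 * K23"
    unfolding KK using r23 c23 kf kh by algebra
  moreover have "K23 * K23 = K22 * K33"
    unfolding KK using r2 r3 c1 ka by algebra
  moreover have "K02 * K12 = K22 * K01"
    unfolding KK using r23 c23 kf kh by algebra
  moreover have "K02 * K23 = K22 * K03"
    unfolding KK using r12 c12 kb kd by algebra
  moreover have "K12 * K23 = K22 * K13"
    unfolding KK using r13 c13 kc kg by algebra
  moreover have "K03 * K13 = K33 * K01"
    unfolding KK using r23 c23 kf kh by algebra
  moreover have "K03 * K23 = K33 * K02"
    unfolding KK using r13 c13 kc kg by algebra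
  moreover have "K13 * K23 = K33 * K12"
    unfolding KK using r12 c12 kb kd by algebra
  ultimately have minors:
    "K01 * K01 = K00 * K11"
    "K02 * K02 = K00 * K22"
    "K03 * K03 = K00 * K33"
    "K01 * K02 = K00 * K12"
    "K01 * K03 = K00 * K13"
    "K02 * K03 = K00 * K23"
    "K12 * K12 = K11 * K22"
    "K13 * K13 = K11 * K33"
    "K01 * K12 = K11 * K02"
    "K01 * K13 = K11 * K03"
    "K12 * K13 = K11 * K23"
    "K23 * K23 = K22 * K33"
    "K02 * K12 = K22 * K01"
    "K02 * K23 = K22 * K03"
    "K12 * K23 = K22 * K13"
    "K03 * K13 = K33 * K01"
    "K03 * K23 = K33 * K02"
    "K13 * K23 = K33 * K12"
    by blast+
  note witness = that
  have key: thesis if "4 * (x0 * x0) = K00" "4 * (x1 * x1) = K11" "4 * (x2 * x2) = K22" "4 * (x3 * x3) = K33"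
      "4 * (x0 * x1) = K01" "4 * (x0 * x2) = K02" "4 * (x0 * x3) = K03" 
      "4 * (x1 * x2) = K12" "4 * (x1 * x3) = K13" "4 * (x2 * x3) = K23" for x0 x1 x2 x3
  proof (rule witness[of x0 "vector [x1,x2,x3]"])
    show "x0\<^sup>2 + vector [x1,x2,x3] \<bullet> (vector [x1,x2,x3] :: real^3) = 1"
      using that unfolding KK by (simp add: inner_vec_def sum_3 power2_eq_square)
    show "R = quat_mat x0 (vector [x1,x2,x3])"
      using that unfolding KK by (simp add: quat_mat_def mat3_simps flip: abc) (simp add: power2_eq_square mult.commute mult.left_commute)
  qed
  \<comment> \<open>A row of the matrix with pivot k, divided by 2 * sqrt k, is the quaternion: for
    two entries u, v of that row, the vanishing minor u * v = k * w says that four times the product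
    of the two components is the entry w.\<close>
  have div: "4 * (u / (2 * sqrt k) * (v / (2 * sqrt k))) = w" if "u * v = k * w" "k > 0" for u v w k :: real
    using that by (simp add: field_simps)
  have "K00 + K11 + K22 + K33 = 4" by (simp add: K)
  then consider "K00 > 0" | "K11 > 0" | "K22 > 0" | "K33 > 0" by linarith
  then show thesis
  proof cases
    case 1
    show thesis
      by (rule key[of "K00 / (2 * sqrt K00)" "K01 / (2 * sqrt K00)" "K02 / (2 * sqrt K00)" "K03 / (2 * sqrt K00)"]; rule div[OF _ 1])
        (use minors in \<open>simp_all add: mult.commute\<close>)
  next
    case 2
    show thesis
      by (rule key[of "K01 / (2 * sqrt K11)" "K11 / (2 * sqrt K11)" "K12 / (2 * sqrt K11)" "K13 / (2 * sqrt K11)"]; rule div[OF _ 2])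
        (use minors in \<open>simp_all add: mult.commute\<close>)
  next
    case 3
    show thesis
      by (rule key[of "K02 / (2 * sqrt K22)" "K12 / (2 * sqrt K22)" "K22 / (2 * sqrt K22)" "K23 / (2 * sqrt K22)"]; rule div[OF _ 3])
        (use minors in \<open>simp_all add: mult.commute\<close>)
  next
    case 4
    show thesis
      by (rule key[of "K03 / (2 * sqrt K33)" "K13 / (2 * sqrt K33)" "K23 / (2 * sqrt K33)" "K33 / (2 * sqrt K33)"]; rule div[OF _ 4])
        (use minors in \<open>simp_all add: mult.commute\<close>)
  qed
qed

section \<open>Rodrigues' formula\<close>

lemma skew_minus [simp]: "skew (- x) = - skew x"
  by (simp add: mat3_simps)

lemma skew_0 [simp]: "skew 0 = 0"
  by (simp add: mat3_simps)

lemma skew_scaleR: "skew (c *\<^sub>R x) = c *\<^sub>R skew x"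
  by (simp add: mat3_simps)

lemma transpose_skew: "transpose (skew x) = - skew x"
  by (simp add: mat3_simps)

lemma skew_square: "skew x ** skew x = outer x - (x \<bullet> x) *\<^sub>R mat 1"
  by (simp add: mat3_simps algebra_simps)

lemma skew_cube: "skew x ** skew x ** skew x = - (x \<bullet> x) *\<^sub>R skew x"
  by (simp add: mat3_simps algebra_simps)

text \<open>This is exp (t * skew w). The axis \<open>sgn w\<close> covers w = 0 without a separate
  clause, since \<open>sgn 0 = 0\<close>.\<close>

definition rot :: "real^3 \<Rightarrow> real \<Rightarrow> real^3^3" where
  "rot w t = mat 1 + sin (norm w * t) *\<^sub>R skew (sgn w)
     + (1 - cos (norm w * t)) *\<^sub>R (skew (sgn w) ** skew (sgn w))"

lemma rot_0 [simp]: "rot w 0 = mat 1"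
  by (simp add: rot_def)

lemma sgn_dot_self: "sgn w \<bullet> sgn w = (if w = 0 then 0 else 1)" for w :: "'a::real_inner"
  by (simp add: dot_square_norm norm_sgn)

lemma rot_has_vector_derivative:
  "(rot w has_vector_derivative rot w t ** skew w) (at t within S)"
proof -
  let ?X = "skew (sgn w)"
  have w: "skew w = norm w *\<^sub>R ?X"
    by (cases "w = 0") (simp_all add: sgn_div_norm skew_0 flip: skew_scaleR)
  \<comment> \<open>This relation folds the cubic term of the product back: in X + (1 - cos) X^3 the
    ones cancel and cos X remains.\<close>
  have X3: "?X ** ?X ** ?X = - ?X" if "w \<noteq> 0"
    using that by (simp add: skew_cube sgn_dot_self)
  have "((\<lambda>t. sin (norm w * t) *\<^sub>R ?X + (1 - cos (norm w * t)) *\<^sub>R (?X ** ?X))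
       has_vector_derivative (cos (norm w * t) * norm w) *\<^sub>R ?X + (sin (norm w * t) * norm w) *\<^sub>R (?X ** ?X)) (at t within S)"
    by (rule derivative_eq_intros refl | simp)+
  then have "((\<lambda>t. sin (norm w * t) *\<^sub>R ?X + (1 - cos (norm w * t)) *\<^sub>R (?X ** ?X) + mat 1) has_vector_derivative (cos (norm w * t) * norm w) *\<^sub>R ?X + (sin (norm w * t) * norm w) *\<^sub>R (?X ** ?X)) (at t within S)"
    unfolding has_vector_derivative_add_const .
  also have "(\<lambda>t. sin (norm w * t) *\<^sub>R ?X + (1 - cos (norm w * t)) *\<^sub>R (?X ** ?X) + mat 1) = rot w"
    by (simp add: rot_def fun_eq_iff algebra_simps)
  also have "(cos (norm w * t) * norm w) *\<^sub>R ?X + (sin (norm w * t) * norm w) *\<^sub>R (?X ** ?X) = rot w t ** skew w"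
    using X3 by (cases "w = 0") (simp_all add: rot_def w mat_mult.add_left mat_mult.diff_left
        mat_mult.scaleR_left mat_mult.scaleR_right matrix_mul_lid algebra_simps)
  finally show ?thesis .
qed

text \<open>The quaternion is the half-angle one, with scalar part cos (|w| t / 2) and vector part
  sin (|w| t / 2) \<open>sgn w\<close>. For w = 0 the angle vanishes together with the axis, so it
  still has norm 1.\<close>

lemma rotation_rot: "rotation_matrix (rot w t)"
proof -
  let ?s = "norm w * t / 2"
  let ?q = "sin ?s *\<^sub>R sgn w"
  have q: "?q \<bullet> ?q = (sin ?s)\<^sup>2"
    by (simp add: sgn_dot_self power2_eq_square)
  have "rot w t = quat_mat (cos ?s) ?q"
  proof -
    have c: "sin (norm w * t) = 2 * sin ?s * cos ?s" "cos (norm w * t) = 1 - 2 * (sin ?s)\<^sup>2"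
      using sin_double[of ?s] cos_double_sin[of ?s] by simp_all
    have o: "outer ?q = (sin ?s)\<^sup>2 *\<^sub>R outer (sgn w)"
      by (simp add: vec_eq_iff power2_eq_square)
    show ?thesis
      unfolding rot_def quat_mat_def q skew_square skew_scaleR sgn_dot_self c o
      by (cases "w = 0") (auto simp: algebra_simps cos_squared_eq scaleR_2)
  qed
  also have "rotation_matrix \<dots>"
    by (rule rotation_quat_mat) (simp only: q sin_cos_squared_add2)
  finally show ?thesis .
qed

lemma rot_transpose_mult [simp]: "rot w t ** transpose (rot w t) = mat 1" "transpose (rot w t) ** rot w t = mat 1"
  using rotation_rot[of w t] by (auto simp: rotation_matrix_def orthogonal_matrix_def)

section \<open>The landmark potential\<close>

lemma symmetric_matrix_inner:
  fixes B :: "real^'n^'n"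
  assumes "transpose B = B"
  shows "x \<bullet> (B *v y) = (B *v x) \<bullet> y"
  by (metis assms dot_lmul_matrix transpose_matrix_vector)

text \<open>u minimises the form, so the gradient has to vanish. Along u + t w with w = B u the form
  equals 2 t |w|^2 + t^2 b, which is negative for small negative t unless w = 0.\<close>

lemma psd_form_zero_imp_null:
  fixes B :: "real^'n^'n"
  assumes sym: "transpose B = B" and psd: "\<And>x. 0 \<le> x \<bullet> (B *v x)" and u: "u \<bullet> (B *v u) = 0"
  shows "B *v u = 0"
proof -
  define w where "w = B *v u"
  define b where "b = w \<bullet> (B *v w)"
  have "0 \<le> (u + t *\<^sub>R w) \<bullet> (B *v (u + t *\<^sub>R w))" for t by (rule psd)
  then have *: "0 \<le> 2 * t * (w \<bullet> w) + t\<^sup>2 * b" for t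
    using u symmetric_matrix_inner[OF sym, of u w]
    by (simp add: matrix_vector_right_distrib inner_add inner_commute power2_eq_square b_def
        algebra_simps matrix_vector_mult_scaleR flip: w_def)
  have "b \<ge> 0" unfolding b_def by (rule psd)
  have "w \<bullet> w \<le> 0"
  proof (rule ccontr)
    assume "\<not> w \<bullet> w \<le> 0"
    then have w: "w \<bullet> w > 0" by linarith
    \<comment> \<open>The minimiser of the parabola would be t = - |w|^2 / b; b + 1 in the
      denominator avoids division by zero and still gives a negative value.\<close>
    have "0 \<le> 2 * (- (w \<bullet> w) / (b + 1)) * (w \<bullet> w) + (- (w \<bullet> w) / (b + 1))\<^sup>2 * b" by (rule *)
    also have "\<dots> = ((w \<bullet> w) / (b + 1))\<^sup>2 * (b - 2 * (b + 1))"
    proof -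
      define r where "r = (w \<bullet> w) / (b + 1)"
      then have "w \<bullet> w = r * (b + 1)" using \<open>b \<ge> 0\<close> by simp
      then show ?thesis
        unfolding minus_divide_left[symmetric] r_def[symmetric] by (simp add: algebra_simps power2_eq_square)
    qed
    also have "\<dots> < 0"
    proof (rule mult_pos_neg)
      show "0 < ((w \<bullet> w) / (b + 1))\<^sup>2" by (intro zero_less_power divide_pos_pos w) (use \<open>b \<ge> 0\<close> in simp)
    qed (use \<open>b \<ge> 0\<close> in auto)
    finally show False by simp
  qed
  then show ?thesis unfolding w_def by (metis inner_ge_zero inner_eq_zero_iff antisym)
qed

text \<open>\<open>Min\<close> and \<open>Max\<close> of the set of eigenvalues are meaningful only
  if it is finite. Eigenvectors of distinct eigenvalues are orthogonal, hence independent, hence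
  finite in number.\<close>

lemma finite_eigenvalues_symmetric:
  fixes B :: "real^'n^'n"
  assumes sym: "transpose B = B"
  shows "finite (eigenvalues B)"
proof -
  have "\<forall>l\<in>eigenvalues B. \<exists>v. v \<noteq> 0 \<and> B *v v = l *\<^sub>R v" by (auto simp: eigenvalues_def)
  then obtain f where f: "\<And>l. l \<in> eigenvalues B \<Longrightarrow> f l \<noteq> 0 \<and> B *v f l = l *\<^sub>R f l" by metis
  have orth: "f l \<bullet> f m = 0" if "l \<in> eigenvalues B" "m \<in> eigenvalues B" "l \<noteq> m" for l m
    using symmetric_matrix_inner[OF sym, of "f l" "f m"] f[OF that(1)] f[OF that(2)] that(3) by auto
  have "inj_on f (eigenvalues B)"
    using orth f by (metis inj_onI inner_eq_zero_iff)
  moreover have "finite (f ` eigenvalues B)"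
  proof (rule finiteI_independent)
    show "independent (f ` eigenvalues B)"
      by (rule pairwise_orthogonal_independent)
        (use orth f in \<open>force simp: pairwise_def orthogonal_def\<close>)+
  qed
  ultimately show ?thesis using finite_image_iff by blast
qed

text \<open>The form attains a minimum a and a maximum b on the unit sphere. Then B - a I and b I -
  B are positive semidefinite with forms vanishing at the extremal points, which are therefore
  eigenvectors by \<open>psd_form_zero_imp_null\<close>. All other eigenvalues lie between a and
  b.\<close>

lemma symmetric_rayleigh_bounds:
  fixes B :: "real^'n^'n"
  assumes sym: "transpose B = B"
  shows "Min (eigenvalues B) \<in> eigenvalues B" "Max (eigenvalues B) \<in> eigenvalues B"
    "Min (eigenvalues B) * (x \<bullet> x) \<le> x \<bullet> (B *v x)"
    "x \<bullet> (B *v x) \<le> Max (eigenvalues B) * (x \<bullet> x)"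
proof -
  let ?S = "sphere 0 1 :: (real^'n) set"
  have cont: "continuous_on ?S (\<lambda>x. x \<bullet> (B *v x))"
    by (intro continuous_intros linear_continuous_on matrix_vector_mul_bounded_linear)
  have ne: "?S \<noteq> {}" by simp
  have scale: "x \<bullet> (B *v x) = (x \<bullet> x) * (sgn x \<bullet> (B *v sgn x))" for x
    by (cases "x = 0") (simp_all add: sgn_div_norm matrix_vector_mult_scaleR dot_square_norm power2_eq_square field_simps)
  obtain u where u: "u \<in> ?S" "\<And>x. x \<in> ?S \<Longrightarrow> u \<bullet> (B *v u) \<le> x \<bullet> (B *v x)"
    using continuous_attains_inf[OF compact_sphere ne cont] by blast
  obtain v where v: "v \<in> ?S" "\<And>x. x \<in> ?S \<Longrightarrow> x \<bullet> (B *v x) \<le> v \<bullet> (B *v v)"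
    using continuous_attains_sup[OF compact_sphere ne cont] by blast
  have uu: "u \<bullet> u = 1" "v \<bullet> v = 1" using u(1) v(1) by (simp_all add: dot_square_norm)
  define a where "a = u \<bullet> (B *v u)"
  define b where "b = v \<bullet> (B *v v)"
  have lo: "a * (x \<bullet> x) \<le> x \<bullet> (B *v x)" for x
  proof (cases "x = 0")
    case False
    then have "a \<le> sgn x \<bullet> (B *v sgn x)" unfolding a_def by (intro u) (simp add: norm_sgn)
    then show ?thesis by (subst scale) (metis mult.commute mult_left_mono inner_ge_zero)
  qed simp
  have hi: "x \<bullet> (B *v x) \<le> b * (x \<bullet> x)" for x
  proof (cases "x = 0")
    case False
    then have "sgn x \<bullet> (B *v sgn x) \<le> b" unfolding b_def by (intro v) (simp add: norm_sgn)
    then show ?thesis by (subst scale) (metis mult.commute mult_left_mono inner_ge_zero)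
  qed simp
  have mulv: "(B - c *\<^sub>R mat 1) *v x = B *v x - c *\<^sub>R x" "(c *\<^sub>R mat 1 - B) *v x = c *\<^sub>R x - B *v x" for c x
    by (simp_all add: matrix_vector_mult_diff_rdistrib flip: scaleR_matrix_vector_assoc)
  have tr: "transpose (B - c *\<^sub>R mat 1) = B - c *\<^sub>R mat 1" "transpose (c *\<^sub>R mat 1 - B) = c *\<^sub>R mat 1 - B" for c
    using sym by (auto simp: transpose_def vec_eq_iff mat_def)
  have "(B - a *\<^sub>R mat 1) *v u = 0"
    by (rule psd_form_zero_imp_null[OF tr(1)]) (use lo uu in \<open>simp_all add: mulv inner_diff a_def\<close>)
  then have "B *v u = a *\<^sub>R u" by (simp add: mulv)
  moreover have "u \<noteq> 0" using uu by auto
  ultimately have a_eig: "a \<in> eigenvalues B"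
    unfolding eigenvalues_def by blast
  have "(b *\<^sub>R mat 1 - B) *v v = 0"
    by (rule psd_form_zero_imp_null[OF tr(2)]) (use hi uu in \<open>simp_all add: mulv inner_diff b_def\<close>)
  then have "B *v v = b *\<^sub>R v" by (simp add: mulv)
  moreover have "v \<noteq> 0" using uu by auto
  ultimately have b_eig: "b \<in> eigenvalues B"
    unfolding eigenvalues_def by blast
  have rng: "a \<le> l \<and> l \<le> b" if l: "l \<in> eigenvalues B" for l
  proof -
    obtain w where w: "w \<noteq> 0" "B *v w = l *\<^sub>R w" using l by (auto simp: eigenvalues_def)
    then have "w \<bullet> w > 0" by simp
    then show ?thesis using lo[of w] hi[of w] w by simp
  qed
  have fin: "finite (eigenvalues B)" by (rule finite_eigenvalues_symmetric[OF sym])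
  have "Min (eigenvalues B) = a" "Max (eigenvalues B) = b"
    using fin a_eig b_eig rng by (auto intro!: Min_eqI Max_eqI)
  then show "Min (eigenvalues B) \<in> eigenvalues B" "Max (eigenvalues B) \<in> eigenvalues B"
    "Min (eigenvalues B) * (x \<bullet> x) \<le> x \<bullet> (B *v x)"
    "x \<bullet> (B *v x) \<le> Max (eigenvalues B) * (x \<bullet> x)"
    using a_eig b_eig lo hi by simp_all
qed

section \<open>The landmark matrix\<close>

lemma outer_mult_vector: "outer z *v x = (z \<bullet> x) *\<^sub>R z"
  by (simp add: vec_eq_iff matrix_vector_mult_def inner_vec_def sum_distrib_right sum_distrib_left mult_ac)

lemma trace_outer: "trace (outer z) = z \<bullet> z"
  by (simp add: trace_def inner_vec_def)

lemma trace_scaleR: "trace (c *\<^sub>R A) = c * trace A" for A :: "real^'n^'n"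
  by (simp add: trace_def sum_distrib_left)

lemma trace_sum: "trace (\<Sum>i\<in>I. f i) = (\<Sum>i\<in>I. trace (f i))" for f :: "'i \<Rightarrow> real^'n^'n"
  by (induction I rule: infinite_finite_induct) (simp_all add: trace_add, simp_all add: trace_def)

lemma sum_matrix_vector_mult: "(\<Sum>i\<in>I. f i) *v x = (\<Sum>i\<in>I. f i *v x)" for f :: "'i \<Rightarrow> real^'n^'m"
  by (induction I rule: infinite_finite_induct) (simp_all add: matrix_vector_mult_add_rdistrib)

lemma transpose_landmark_matrix: "transpose (landmark_matrix N k p) = landmark_matrix N k p"
  by (simp add: landmark_matrix_def transpose_def vec_eq_iff sum_component mult.commute)

lemma transpose_bar_matrix: "transpose M = M \<Longrightarrow> transpose (bar_matrix M) = bar_matrix M"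
  by (auto simp: bar_matrix_def transpose_def vec_eq_iff mat_def)

lemma bar_matrix_mult_vector: "bar_matrix M *v x = (1/2) *\<^sub>R (trace M *\<^sub>R x - M *v x)"
  by (simp add: bar_matrix_def matrix_vector_mult_diff_rdistrib flip: scaleR_matrix_vector_assoc)

text \<open>By Lagrange's identity each summand is k i times the squared norm of the cross product
  of \<open>p i - landmark_center N k p\<close> with x, so the form is visibly nonnegative term by
  term.\<close>

lemma bar_landmark_form:
  "x \<bullet> (bar_matrix (landmark_matrix N k p) *v x) =
    (\<Sum>i=1..N. k i * ((norm (p i - landmark_center N k p))\<^sup>2 * (x \<bullet> x) - ((p i - landmark_center N k p) \<bullet> x)\<^sup>2)) / 2"
proof -
  let ?z = "\<lambda>i. p i - landmark_center N k p"
  have "trace (landmark_matrix N k p) = (\<Sum>i=1..N. k i * (norm (?z i))\<^sup>2)"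
    by (simp add: landmark_matrix_def trace_sum trace_scaleR trace_outer dot_square_norm)
  moreover have "x \<bullet> (landmark_matrix N k p *v x) = (\<Sum>i=1..N. k i * (?z i \<bullet> x)\<^sup>2)"
    by (simp add: landmark_matrix_def sum_matrix_vector_mult outer_mult_vector inner_sum_right
        power2_eq_square inner_commute mult.assoc flip: scaleR_matrix_vector_assoc)
  moreover have "x \<bullet> (bar_matrix M *v x) = (trace M * (x \<bullet> x) - x \<bullet> (M *v x)) / 2" for M
    by (simp add: bar_matrix_mult_vector inner_diff)
  ultimately show ?thesis
    by (simp add: sum_distrib_right sum_subtractf right_diff_distrib mult.assoc del: inner_diff_left inner_diff_right)
qed

text \<open>A zero of the form is a case of equality in Cauchy-Schwarz for every landmark: each one
  differs from the center by a multiple of x, and all of them lie on one line.\<close>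

lemma bar_landmark_pos:
  assumes k: "\<And>i. i \<in> {1..N} \<Longrightarrow> k i > 0"
    and nc: "\<exists>i\<in>{1..N}. \<exists>j\<in>{1..N}. \<exists>l\<in>{1..N}. \<not> collinear {p i, p j, p l}"
    and "x \<noteq> 0"
  shows "x \<bullet> (bar_matrix (landmark_matrix N k p) *v x) > 0"
proof (rule ccontr)
  let ?z = "\<lambda>i. p i - landmark_center N k p"
  let ?d = "\<lambda>i. (norm (?z i))\<^sup>2 * (x \<bullet> x) - (?z i \<bullet> x)\<^sup>2"
  assume "\<not> ?thesis"
  then have le: "(\<Sum>i=1..N. k i * ?d i) \<le> 0"
    by (simp add: bar_landmark_form)
  have nonneg: "?d i \<ge> 0" for i
    using Cauchy_Schwarz_ineq[of "?z i" x] by (simp add: dot_square_norm)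
  have kd: "k i * ?d i \<ge> 0" if "i \<in> {1..N}" for i
    by (intro mult_nonneg_nonneg nonneg less_imp_le k that)
  have "(\<Sum>i=1..N. k i * ?d i) = 0"
    using le kd by (intro antisym sum_nonneg)
  then have "\<forall>i\<in>{1..N}. k i * ?d i = 0"
    using kd by (subst (asm) sum_nonneg_eq_0_iff) auto
  then have d0: "?d i = 0" if "i \<in> {1..N}" for i
    using k[OF that] that by (metis less_irrefl mult_eq_0_iff)
  have par: "\<exists>c. ?z i = c *\<^sub>R x" if "i \<in> {1..N}" for i
  proof -
    have "(?z i \<bullet> x)\<^sup>2 = (norm (?z i) * norm x)\<^sup>2"
      using d0[OF that] by (simp add: dot_square_norm power_mult_distrib del: inner_diff_left)
    then have "\<bar>?z i \<bullet> x\<bar> = norm (?z i) * norm x"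
      by (metis abs_ge_zero norm_ge_zero mult_nonneg_nonneg power2_abs power2_eq_imp_eq)
    then consider "norm x *\<^sub>R ?z i = norm (?z i) *\<^sub>R x" | "norm x *\<^sub>R ?z i = - norm (?z i) *\<^sub>R x"
      unfolding norm_cauchy_schwarz_abs_eq by fastforce
    then obtain c where "norm x *\<^sub>R ?z i = c *\<^sub>R x" by cases blast+
    then have "?z i = (c / norm x) *\<^sub>R x"
      using \<open>x \<noteq> 0\<close> by (metis divide_inverse_commute norm_eq_zero scaleR_left_imp_eq scaleR_scaleR nonzero_mult_div_cancel_left times_divide_eq_right)
    then show ?thesis by blast
  qed
  then obtain c where c: "\<And>i. i \<in> {1..N} \<Longrightarrow> ?z i = c i *\<^sub>R x" by metis
  have diff: "p i - p j = (c i - c j) *\<^sub>R x" if "i \<in> {1..N}" "j \<in> {1..N}" for i j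
    using c[OF that(1)] c[OF that(2)] by (simp add: algebra_simps)
  have "collinear {p i, p j, p l}" if "i \<in> {1..N}" "j \<in> {1..N}" "l \<in> {1..N}" for i j l
    unfolding collinear_def using diff that by blast
  then show False using nc by blast
qed

section \<open>Attitude error, potential and its gradient in quaternion coordinates\<close>

lemma rot_norm_quat_mat: "a\<^sup>2 + q \<bullet> q = 1 \<Longrightarrow> rot_norm (quat_mat a q) = norm q"
proof -
  assume "a\<^sup>2 + q \<bullet> q = 1"
  then have "trace (mat 1 - quat_mat a q) / 4 = q \<bullet> q"
    by (simp add: quat_mat_def mat3_simps power2_eq_square algebra_simps)
  then show ?thesis by (simp add: rot_norm_def norm_eq_sqrt_inner)
qed

lemma rot_norm_nonneg: "rotation_matrix R \<Longrightarrow> 0 \<le> rot_norm R"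
  by (metis rotation_eq_quat_mat rot_norm_quat_mat norm_ge_zero)

text \<open>Orthogonality gives |I - R|^2 = 2 trace (I - R). Up to the factor sqrt 8,
  \<open>rot_norm\<close> is thus the Frobenius distance to the identity and inherits its triangle
  inequality.\<close>

lemma norm_mat_1_minus_rotation:
  assumes "rotation_matrix R"
  shows "(norm (mat 1 - R))\<^sup>2 = 8 * (rot_norm R)\<^sup>2"
proof -
  obtain a q where aq: "a\<^sup>2 + q \<bullet> q = 1" "R = quat_mat a q" using rotation_eq_quat_mat[OF assms] .
  define x y z where xyz: "x = q$1" "y = q$2" "z = q$3"
  have a: "a\<^sup>2 = 1 - (x*x+y*y+z*z)" using aq(1) by (simp add: inner_vec_def sum_3 xyz)
  have "(mat 1 - R) \<bullet> (mat 1 - R) = 8 * (q \<bullet> q)"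
    unfolding aq(2) quat_mat_def using a
    by (simp add: mat3_simps flip: xyz) algebra
  then show ?thesis
    by (simp add: aq rot_norm_quat_mat[OF aq(1)] dot_square_norm)
qed

definition pot :: "real^3^3 \<Rightarrow> real^3^3 \<Rightarrow> real" where
  "pot M R = trace M - trace (M ** R)"

lemma pot_quat_mat:
  assumes "transpose M = M" "a\<^sup>2 + q \<bullet> q = 1"
  shows "pot M (quat_mat a q) = 4 * (q \<bullet> (bar_matrix M *v q))"
proof -
  define x y z where xyz: "x = q$1" "y = q$2" "z = q$3"
  have bar: "4 * (q \<bullet> (bar_matrix M *v q)) = 2 * (trace M * (q \<bullet> q) - q \<bullet> (M *v q))"
    by (simp add: bar_matrix_mult_vector inner_diff)
  have a: "a\<^sup>2 = 1 - (x*x+y*y+z*z)" using assms(2) by (simp add: inner_vec_def sum_3 xyz)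
  have "M$2$1 = M$1$2" "M$3$1 = M$1$3" "M$3$2 = M$2$3"
    using assms(1) by (auto simp: transpose_def vec_eq_iff)
  then show ?thesis
    using a unfolding pot_def quat_mat_def bar
    by (simp add: mat3_simps matrix_vector_mult_def flip: xyz) (simp add: algebra_simps)
qed

lemma psi_quat_mat:
  assumes "transpose M = M" "a\<^sup>2 + q \<bullet> q = 1"
  shows "psi (M ** quat_mat a q) = (2 * a) *\<^sub>R (bar_matrix M *v q) - 2 *\<^sub>R cross3 q (bar_matrix M *v q)"
proof -
  define x y z where xyz: "x = q$1" "y = q$2" "z = q$3"
  have a: "a\<^sup>2 = 1 - (x*x+y*y+z*z)" using assms(2) by (simp add: inner_vec_def sum_3 xyz)
  have "M$2$1 = M$1$2" "M$3$1 = M$1$3" "M$3$2 = M$2$3"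
    using assms(1) by (auto simp: transpose_def vec_eq_iff)
  then show ?thesis
    using a unfolding quat_mat_def bar_matrix_mult_vector
    by (simp add: mat3_simps matrix_vector_mult_def cross3_def flip: xyz) (simp add: algebra_simps)
qed

text \<open>The two parts in \<open>psi_quat_mat\<close> are orthogonal, so dropping the cross
  product only lowers the norm. Cauchy-Schwarz bounds the norm of \<open>bar_matrix M *v q\<close>
  below by l |q|, and a^2 = 1 - |q|^2 is the factor that is lost near rotations by pi.\<close>

lemma psi_lower_bound:
  assumes sym: "transpose M = M" and lo: "\<And>q. l * (q \<bullet> q) \<le> q \<bullet> (bar_matrix M *v q)" and "l \<ge> 0"
    and R: "rotation_matrix R"
  shows "4 * (1 - (rot_norm R)\<^sup>2) * l\<^sup>2 * (rot_norm R)\<^sup>2 \<le> (norm (psi (M ** R)))\<^sup>2"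
proof -
  obtain a q where aq: "a\<^sup>2 + q \<bullet> q = 1" "R = quat_mat a q" using rotation_eq_quat_mat[OF R] .
  define b where "b = bar_matrix M *v q"
  have "l * norm q * norm q \<le> norm b * norm q"
    using lo[of q] norm_cauchy_schwarz[of q b] by (simp add: b_def dot_square_norm power2_eq_square mult_ac)
  then have "l * norm q \<le> norm b" by (cases "q = 0") auto
  then have "(l * norm q)\<^sup>2 \<le> (norm b)\<^sup>2" using \<open>l \<ge> 0\<close> by (intro power_mono) auto
  moreover have "1 - (rot_norm R)\<^sup>2 = a\<^sup>2" using aq by (simp add: rot_norm_quat_mat[OF aq(1)] dot_square_norm)
  ultimately have "4 * (1 - (rot_norm R)\<^sup>2) * l\<^sup>2 * (rot_norm R)\<^sup>2 \<le> 4 * a\<^sup>2 * (norm b)\<^sup>2"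
    by (simp add: aq rot_norm_quat_mat[OF aq(1)] power_mult_distrib mult_left_mono mult.assoc)
  also have "\<dots> \<le> 4 * a\<^sup>2 * (norm b)\<^sup>2 + 4 * (norm (cross3 q b))\<^sup>2" by simp
  also have "\<dots> = (norm ((2 * a) *\<^sub>R b - 2 *\<^sub>R cross3 q b))\<^sup>2"
    unfolding power2_norm_eq_inner
    by (simp add: inner_diff_left inner_diff_right dot_cross_self power2_eq_square)
  also have "\<dots> = (norm (psi (M ** R)))\<^sup>2" by (simp add: psi_quat_mat[OF sym aq(1)] aq(2) b_def)
  finally show ?thesis .
qed

lemma pot_bounds:
  assumes sym: "transpose M = M" and R: "rotation_matrix R"
  shows "4 * Min (eigenvalues (bar_matrix M)) * (rot_norm R)\<^sup>2 \<le> pot M R"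
    "pot M R \<le> 4 * Max (eigenvalues (bar_matrix M)) * (rot_norm R)\<^sup>2"
proof -
  obtain a q where aq: "a\<^sup>2 + q \<bullet> q = 1" "R = quat_mat a q" using rotation_eq_quat_mat[OF R] .
  note symmetric_rayleigh_bounds(3,4)[OF transpose_bar_matrix[OF sym], of q]
  then show "4 * Min (eigenvalues (bar_matrix M)) * (rot_norm R)\<^sup>2 \<le> pot M R"
    "pot M R \<le> 4 * Max (eigenvalues (bar_matrix M)) * (rot_norm R)\<^sup>2"
    by (simp_all add: aq rot_norm_quat_mat[OF aq(1)] pot_quat_mat[OF sym aq(1)] dot_square_norm)
qed

section \<open>The explicit flow\<close>

lemma vstack_simps [simp]: "vstack u w $ Inl i = u $ i" "vstack u w $ Inr j = w $ j"
  by (simp_all add: vstack_def)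

lemma A_mat_square: "A_mat ** A_mat = 0"
proof -
  have "A_mat $ i $ j * A_mat $ j $ k = 0" for i j k
    by (cases i; cases j; cases k) (simp_all add: A_mat_def hstack_def)
  then have "(\<Sum>j\<in>UNIV. A_mat $ i $ j * A_mat $ j $ k) = 0" for i k
    by (intro sum.neutral) simp
  then show ?thesis by (simp add: vec_eq_iff matrix_matrix_mult_def)
qed

lemma A_mat_nilpotent [simp]: "A_mat *v (A_mat *v x) = 0"
  by (simp add: matrix_vector_mul_assoc A_mat_square)

text \<open>\<open>A_mat\<close> has square zero, so the exponential series ends after its linear
  term and no convergence argument is required.\<close>

lemma Phi_eq: "Phi \<tau> = mat 1 + \<tau> *\<^sub>R A_mat"
proof -
  let ?f = "\<lambda>n. inverse (fact n) *\<^sub>R (((**) (\<tau> *\<^sub>R A_mat)) ^^ n) (mat 1)"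
  have zero: "?f n = 0" if "n \<notin> {0, 1}" for n
  proof -
    obtain m where "n = Suc (Suc m)" using \<open>n \<notin> {0, 1}\<close>
      by (metis One_nat_def insertI1 insertI2 not0_implies_Suc)
    then show ?thesis
      by (simp add: matrix_mul_assoc mat_mult.scaleR_left mat_mult.scaleR_right A_mat_square)
  qed
  have "Phi \<tau> = sum ?f {0, 1}"
    unfolding Phi_def matrix_exp_def by (rule suminf_finite) (use zero in auto)
  then show ?thesis by simp
qed

lemma Phi_mult_vector: "Phi \<tau> *v x = x + \<tau> *\<^sub>R (A_mat *v x)"
  by (simp add: Phi_eq matrix_vector_mult_add_rdistrib flip: scaleR_matrix_vector_assoc)

lemma bounded_linear_delta: "bounded_linear (\<lambda>X. vstack 0 (g v* X) :: real^(3+3))" for g :: "real^3"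
proof -
  have "(vstack 0 (g v* (X + Y)) :: real^(3+3)) = vstack 0 (g v* X) + vstack 0 (g v* Y)" for X Y :: "real^3^3"
    by (auto simp: vec_eq_iff vector_matrix_mult_def vstack_def distrib_left distrib_right sum.distrib split: sum.split)
  moreover have "(vstack 0 (g v* (r *\<^sub>R X)) :: real^(3+3)) = r *\<^sub>R vstack 0 (g v* X)" for r and X :: "real^3^3"
    by (auto simp: vec_eq_iff vector_matrix_mult_def vstack_def sum_distrib_left mult_ac split: sum.split)
  ultimately have "linear (\<lambda>X. vstack 0 (g v* X) :: real^(3+3))"
    by (intro linearI)
  then show ?thesis by (simp add: linear_conv_bounded_linear)
qed

lemma continuous_on_delta_g [continuous_intros]:
  "continuous_on S f \<Longrightarrow> continuous_on S (\<lambda>t. delta_g g (f t))"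
  unfolding delta_g_def
  by (rule bounded_linear.continuous_on[OF bounded_linear_delta]) (intro continuous_intros)

lemma continuous_on_matrix_mult [continuous_intros]:
  fixes f :: "'a::topological_space \<Rightarrow> real^'n^'m" and h :: "'a \<Rightarrow> real^'p^'n"
  shows "continuous_on S f \<Longrightarrow> continuous_on S h \<Longrightarrow> continuous_on S (\<lambda>t. f t ** h t)"
  by (rule mat_mult.continuous_on)

lemma continuous_on_A_mat [continuous_intros]:
  "continuous_on S f \<Longrightarrow> continuous_on S (\<lambda>t. A_mat *v f t)"
  by (rule bounded_linear.continuous_on[OF matrix_vector_mul_bounded_linear])

lemma continuous_on_rot [continuous_intros]: "continuous_on S (rot w)"
  by (rule continuous_at_imp_continuous_on) (use has_vector_derivative_continuous[OF rot_has_vector_derivative] in blast)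

lemma bounded_linear_skew: "bounded_linear skew"
proof -
  have "skew (x + y) = skew x + skew y" for x y by (simp add: mat3_simps)
  then have "linear skew" by (intro linearI) (auto simp: skew_scaleR)
  then show ?thesis by (simp add: linear_conv_bounded_linear)
qed

text \<open>The flow map of \<open>error_system\<close>, which depends on g alone. It is polynomial
  on the whole matrix space, R not being restricted to rotations, so continuity can be stated on
  \<open>UNIV\<close>.\<close>

definition err_flow :: "real^3 \<Rightarrow> state \<Rightarrow> state" where
  "err_flow g = (\<lambda>(R, \<eta>, x, \<tau>). (R ** skew (- \<eta>), 0, A_mat *v x + delta_g g R, - 1))"

lemma continuous_on_err_flow: "continuous_on UNIV (err_flow g)"
  unfolding err_flow_def case_prod_beta
  by (intro continuous_intros bounded_linear.continuous_on[OF bounded_linear_skew])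

text \<open>This is $\Phi(-s)\,\delta_g(s)$, the integrand of the variation of constants formula.\<close>

definition forcing :: "real^3 \<Rightarrow> real^3^3 \<Rightarrow> real^3 \<Rightarrow> real \<Rightarrow> real^(3+3)" where
  "forcing g R w s = delta_g g (R ** rot w s) - s *\<^sub>R (A_mat *v delta_g g (R ** rot w s))"

definition drift :: "real^3 \<Rightarrow> real^3^3 \<Rightarrow> real^3 \<Rightarrow> real \<Rightarrow> real^(3+3)" where
  "drift g R w t = integral {0..t} (forcing g R w)"

text \<open>Defined for every t: the flow set plays its part only later, through the timer
  component, which reaches 0 after the initial timer value.\<close>

definition sol :: "real^3 \<Rightarrow> state \<Rightarrow> real \<Rightarrow> state" where
  "sol g = (\<lambda>(R, \<eta>, x, \<tau>) t.
     (R ** rot (- \<eta>) t, \<eta>, Phi t *v (x + drift g R (- \<eta>) t), \<tau> - t))"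

lemma sol_0 [simp]: "sol g z 0 = z"
  by (simp add: sol_def drift_def Phi_eq case_prod_beta)

lemma continuous_on_forcing: "continuous_on S (forcing g R w)"
  unfolding forcing_def by (intro continuous_intros)

lemma sol_has_vector_derivative:
  assumes t: "t \<in> {0..T}"
  shows "(sol g z has_vector_derivative err_flow g (sol g z t)) (at t within {0..T})"
proof -
  obtain R \<eta> x \<tau> where z: "z = (R, \<eta>, x, \<tau>)" by (metis surj_pair)
  define y where "y t = x + drift g R (- \<eta>) t" for t
  have y: "(y has_vector_derivative forcing g R (- \<eta>) t) (at t within {0..T})"
    unfolding y_def drift_def
    using integral_has_vector_derivative[OF continuous_on_forcing t]
    by (intro has_vector_derivative_eq_rhs[OF has_vector_derivative_add[OF has_vector_derivative_const]]) auto
  have Ay: "((\<lambda>t. A_mat *v y t) has_vector_derivative A_mat *v forcing g R (- \<eta>) t) (at t within {0..T})"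
    by (rule bounded_linear.has_vector_derivative[OF matrix_vector_mul_bounded_linear y])
  have Ry: "((\<lambda>t. R ** rot (- \<eta>) t) has_vector_derivative R ** (rot (- \<eta>) t ** skew (- \<eta>))) (at t within {0..T})"
    by (rule bounded_linear.has_vector_derivative[OF mat_mult.bounded_linear_right rot_has_vector_derivative])
  have "((\<lambda>t. y t + t *\<^sub>R (A_mat *v y t)) has_vector_derivative
      forcing g R (- \<eta>) t + (t *\<^sub>R (A_mat *v forcing g R (- \<eta>) t) + 1 *\<^sub>R (A_mat *v y t))) (at t within {0..T})"
    by (intro derivative_intros y has_vector_derivative_scaleR Ay)
  \<comment> \<open>Since A^2 = 0, (I + t A)(I - t A) = I, so the two forcing terms combine to
    \<open>delta_g\<close>; for the same reason A y equals A (y + t A y).\<close>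
  moreover have "forcing g R (- \<eta>) t + (t *\<^sub>R (A_mat *v forcing g R (- \<eta>) t) + 1 *\<^sub>R (A_mat *v y t))
      = A_mat *v (y t + t *\<^sub>R (A_mat *v y t)) + delta_g g (R ** rot (- \<eta>) t)"
    by (simp add: forcing_def matrix_vector_right_distrib matrix_vector_mult_diff_distrib
        matrix_vector_mult_scaleR)
  ultimately have "((\<lambda>t. y t + t *\<^sub>R (A_mat *v y t)) has_vector_derivative
      A_mat *v (y t + t *\<^sub>R (A_mat *v y t)) + delta_g g (R ** rot (- \<eta>) t)) (at t within {0..T})"
    by simp
  moreover have "((\<lambda>t. \<tau> - t) has_vector_derivative - 1) (at t within {0..T})"
    by (auto intro!: derivative_eq_intros)
  ultimately show ?thesis
    using Ry unfolding z sol_def err_flow_def Phi_mult_vector y_def prod.case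
    by (intro has_vector_derivative_Pair has_vector_derivative_const) (simp_all add: matrix_mul_assoc)
qed

text \<open>The vector field contains the product of R and \<eta> and is not globally Lipschitz, so
  the equation is integrated directly. \<eta> and \<tau> + t are constant. R times the transpose of
  \<open>rot\<close> is constant because \<open>rot\<close> solves the same linear equation and
  \<open>skew\<close> is antisymmetric. Finally x - t A x, which is \<Phi>(-t) x, has derivative
  \<open>forcing\<close>. R may be any matrix here, so staying in SO(3) is a consequence and not a
  premise.\<close>

lemma sol_unique_0:
  fixes f :: "real \<Rightarrow> state"
  assumes f: "\<And>t. t \<in> {0..T} \<Longrightarrow> (f has_vector_derivative err_flow g (f t)) (at t within {0..T})"
    and t: "t \<in> {0..T}"
  shows "f t = sol g (f 0) t"
proof -
  define R where "R t = fst (f t)" for t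
  define \<eta> where "\<eta> t = fst (snd (f t))" for t
  define x where "x t = fst (snd (snd (f t)))" for t
  define \<tau> where "\<tau> t = snd (snd (snd (f t)))" for t
  have ft: "f t = (R t, \<eta> t, x t, \<tau> t)" for t by (simp add: R_def \<eta>_def x_def \<tau>_def)
  have fl: "err_flow g (f t) = (R t ** skew (- \<eta> t), 0, A_mat *v x t + delta_g g (R t), - 1)" for t
    by (simp add: err_flow_def ft)
  note bl = bounded_linear.has_vector_derivative
  have dR: "(R has_vector_derivative R t ** skew (- \<eta> t)) (at t within {0..T})" if "t \<in> {0..T}" for t
    using bl[OF bounded_linear_fst f[OF that]] unfolding fl R_def[symmetric] by simp
  have d\<eta>: "(\<eta> has_vector_derivative 0) (at t within {0..T})" if "t \<in> {0..T}" for t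
    using bl[OF bounded_linear_fst bl[OF bounded_linear_snd f[OF that]]] unfolding fl \<eta>_def[symmetric] by simp
  have dx: "(x has_vector_derivative A_mat *v x t + delta_g g (R t)) (at t within {0..T})" if "t \<in> {0..T}" for t
    using bl[OF bounded_linear_fst bl[OF bounded_linear_snd bl[OF bounded_linear_snd f[OF that]]]]
    unfolding fl x_def[symmetric] by simp
  have d\<tau>: "(\<tau> has_vector_derivative - 1) (at t within {0..T})" if "t \<in> {0..T}" for t
    using bl[OF bounded_linear_snd bl[OF bounded_linear_snd bl[OF bounded_linear_snd f[OF that]]]]
    unfolding fl \<tau>_def[symmetric] by simp
  have const: "h t = h 0" if "\<And>t. t \<in> {0..T} \<Longrightarrow> (h has_vector_derivative 0) (at t within {0..T})" "t \<in> {0..T}"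
    for h :: "real \<Rightarrow> 'b::banach" and t
  proof -
    have "((\<lambda>_. 0) has_integral (h t - h 0)) {0..t}"
      by (rule fundamental_theorem_of_calculus)
        (use that(2) in \<open>auto intro!: has_vector_derivative_within_subset[OF that(1)]\<close>)
    then show ?thesis by (metis has_integral_0 has_integral_unique right_minus_eq)
  qed
  have \<eta>: "\<eta> t = \<eta> 0" if "t \<in> {0..T}" for t using const[OF d\<eta> that] .
  have "\<tau> t + t = \<tau> 0 + 0"
    by (rule const[OF _ t]) (auto intro!: derivative_eq_intros d\<tau>)
  then have \<tau>: "\<tau> t = \<tau> 0 - t" by simp
  define E where "E = rot (- \<eta> 0)"
  have tr: "bounded_linear (transpose :: real^3^3 \<Rightarrow> real^3^3)"
    unfolding linear_conv_bounded_linear[symmetric] by (intro linearI) (auto simp: transpose_def vec_eq_iff)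
  have dET: "((\<lambda>t. transpose (E t)) has_vector_derivative transpose (E t ** skew (- \<eta> 0))) (at t within S)" for t S
    unfolding E_def by (rule bl[OF tr rot_has_vector_derivative])
  have Rsol: "R t = R 0 ** rot (- \<eta> 0) t" if t: "t \<in> {0..T}" for t
  proof -
    have "R t ** transpose (E t) = R 0 ** transpose (E 0)"
    proof (rule const[OF _ t])
      fix t assume t: "t \<in> {0..T}"
      have "((\<lambda>t. R t ** transpose (E t)) has_vector_derivative
          R t ** transpose (E t ** skew (- \<eta> 0)) + R t ** skew (- \<eta> t) ** transpose (E t)) (at t within {0..T})"
        by (rule mat_mult.has_vector_derivative[OF dR[OF t] dET])
      also have "R t ** transpose (E t ** skew (- \<eta> 0)) + R t ** skew (- \<eta> t) ** transpose (E t) = 0"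
        by (simp add: \<eta>[OF t] matrix_transpose_mul transpose_skew mat_mult.minus_left mat_mult.minus_right
            matrix_mul_assoc del: skew_minus)
      finally show "((\<lambda>t. R t ** transpose (E t)) has_vector_derivative 0) (at t within {0..T})" .
    qed
    then have "R t ** transpose (E t) ** E t = R 0 ** E t" by (simp add: E_def transpose_mat matrix_mul_rid)
    then show ?thesis by (simp add: E_def flip: matrix_mul_assoc)
  qed
  have dy: "((\<lambda>t. x t - t *\<^sub>R (A_mat *v x t)) has_vector_derivative forcing g (R 0) (- \<eta> 0) t) (at t within {0..T})"
    if t: "t \<in> {0..T}" for t
  proof -
    have "((\<lambda>t. x t - t *\<^sub>R (A_mat *v x t)) has_vector_derivative
       (A_mat *v x t + delta_g g (R t)) - (t *\<^sub>R (A_mat *v (A_mat *v x t + delta_g g (R t))) + 1 *\<^sub>R (A_mat *v x t))) (at t within {0..T})"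
      by (intro has_vector_derivative_diff has_vector_derivative_scaleR dx[OF t] DERIV_ident
          bl[OF matrix_vector_mul_bounded_linear dx[OF t]])
    then show ?thesis
      unfolding forcing_def Rsol[OF t, symmetric]
      by (simp add: matrix_vector_right_distrib algebra_simps)
  qed
  have "(forcing g (R 0) (- \<eta> 0) has_integral ((x t - t *\<^sub>R (A_mat *v x t)) - (x 0 - 0 *\<^sub>R (A_mat *v x 0)))) {0..t}"
    by (rule fundamental_theorem_of_calculus) (use t in \<open>auto intro: has_vector_derivative_within_subset[OF dy]\<close>)
  then have y: "x t - t *\<^sub>R (A_mat *v x t) = x 0 + drift g (R 0) (- \<eta> 0) t"
    unfolding drift_def by (simp add: integral_unique algebra_simps)
  have "Phi t *v (x 0 + drift g (R 0) (- \<eta> 0) t) = x t"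
    unfolding y[symmetric] Phi_mult_vector by (simp add: matrix_vector_mult_diff_distrib matrix_vector_mult_scaleR)
  then show ?thesis unfolding ft sol_def prod.case by (simp add: Rsol[OF t] \<eta>[OF t] \<tau>)
qed

lemma sol_unique:
  fixes f :: "real \<Rightarrow> state"
  assumes f: "\<And>t. t \<in> {a..b} \<Longrightarrow> (f has_vector_derivative err_flow g (f t)) (at t within {a..b})"
    and t: "t \<in> {a..b}"
  shows "f t = sol g (f a) (t - a)"
proof -
  have "((\<lambda>s. f (a + s)) has_vector_derivative err_flow g (f (a + s))) (at s within {0..b - a})"
    if "s \<in> {0..b - a}" for s
  proof -
    have im: "(+) a ` {0..b - a} = {a..b}" by simp
    have "((f \<circ> (+) a) has_vector_derivative 1 *\<^sub>R err_flow g (f (a + s))) (at s within {0..b - a})"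
      by (rule vector_diff_chain_within) (use f[of "a + s"] that in \<open>auto simp: im intro!: derivative_eq_intros\<close>)
    then show ?thesis by (simp add: o_def)
  qed
  from sol_unique_0[of "b - a" "\<lambda>s. f (a + s)", OF this, of "t - a"] t show ?thesis by simp
qed

section \<open>Solutions of the error system\<close>

text \<open>Names the sequence whose existence \<open>hybrid_time_domain\<close> asserts, so that
  one choice of it can be fixed for a solution.\<close>

definition jump_times :: "(real \<times> nat) set \<Rightarrow> (nat \<Rightarrow> real) \<Rightarrow> bool" where
  "jump_times E s \<longleftrightarrow> s 0 = 0 \<and> incseq s \<and>
        (E = (\<Union>j. {s j..s (Suc j)} \<times> {j}) \<or>
         (\<exists>J I. E = (\<Union>j<J. {s j..s (Suc j)} \<times> {j}) \<union> I \<times> {J} \<and>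
                (I = {s J..s (Suc J)} \<or> s J < s (Suc J) \<and> I = {s J..<s (Suc J)} \<or> I = {s J..})))"

lemma hybrid_time_domain_iff: "hybrid_time_domain E \<longleftrightarrow> (\<exists>s. jump_times E s)"
  by (simp only: hybrid_time_domain_def jump_times_def)

text \<open>Consequences common to all shapes of a hybrid time domain, which spare later arguments
  the case distinction. The third one says that a nonempty slice \<open>Suc j\<close> forces slice j
  to contain its right end point.\<close>

lemma jump_times_slices:
  assumes "jump_times E s"
  shows "(0, 0) \<in> E"
    "\<And>t j. (t, j) \<in> E \<Longrightarrow> s j \<le> t \<and> {s j..t} \<subseteq> time_slice E j"
    "\<And>t j. (t, Suc j) \<in> E \<Longrightarrow> s (Suc j) \<in> time_slice E j \<and> s (Suc j) \<in> time_slice E (Suc j)"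
proof -
  have s: "s 0 = 0" "incseq s" and E: "E = (\<Union>j. {s j..s (Suc j)} \<times> {j}) \<or>
         (\<exists>J I. E = (\<Union>j<J. {s j..s (Suc j)} \<times> {j}) \<union> I \<times> {J} \<and>
                (I = {s J..s (Suc J)} \<or> s J < s (Suc J) \<and> I = {s J..<s (Suc J)} \<or> I = {s J..}))"
    using assms unfolding jump_times_def by blast+
  have le: "s j \<le> s (Suc j)" for j using s(2) by (simp add: incseq_SucD)
  from E have "(0, 0) \<in> E \<and> (\<forall>t j. (t, j) \<in> E \<longrightarrow> s j \<le> t \<and> {s j..t} \<subseteq> time_slice E j) \<and>
    (\<forall>t j. (t, Suc j) \<in> E \<longrightarrow> s (Suc j) \<in> time_slice E j \<and> s (Suc j) \<in> time_slice E (Suc j))"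
    (is "?goal E")
  proof (elim disjE exE conjE)
    assume E: "E = (\<Union>j. {s j..s (Suc j)} \<times> {j})"
    then have mem: "(t, j) \<in> E \<longleftrightarrow> s j \<le> t \<and> t \<le> s (Suc j)" for t j by auto
    have "0 \<le> s (Suc 0)" using le[of 0] s(1) by simp
    then show ?thesis using s le by (auto simp: time_slice_def mem)
  next
    fix J I
    assume E: "E = (\<Union>j<J. {s j..s (Suc j)} \<times> {j}) \<union> I \<times> {J}"
    then have mem: "(t, j) \<in> E \<longleftrightarrow> (j < J \<and> s j \<le> t \<and> t \<le> s (Suc j)) \<or> (j = J \<and> t \<in> I)" for t j by auto
    have I: ?thesis if I: "s J \<in> I" "\<And>t. t \<in> I \<Longrightarrow> s J \<le> t \<and> {s J..t} \<subseteq> I"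
    proof (intro conjI allI impI)
      show "(0, 0) \<in> E" using s(1) le[of 0] I(1) by (cases "J = 0") (auto simp: mem)
      show "s j \<le> t" "{s j..t} \<subseteq> time_slice E j" if "(t, j) \<in> E" for t j
        using that I(2)[of t] by (auto simp: mem time_slice_def)
      show "s (Suc j) \<in> time_slice E j" "s (Suc j) \<in> time_slice E (Suc j)" if "(t, Suc j) \<in> E" for t j
        using that I(1) le[of j] le[of "Suc j"] by (auto simp: mem time_slice_def)
    qed
    show ?thesis if "I = {s J..s (Suc J)}" by (rule I) (use that le[of J] in auto)
    show ?thesis if "s J < s (Suc J)" "I = {s J..<s (Suc J)}" by (rule I) (use that in auto)
    show ?thesis if "I = {s J..}" by (rule I) (use that in auto)
  qed
  then show "(0, 0) \<in> E"
    "\<And>t j. (t, j) \<in> E \<Longrightarrow> s j \<le> t \<and> {s j..t} \<subseteq> time_slice E j"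
    "\<And>t j. (t, Suc j) \<in> E \<Longrightarrow> s (Suc j) \<in> time_slice E j \<and> s (Suc j) \<in> time_slice E (Suc j)"
    by blast+
qed

definition Rc :: "state \<Rightarrow> real^3^3" where "Rc z = fst z"
definition \<tau>c :: "state \<Rightarrow> real" where "\<tau>c z = snd (snd (snd z))"

lemma Rc_sol: "Rc (sol g z t) = Rc z ** rot (- fst (snd z)) t"
  by (simp add: Rc_def sol_def case_prod_beta)

lemma \<tau>c_sol: "\<tau>c (sol g z t) = \<tau>c z - t"
  by (simp add: \<tau>c_def sol_def case_prod_beta)

lemma rotation_matrix_mult: "rotation_matrix A \<Longrightarrow> rotation_matrix B \<Longrightarrow> rotation_matrix (A ** B)"
  for A B :: "real^'n^'n"
  by (auto simp: rotation_matrix_def det_mul intro: orthogonal_matrix_mul)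

lemma rotation_Rc_sol: "rotation_matrix (Rc z) \<Longrightarrow> rotation_matrix (Rc (sol g z t))"
  by (simp add: Rc_sol rotation_matrix_mult rotation_rot)

lemma error_system_simps:
  "z \<in> flow_set (error_system M g k\<^sub>R k\<^sub>p k\<^sub>v T\<^sub>m T\<^sub>M) \<longleftrightarrow> rotation_matrix (Rc z) \<and> \<tau>c z \<in> {0..T\<^sub>M}"
  "z \<in> jump_set (error_system M g k\<^sub>R k\<^sub>p k\<^sub>v T\<^sub>m T\<^sub>M) \<longleftrightarrow> rotation_matrix (Rc z) \<and> \<tau>c z = 0"
  "flow_map (error_system M g k\<^sub>R k\<^sub>p k\<^sub>v T\<^sub>m T\<^sub>M) = err_flow g"
  by (cases z; auto simp: error_system_def err_flow_def Rc_def \<tau>c_def)+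

lemma solution_eq_sol:
  assumes H: "hybrid_solution (error_system M g k\<^sub>R k\<^sub>p k\<^sub>v T\<^sub>m T\<^sub>M) E x"
    and sub: "{a..b} \<subseteq> time_slice E j" and t: "t \<in> {a..b}"
  shows "x t j = sol g (x a j) (t - a)"
proof (rule sol_unique[OF _ t])
  fix t assume t: "t \<in> {a..b}"
  show "((\<lambda>t. x t j) has_vector_derivative err_flow g (x t j)) (at t within {a..b})"
  proof (rule abs_cont_solution_classical[OF _ _ continuous_on_err_flow t])
    show "abs_cont_on_interval a b (\<lambda>t. x t j)"
      using H sub by (auto simp: hybrid_solution_def locally_abs_cont_on_def)
    have "AE t in lebesgue. t \<in> time_slice E j \<longrightarrow>
        ((\<lambda>t. x t j) has_vector_derivative err_flow g (x t j)) (at t within time_slice E j)"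
      using H by (simp add: hybrid_solution_def error_system_simps)
    then show "AE t in lebesgue. t \<in> {a..b} \<longrightarrow>
        ((\<lambda>t. x t j) has_vector_derivative err_flow g (x t j)) (at t within {a..b})"
      by eventually_elim (use sub has_vector_derivative_within_subset in blast)
  qed
qed

text \<open>The constraint that the timer is nonnegative is imposed only in the interior of the
  slice. It bounds every u < t, and density carries the bound over to t itself; if the interval is
  one point, the sign of the timer at a is all that is needed.\<close>

lemma solution_timer:
  assumes H: "hybrid_solution (error_system M g k\<^sub>R k\<^sub>p k\<^sub>v T\<^sub>m T\<^sub>M) E x"
    and sub: "{a..t} \<subseteq> time_slice E j" and "a \<le> t" and "0 \<le> \<tau>c (x a j)"
  shows "t - a \<le> \<tau>c (x a j)"
proof (cases "a = t")
  case False
  with \<open>a \<le> t\<close> have "a < t" by simp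
  have "u \<le> a + \<tau>c (x a j)" if u: "a < u" "u < t" for u
  proof -
    have "{a<..<t} \<subseteq> interior (time_slice E j)"
      using sub by (intro interior_maximal) (auto simp: subset_iff)
    then have "x u j \<in> flow_set (error_system M g k\<^sub>R k\<^sub>p k\<^sub>v T\<^sub>m T\<^sub>M)"
      using H u by (auto simp: hybrid_solution_def)
    then show ?thesis
      using solution_eq_sol[OF H sub, of u] u by (simp add: error_system_simps \<tau>c_sol)
  qed
  then have "t \<le> a + \<tau>c (x a j)"
    by (rule dense_le_bounded[OF \<open>a < t\<close>])
  then show ?thesis by simp
qed (use assms in simp)

locale error_solution =
  fixes M :: "real^3^3" and g :: "real^3" and k\<^sub>R k\<^sub>p k\<^sub>v T\<^sub>m T\<^sub>M :: real
    and E :: "(real \<times> nat) set" and x :: "real \<Rightarrow> nat \<Rightarrow> state" and s :: "nat \<Rightarrow> real"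
  assumes H: "hybrid_solution (error_system M g k\<^sub>R k\<^sub>p k\<^sub>v T\<^sub>m T\<^sub>M) E x"
    and T: "0 < T\<^sub>m" "T\<^sub>m \<le> T\<^sub>M"
    and jt: "jump_times E s"
begin

lemma s0: "s 0 = 0" and mono: "incseq s"
  using jt by (auto simp: jump_times_def)

lemmas zero = jump_times_slices(1)[OF jt]
  and slice = jump_times_slices(2)[OF jt]
  and pred = jump_times_slices(3)[OF jt]

abbreviation start :: "nat \<Rightarrow> state" where "start j \<equiv> x (s j) j"

lemma jump_at:
  assumes "(t, Suc j) \<in> E"
  shows "start (Suc j) \<in> jump_map (error_system M g k\<^sub>R k\<^sub>p k\<^sub>v T\<^sub>m T\<^sub>M) (x (s (Suc j)) j)"
    "rotation_matrix (Rc (x (s (Suc j)) j))" "\<tau>c (x (s (Suc j)) j) = 0"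
proof -
  let ?H = "error_system M g k\<^sub>R k\<^sub>p k\<^sub>v T\<^sub>m T\<^sub>M"
  have "(s (Suc j), j) \<in> E" "(s (Suc j), Suc j) \<in> E"
    using pred[OF assms] by (auto simp: time_slice_def)
  then have "x (s (Suc j)) j \<in> jump_set ?H" "start (Suc j) \<in> jump_map ?H (x (s (Suc j)) j)"
    using H unfolding hybrid_solution_def by blast+
  then show "start (Suc j) \<in> jump_map ?H (x (s (Suc j)) j)"
    "rotation_matrix (Rc (x (s (Suc j)) j))" "\<tau>c (x (s (Suc j)) j) = 0"
    by (simp_all add: error_system_simps)
qed

text \<open>The left end of a slice is not an interior point, so validity there comes from the
  initial condition for j = 0 and from the jump rule for larger j.\<close>

lemma start_valid:
  assumes "(t, j) \<in> E"
  shows "rotation_matrix (Rc (start j)) \<and> \<tau>c (start j) \<in> {0..T\<^sub>M}"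
proof (cases j)
  case 0
  have "start 0 \<in> flow_set (error_system M g k\<^sub>R k\<^sub>p k\<^sub>v T\<^sub>m T\<^sub>M) \<union> jump_set (error_system M g k\<^sub>R k\<^sub>p k\<^sub>v T\<^sub>m T\<^sub>M)"
    using H s0 by (simp add: hybrid_solution_def)
  then show ?thesis using 0 T by (auto simp: error_system_simps)
next
  case (Suc i)
  then show ?thesis
    using jump_at[of t i] assms T by (auto simp: error_system_def Rc_def \<tau>c_def)
qed

lemma on_slice:
  assumes "(t, j) \<in> E"
  shows "x t j = sol g (start j) (t - s j)" "t - s j \<in> {0..\<tau>c (start j)}"
  using solution_eq_sol[OF H, of "s j" t j t] solution_timer[OF H, of "s j" t j]
    slice[OF assms] start_valid[OF assms] by auto

text \<open>A jump occurs only at timer value 0 and the timer falls at unit rate, so an interval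
  that ends in a jump lasts exactly as long as the timer value it started with.\<close>

lemma jump_time:
  assumes "(t, Suc j) \<in> E"
  shows "s (Suc j) - s j = \<tau>c (start j)" "x (s (Suc j)) j = sol g (start j) (\<tau>c (start j))"
proof -
  have "(s (Suc j), j) \<in> E" using pred[OF assms] by (simp add: time_slice_def)
  note * = on_slice[OF this]
  show "s (Suc j) - s j = \<tau>c (start j)"
    using jump_at(3)[OF assms] by (simp add: *(1) \<tau>c_sol)
  then show "x (s (Suc j)) j = sol g (start j) (\<tau>c (start j))" using * by simp
qed

end

section \<open>Extension of solutions and completeness\<close>

lemma abs_cont_on_interval_degenerate:
  assumes "b \<le> a" shows "abs_cont_on_interval a b f"
  unfolding abs_cont_on_interval_def
proof (intro allI impI)
  fix e :: real assume "e > 0"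
  have "(\<Sum>K\<in>\<D>. norm (f (Sup K) - f (Inf K))) < e" if D: "\<D> division_of T" "T \<subseteq> {a..b}" for \<D> T
  proof -
    have "norm (f (Sup K) - f (Inf K)) = 0" if "K \<in> \<D>" for K
    proof -
      have "K \<noteq> {}" "K \<subseteq> {a..b}" using division_ofD(2,3)[OF D(1) that] D(2) by auto
      then have "\<forall>y\<in>K. y = a" using assms by fastforce
      with \<open>K \<noteq> {}\<close> have "K = {a}" by auto
      then show ?thesis by simp
    qed
    then show ?thesis using \<open>e > 0\<close> by simp
  qed
  then show "\<exists>\<delta>>0. \<forall>\<D> T. \<D> division_of T \<and> T \<subseteq> {a..b} \<and> (\<Sum>K\<in>\<D>. Sup K - Inf K) < \<delta> \<longrightarrow>
      (\<Sum>K\<in>\<D>. norm (f (Sup K) - f (Inf K))) < e"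
    by (intro exI[of _ 1]) auto
qed

lemma sol_shift_has_vector_derivative:
  assumes t: "t \<in> {a..b}"
  shows "((\<lambda>t. sol g z (t - a)) has_vector_derivative err_flow g (sol g z (t - a))) (at t within {a..b})"
proof -
  have im: "(\<lambda>t. t - a) ` {a..b} = {0..b - a}" by simp
  have "((sol g z \<circ> (\<lambda>t. t - a)) has_vector_derivative 1 *\<^sub>R err_flow g (sol g z (t - a))) (at t within {a..b})"
    by (rule vector_diff_chain_within)
      (use t sol_has_vector_derivative[of "t - a" "b - a"] in \<open>auto simp: im intro!: derivative_eq_intros\<close>)
  then show ?thesis by (simp add: o_def)
qed

lemma sol_shift_abs_cont: "abs_cont_on_interval c d (\<lambda>t. sol g z (t - a))" if "{c..d} \<subseteq> {a..b}"
proof -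
  have "abs_cont_on_interval a b (\<lambda>t. sol g z (t - a))"
  proof (rule C1_abs_cont)
    show "continuous_on {a..b} (\<lambda>t. err_flow g (sol g z (t - a)))"
    proof (rule continuous_on_compose2[OF continuous_on_err_flow _ subset_UNIV])
      show "continuous_on {a..b} (\<lambda>t. sol g z (t - a))"
        unfolding continuous_on_eq_continuous_within
        using has_vector_derivative_continuous[OF sol_shift_has_vector_derivative] by blast
    qed
  qed (use sol_shift_has_vector_derivative in blast)
  then show ?thesis using that by (rule abs_cont_on_interval_subset)
qed

lemma AE_lebesgue_not_eq: "AE t in lebesgue. t \<noteq> (b::real)"
  using AE_not_in[of "{b}" lebesgue] by simp

context error_solution
begin

abbreviation "HS \<equiv> error_system M g k\<^sub>R k\<^sub>p k\<^sub>v T\<^sub>m T\<^sub>M"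

text \<open>Whatever the shape of the last interval, \<open>on_slice\<close> keeps it inside {s
  J..b}, where b is the time at which the timer expires, and the explicit flow remains in the flow
  set up to b.\<close>

lemma extend_by_flow:
  assumes E: "E = (\<Union>j<J. {s j..s (Suc j)} \<times> {j}) \<union> I \<times> {J}" and I: "s J \<in> I" "\<And>t. t \<in> I \<Longrightarrow> s J \<le> t"
  defines "b \<equiv> s J + \<tau>c (start J)"
  defines "E' \<equiv> (\<Union>j<J. {s j..s (Suc j)} \<times> {j}) \<union> {s J..b} \<times> {J}"
    and "x' \<equiv> \<lambda>t j. if j = J then sol g (start J) (t - s J) else x t j"
  shows "hybrid_solution HS E' x'" "E \<subseteq> E'" "\<And>t j. (t, j) \<in> E \<Longrightarrow> x' t j = x t j"
proof -
  have memE: "(t, j) \<in> E \<longleftrightarrow> (j < J \<and> s j \<le> t \<and> t \<le> s (Suc j)) \<or> (j = J \<and> t \<in> I)" for t j by (auto simp: E)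
  have memE': "(t, j) \<in> E' \<longleftrightarrow> (j < J \<and> s j \<le> t \<and> t \<le> s (Suc j)) \<or> (j = J \<and> s J \<le> t \<and> t \<le> b)" for t j
    by (auto simp: E'_def)
  have JE: "(s J, J) \<in> E" using I by (simp add: memE)
  have valid: "rotation_matrix (Rc (start J))" "0 \<le> \<tau>c (start J)" "\<tau>c (start J) \<le> T\<^sub>M"
    using start_valid[OF JE] by auto
  have "s J \<le> b" using valid by (simp add: b_def)
  show sub: "E \<subseteq> E'"
  proof safe
    fix t j assume "(t, j) \<in> E"
    then show "(t, j) \<in> E'" using on_slice(2)[of t j] by (auto simp: memE memE' b_def)
  qed
  show agree: "x' t j = x t j" if "(t, j) \<in> E" for t j
    using on_slice(1)[OF that] by (simp add: x'_def)
  have slice_lt: "time_slice E' j = time_slice E j" if "j < J" for j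
    using that by (auto simp: time_slice_def memE memE')
  have slice_J: "time_slice E' J = {s J..b}" by (auto simp: time_slice_def memE')
  have slice_gt: "time_slice E' j = {}" if "J < j" for j
    using that by (auto simp: time_slice_def memE')
  have x'_J: "x' t J = sol g (start J) (t - s J)" for t by (simp add: x'_def)
  have x'_ne: "x' t j = x t j" if "j \<noteq> J" for t j using that by (simp add: x'_def)
  show "hybrid_solution HS E' x'"
    unfolding hybrid_solution_def
  proof (intro conjI allI impI ballI)
    \<comment> \<open>\<open>s (Suc J)\<close> need not be related to the new last interval, so the
      sequence is frozen at b after index J.\<close>
    have "jump_times E' (\<lambda>j. if j \<le> J then s j else b)"
      unfolding jump_times_def
    proof (intro conjI)
      show "incseq (\<lambda>j. if j \<le> J then s j else b)"
        using mono \<open>s J \<le> b\<close> by (intro incseq_SucI) (auto simp: incseq_SucD dest: le_less_Suc_eq)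
      have "(\<Union>j<J. {s j..s (Suc j)} \<times> {j}) = (\<Union>j<J. {(if j \<le> J then s j else b)..(if Suc j \<le> J then s (Suc j) else b)} \<times> {j})"
        by (intro SUP_cong) auto
      then show "E' = (\<Union>j. {if j \<le> J then s j else b..if Suc j \<le> J then s (Suc j) else b} \<times> {j}) \<or>
        (\<exists>K I. E' = (\<Union>j<K. {if j \<le> J then s j else b..if Suc j \<le> J then s (Suc j) else b} \<times> {j}) \<union> I \<times> {K} \<and>
           (I = {if K \<le> J then s K else b..if Suc K \<le> J then s (Suc K) else b} \<or>
            (if K \<le> J then s K else b) < (if Suc K \<le> J then s (Suc K) else b) \<and>
            I = {if K \<le> J then s K else b..<if Suc K \<le> J then s (Suc K) else b} \<or>
            I = {if K \<le> J then s K else b..}))"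
        unfolding E'_def by (intro disjI2 exI[of _ J] exI[of _ "{s J..b}"]) simp
    qed (simp add: s0)
    then show "hybrid_time_domain E'" unfolding hybrid_time_domain_iff by blast
    show "x' 0 0 \<in> flow_set HS \<union> jump_set HS"
      using agree[OF zero] H by (simp add: hybrid_solution_def)
    show "locally_abs_cont_on (time_slice E' j) (\<lambda>t. x' t j)" for j
    proof -
      consider "j < J" | "j = J" | "J < j" by linarith
      then show ?thesis
      proof cases
        case 1
        then show ?thesis using H by (simp add: hybrid_solution_def slice_lt x'_ne)
      next
        case 2
        then show ?thesis
          unfolding locally_abs_cont_on_def 2 slice_J x'_J by (blast intro: sol_shift_abs_cont)
      next
        case 3
        then show ?thesis
          by (auto simp: locally_abs_cont_on_def slice_gt intro!: abs_cont_on_interval_degenerate)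
      qed
    qed
    show "x' t j \<in> flow_set HS" if "t \<in> interior (time_slice E' j)" for t j
    proof -
      consider "j < J" | "j = J" | "J < j" by linarith
      then show ?thesis
      proof cases
        case 1
        then show ?thesis using H that by (simp add: hybrid_solution_def slice_lt x'_ne)
      next
        case 2
        have "t \<in> {s J..b}" using that interior_subset unfolding 2 slice_J by blast
        then show ?thesis
          using valid 2 by (simp add: x'_J error_system_simps \<tau>c_sol rotation_Rc_sol b_def)
      next
        case 3
        then show ?thesis using that by (simp add: slice_gt)
      qed
    qed
    show "AE t in lebesgue. t \<in> time_slice E' j \<longrightarrow>
        ((\<lambda>t. x' t j) has_vector_derivative flow_map HS (x' t j)) (at t within time_slice E' j)" for j
    proof -
      consider "j < J" | "j = J" | "J < j" by linarith
      then show ?thesis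
      proof cases
        case 1
        then show ?thesis using H by (simp add: hybrid_solution_def slice_lt x'_ne)
      next
        case 2
        then show ?thesis
          using sol_shift_has_vector_derivative by (simp add: slice_J x'_J error_system_simps)
      next
        case 3
        then show ?thesis by (simp add: slice_gt)
      qed
    qed
    \<comment> \<open>The extension creates no new jump: if \<open>Suc j = J\<close>, then t <= s
      (Suc j) = s J forces t = s J, which was in I already.\<close>
    have jumps: "(t, j) \<in> E \<and> (t, Suc j) \<in> E" if "(t, j) \<in> E' \<and> (t, Suc j) \<in> E'" for t j
      using that I(1) incseq_SucD[OF mono, of j] by (auto simp: memE memE')
    show "x' t j \<in> jump_set HS" "x' t (Suc j) \<in> jump_map HS (x' t j)" if "(t, j) \<in> E' \<and> (t, Suc j) \<in> E'" for t j
      using jumps[OF that] H by (simp_all add: hybrid_solution_def agree)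
  qed
qed

text \<open>One added point suffices: a one-point slice has empty interior and is negligible, so
  neither the flow constraint nor the differential equation restricts it. The jump rule is
  set-valued in the timer; the value chosen is \<open>T\<^sub>M\<close>.\<close>

lemma extend_by_jump:
  assumes E: "E = (\<Union>j<J. {s j..s (Suc j)} \<times> {j}) \<union> {s J..b} \<times> {J}"
    and b: "s J \<le> b" "\<tau>c (x b J) = 0"
  obtains x' where "hybrid_solution HS (E \<union> {(b, Suc J)}) x'" "\<And>t j. (t, j) \<in> E \<Longrightarrow> x' t j = x t j"
proof -
  have memE: "(t, j) \<in> E \<longleftrightarrow> (j < J \<and> s j \<le> t \<and> t \<le> s (Suc j)) \<or> (j = J \<and> s J \<le> t \<and> t \<le> b)" for t j by (auto simp: E)
  have bE: "(b, J) \<in> E" using b by (simp add: memE)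
  obtain R \<eta> y \<tau> where xb: "x b J = (R, \<eta>, y, \<tau>)" by (metis surj_pair)
  define z where "z = (R, k\<^sub>R *\<^sub>R psi (M ** R), (mat 1 - K_mat k\<^sub>p k\<^sub>v ** C_mat) *v y, T\<^sub>M)"
  define x' where "x' t j = (if j = Suc J then z else x t j)" for t j
  define E' where "E' = E \<union> {(b, Suc J)}"
  have valid: "rotation_matrix (Rc (start J))"
    using start_valid[OF bE] by simp
  have jump: "x b J \<in> jump_set HS" "z \<in> jump_map HS (x b J)"
  proof -
    show "x b J \<in> jump_set HS"
      using b(2) rotation_Rc_sol[OF valid] on_slice(1)[OF bE] by (simp add: error_system_simps)
    show "z \<in> jump_map HS (x b J)"
      using T unfolding xb z_def by (auto simp: error_system_def)
  qed
  have slice_ne: "time_slice E' j = time_slice E j" if "j \<noteq> Suc J" for j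
    using that by (auto simp: time_slice_def E'_def)
  have slice_J: "time_slice E' (Suc J) = {b}" by (auto simp: time_slice_def E'_def memE)
  have agree: "x' t j = x t j" if "(t, j) \<in> E" for t j using that by (auto simp: x'_def memE)
  have "hybrid_solution HS E' x'"
    unfolding hybrid_solution_def
  proof (intro conjI allI impI ballI)
    have "jump_times E' (\<lambda>j. if j \<le> J then s j else b)"
      unfolding jump_times_def
    proof (intro conjI)
      show "incseq (\<lambda>j. if j \<le> J then s j else b)"
        using mono b(1) by (intro incseq_SucI) (auto simp: incseq_SucD dest: le_less_Suc_eq)
      have "(\<Union>j<Suc J. {(if j \<le> J then s j else b)..(if Suc j \<le> J then s (Suc j) else b)} \<times> {j}) \<union> {b..b} \<times> {Suc J} = E'"
        unfolding set_eq_iff split_paired_All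
        by (auto simp: E'_def memE less_Suc_eq split: if_splits dest: le_antisym)
      then show "E' = (\<Union>j. {if j \<le> J then s j else b..if Suc j \<le> J then s (Suc j) else b} \<times> {j}) \<or>
        (\<exists>K I. E' = (\<Union>j<K. {if j \<le> J then s j else b..if Suc j \<le> J then s (Suc j) else b} \<times> {j}) \<union> I \<times> {K} \<and>
           (I = {if K \<le> J then s K else b..if Suc K \<le> J then s (Suc K) else b} \<or>
            (if K \<le> J then s K else b) < (if Suc K \<le> J then s (Suc K) else b) \<and>
            I = {if K \<le> J then s K else b..<if Suc K \<le> J then s (Suc K) else b} \<or>
            I = {if K \<le> J then s K else b..}))"
        by (intro disjI2 exI[of _ "Suc J"] exI[of _ "{b..b}"]) simp
    qed (simp add: s0)
    then show "hybrid_time_domain E'" unfolding hybrid_time_domain_iff by blast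
    show "x' 0 0 \<in> flow_set HS \<union> jump_set HS"
      using agree[OF zero] H by (simp add: hybrid_solution_def)
    show "locally_abs_cont_on (time_slice E' j) (\<lambda>t. x' t j)" for j
    proof (cases "j = Suc J")
      case True
      have "abs_cont_on_interval c d (\<lambda>t. x' t j)" if "{c..d} \<subseteq> {b}" for c d
      proof (rule abs_cont_on_interval_degenerate, rule ccontr)
        assume "\<not> d \<le> c"
        then have "c \<in> {c..d}" "d \<in> {c..d}" by auto
        then have "c = d" using that by blast
        with \<open>\<not> d \<le> c\<close> show False by simp
      qed
      then show ?thesis by (simp add: True slice_J locally_abs_cont_on_def)
    next
      case False
      then show ?thesis using H by (simp add: hybrid_solution_def slice_ne x'_def)
    qed
    show "x' t j \<in> flow_set HS" if "t \<in> interior (time_slice E' j)" for t j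
      using that H by (cases "j = Suc J") (simp_all add: slice_J hybrid_solution_def slice_ne x'_def)
    show "AE t in lebesgue. t \<in> time_slice E' j \<longrightarrow>
        ((\<lambda>t. x' t j) has_vector_derivative flow_map HS (x' t j)) (at t within time_slice E' j)" for j
    proof (cases "j = Suc J")
      case True
      show ?thesis unfolding True slice_J
        using AE_lebesgue_not_eq[of b] by eventually_elim simp
    next
      case False
      then show ?thesis using H by (simp add: hybrid_solution_def slice_ne x'_def)
    qed
    show "x' t j \<in> jump_set HS" "x' t (Suc j) \<in> jump_map HS (x' t j)" if tj: "(t, j) \<in> E' \<and> (t, Suc j) \<in> E'" for t j
    proof -
      have "x' t j \<in> jump_set HS \<and> x' t (Suc j) \<in> jump_map HS (x' t j)"
      proof (cases "j = J")
        case True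
        then have "t = b" using tj by (auto simp: E'_def memE)
        then show ?thesis using jump True by (simp add: x'_def)
      next
        case False
        then have "(t, j) \<in> E" "(t, Suc j) \<in> E" using tj by (auto simp: E'_def memE)
        then show ?thesis using H by (simp add: hybrid_solution_def agree)
      qed
      then show "x' t j \<in> jump_set HS" "x' t (Suc j) \<in> jump_map HS (x' t j)" by auto
    qed
  qed
  then show thesis using that agree unfolding E'_def by blast
qed

text \<open>The domain of a maximal solution has no last interval: that interval would reach the
  time at which the timer expires, and then a jump could be appended. Hence there are infinitely
  many jumps and j is unbounded on the domain.\<close>

lemma maximal_imp_complete:
  assumes max: "maximal_solution HS E x"
  shows "complete_domain E"
proof (rule ccontr)
  assume "\<not> complete_domain E"
  then obtain B where B: "\<And>t j. (t, j) \<in> E \<Longrightarrow> norm (t, real j) \<le> B"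
    unfolding complete_domain_def bounded_iff by fastforce
  have Bt: "t \<le> B" if "(t, j) \<in> E" for t j
    using norm_fst_le[of t "real j"] B[OF that] by simp
  have Bj: "real j \<le> B" if "(t, j) \<in> E" for t j
    using norm_snd_le[of "real j" t] B[OF that] by simp
  have le: "s j \<le> s (Suc j)" for j using mono by (simp add: incseq_SucD)
  have ext: "E' = E" if "hybrid_solution HS E' x'" "E \<subseteq> E'" "\<And>t j. (t, j) \<in> E \<Longrightarrow> x' t j = x t j" for E' x'
    using max that unfolding maximal_solution_def by blast
  have fin: False
    if E: "E = (\<Union>j<J. {s j..s (Suc j)} \<times> {j}) \<union> I \<times> {J}" and I: "s J \<in> I" "\<And>t. t \<in> I \<Longrightarrow> s J \<le> t" for J I
  proof -
    let ?b = "s J + \<tau>c (start J)"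
    have "(\<Union>j<J. {s j..s (Suc j)} \<times> {j}) \<union> {s J..?b} \<times> {J} = E"
      by (rule ext[OF extend_by_flow[OF E I]])
    then have E': "E = (\<Union>j<J. {s j..s (Suc j)} \<times> {j}) \<union> {s J..?b} \<times> {J}" by simp
    have "(s J, J) \<in> E" using I E by auto
    then have le: "s J \<le> ?b" using start_valid by auto
    then have bE: "(?b, J) \<in> E" by (subst E') auto
    have "\<tau>c (x ?b J) = 0" using on_slice(1)[OF bE] by (simp add: \<tau>c_sol)
    then obtain x' where x': "hybrid_solution HS (E \<union> {(?b, Suc J)}) x'" "\<And>t j. (t, j) \<in> E \<Longrightarrow> x' t j = x t j"
      using extend_by_jump[OF E' le] by blast
    have "E \<union> {(?b, Suc J)} = E" by (rule ext[OF x'(1) _ x'(2)]) auto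
    then have "(?b, Suc J) \<in> E" by blast
    then show False unfolding E by auto
  qed
  have "E = (\<Union>j. {s j..s (Suc j)} \<times> {j}) \<or>
         (\<exists>J I. E = (\<Union>j<J. {s j..s (Suc j)} \<times> {j}) \<union> I \<times> {J} \<and>
                (I = {s J..s (Suc J)} \<or> s J < s (Suc J) \<and> I = {s J..<s (Suc J)} \<or> I = {s J..}))"
    using jt by (simp only: jump_times_def)
  then show False
  proof (elim disjE exE conjE)
    assume E: "E = (\<Union>j. {s j..s (Suc j)} \<times> {j})"
    obtain j where "B < real j" using reals_Archimedean2 by blast
    moreover have "(s j, j) \<in> E" using le by (auto simp: E)
    ultimately show False using Bj by fastforce
  next
    fix J I
    assume E: "E = (\<Union>j<J. {s j..s (Suc j)} \<times> {j}) \<union> I \<times> {J}"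
    show False if "I = {s J..s (Suc J)}" by (rule fin[OF E]) (use that le[of J] in auto)
    show False if "s J < s (Suc J)" "I = {s J..<s (Suc J)}" by (rule fin[OF E]) (use that in auto)
    show False if "I = {s J..}" by (rule fin[OF E]) (use that in auto)
  qed
qed

end

section \<open>Estimates along the flow\<close>

lemma rot_norm_le_1:
  assumes "rotation_matrix R" shows "rot_norm R \<le> 1"
proof -
  obtain a q where aq: "a\<^sup>2 + q \<bullet> q = 1" "R = quat_mat a q" using rotation_eq_quat_mat[OF assms] .
  then have "(norm q)\<^sup>2 \<le> 1" by (simp add: dot_square_norm) (metis le_add_same_cancel2 zero_le_power2)
  then have "norm q \<le> 1" by (simp add: abs_square_le_1)
  then show ?thesis by (simp add: aq(2) rot_norm_quat_mat[OF aq(1)])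
qed

lemma norm_mat_1_minus_rotation_sqrt:
  assumes "rotation_matrix R"
  shows "norm (mat 1 - R) = sqrt 8 * rot_norm R"
proof -
  have "norm (mat 1 - R) = sqrt (8 * (rot_norm R)\<^sup>2)"
    by (metis norm_mat_1_minus_rotation[OF assms] norm_ge_zero real_sqrt_unique)
  then show ?thesis using rot_norm_nonneg[OF assms] by (simp add: real_sqrt_mult)
qed

text \<open>Rotations form a bounded set, so the derivative R ** rot w s ** skew w is at most a
  constant times |w|, uniformly in R and s; the bound follows by integration.\<close>

lemma rot_displacement:
  obtains c where "c > 0"
    "\<And>R w s. rotation_matrix R \<Longrightarrow> 0 \<le> s \<Longrightarrow> norm (R ** rot w s - R) \<le> c * norm w * s"
proof -
  obtain K where K: "K > 0" "\<And>(A :: real^3^3) (B :: real^3^3). norm (A ** B) \<le> norm A * norm B * K"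
    using mat_mult.pos_bounded by blast
  obtain L where L: "L > 0" "\<And>w. norm (skew w) \<le> norm w * L"
    using bounded_linear.pos_bounded[OF bounded_linear_skew] by blast
  define N where "N = norm (mat 1 :: real^3^3) + sqrt 8"
  have "N > 0" by (simp add: N_def add_nonneg_pos)
  have N: "norm R \<le> N" if "rotation_matrix R" for R :: "real^3^3"
  proof -
    have "norm (mat 1 - R) \<le> sqrt 8 * 1"
      unfolding norm_mat_1_minus_rotation_sqrt[OF that] by (intro mult_left_mono rot_norm_le_1 that) simp
    moreover have "norm R \<le> norm (mat 1 :: real^3^3) + norm (mat 1 - R)"
      by (metis norm_triangle_sub norm_minus_commute)
    ultimately show ?thesis by (simp add: N_def)
  qed
  show thesis
  proof
    show "N * L * K > 0" using \<open>N > 0\<close> K L by simp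
    fix R :: "real^3^3" and w and s :: real assume R: "rotation_matrix R" and "0 \<le> s"
    have "((\<lambda>s. R ** (rot w s ** skew w)) has_integral (R ** rot w s - R ** rot w 0)) {0..s}"
      by (rule fundamental_theorem_of_calculus[OF \<open>0 \<le> s\<close>])
        (rule bounded_linear.has_vector_derivative[OF mat_mult.bounded_linear_right rot_has_vector_derivative])
    moreover have "norm (R ** (rot w s ** skew w)) \<le> N * L * K * norm w" for s
    proof -
      have "norm (R ** (rot w s ** skew w)) = norm ((R ** rot w s) ** skew w)" by (simp add: matrix_mul_assoc)
      also have "\<dots> \<le> norm (R ** rot w s) * norm (skew w) * K" by (rule K)
      also have "\<dots> \<le> N * (norm w * L) * K"
        using K(1) L(1) \<open>N > 0\<close> by (intro mult_mono N L rotation_matrix_mult R rotation_rot mult_nonneg_nonneg) auto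
      finally show ?thesis by (simp add: mult_ac)
    qed
    ultimately have "norm (R ** rot w s - R ** rot w 0) \<le> N * L * K * norm w * measure lborel {0..s}"
      using \<open>N > 0\<close> K L by (intro has_integral_bound_real) auto
    then show "norm (R ** rot w s - R) \<le> N * L * K * norm w * s"
      using \<open>0 \<le> s\<close> by (simp add: matrix_mul_rid)
  qed
qed

lemma rot_norm_growth:
  obtains c where "c > 0"
    "\<And>R w s. rotation_matrix R \<Longrightarrow> 0 \<le> s \<Longrightarrow> rot_norm (R ** rot w s) \<le> rot_norm R + c * norm w * s"
proof -
  obtain c where c: "c > 0"
    "\<And>R w s. rotation_matrix R \<Longrightarrow> 0 \<le> s \<Longrightarrow> norm (R ** rot w s - R) \<le> c * norm w * s"
    using rot_displacement by blast
  show thesis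
  proof (rule that[OF c(1)])
    fix R :: "real^3^3" and w and s :: real assume R: "rotation_matrix R" and s: "0 \<le> s"
    have R': "rotation_matrix (R ** rot w s)" by (intro rotation_matrix_mult R rotation_rot)
    have "mat 1 - R ** rot w s = (mat 1 - R) - (R ** rot w s - R)" by simp
    then have "norm (mat 1 - R ** rot w s) \<le> norm (mat 1 - R) + norm (R ** rot w s - R)"
      by (metis norm_triangle_ineq4)
    then have "sqrt 8 * rot_norm (R ** rot w s) \<le> sqrt 8 * rot_norm R + c * norm w * s"
      using c(2)[OF R s, of w] by (simp add: norm_mat_1_minus_rotation_sqrt R R')
    also have "\<dots> \<le> sqrt 8 * rot_norm R + sqrt 8 * (c * norm w * s)"
    proof -
      have "0 \<le> c * norm w * s" using c(1) s by simp
      then have "1 * (c * norm w * s) \<le> sqrt 8 * (c * norm w * s)" by (intro mult_right_mono) auto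
      then show ?thesis by simp
    qed
    finally have "sqrt 8 * rot_norm (R ** rot w s) \<le> sqrt 8 * (rot_norm R + c * norm w * s)"
      by (simp add: distrib_left)
    then show "rot_norm (R ** rot w s) \<le> rot_norm R + c * norm w * s"
      by simp
  qed
qed

text \<open>A sum in place of the root of a sum of squares: the estimates along flow and jumps are
  linear in the components and simply add up. It agrees with \<open>target_dist\<close> up to a
  factor 3.\<close>

definition comp_norm :: "state \<Rightarrow> real" where
  "comp_norm = (\<lambda>(R, \<eta>, x, \<tau>). rot_norm R + norm \<eta> + norm x)"

lemma target_dist_le_comp_norm:
  assumes "rotation_matrix (Rc z)" shows "target_dist z \<le> comp_norm z"
proof -
  obtain R \<eta> x \<tau> where z: "z = (R, \<eta>, x, \<tau>)" by (metis surj_pair)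
  have r: "rot_norm R \<ge> 0" using assms rot_norm_nonneg by (simp add: Rc_def z)
  have "(rot_norm R)\<^sup>2 + (norm \<eta>)\<^sup>2 + (norm x)\<^sup>2 \<le> (rot_norm R + norm \<eta> + norm x)\<^sup>2"
    using r by (simp add: power2_eq_square algebra_simps)
  then show ?thesis
    using r by (simp add: target_dist_def comp_norm_def z real_le_lsqrt)
qed

lemma comp_norm_le_target_dist: "comp_norm z \<le> 3 * target_dist z"
proof -
  obtain R \<eta> x \<tau> where z: "z = (R, \<eta>, x, \<tau>)" by (metis surj_pair)
  let ?d = "sqrt ((rot_norm R)\<^sup>2 + (norm \<eta>)\<^sup>2 + (norm x)\<^sup>2)"
  have "rot_norm R \<le> ?d" "norm \<eta> \<le> ?d" "norm x \<le> ?d"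
    by (rule real_le_rsqrt, simp)+
  then show ?thesis by (simp add: target_dist_def comp_norm_def z)
qed

lemma comp_norm_nonneg: "rotation_matrix (Rc z) \<Longrightarrow> comp_norm z \<ge> 0"
  using rot_norm_nonneg by (auto simp: comp_norm_def Rc_def case_prod_beta intro!: add_nonneg_nonneg)

lemma delta_g_bound:
  obtains c where "c > 0" "\<And>R. rotation_matrix R \<Longrightarrow> norm (delta_g g R) \<le> c * rot_norm R"
proof -
  obtain L where L: "L > 0" "\<And>X. norm (vstack 0 (g v* X) :: real^(3+3)) \<le> norm (X :: real^3^3) * L"
    using bounded_linear.pos_bounded[OF bounded_linear_delta] by blast
  show thesis
  proof (rule that[of "sqrt 8 * L"])
    show "norm (delta_g g R) \<le> sqrt 8 * L * rot_norm R" if "rotation_matrix R" for R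
      using L(2)[of "mat 1 - R"] by (simp add: delta_g_def norm_mat_1_minus_rotation_sqrt[OF that] mult_ac)
  qed (use L in simp)
qed

lemma A_mat_bound:
  obtains c where "c > 0" "\<And>x. norm (A_mat *v x) \<le> c * norm x"
  using bounded_linear.pos_bounded[OF matrix_vector_mul_bounded_linear[of A_mat]] by (metis mult.commute)

lemma Phi_bound:
  obtains c where "c > 0" "\<And>t x. 0 \<le> t \<Longrightarrow> t \<le> T \<Longrightarrow> norm (Phi t *v x) \<le> c * norm x"
proof -
  obtain a where a: "a > 0" "\<And>x. norm (A_mat *v x) \<le> a * norm x" using A_mat_bound by blast
  show thesis
  proof (rule that[of "1 + \<bar>T\<bar> * a"])
    show "1 + \<bar>T\<bar> * a > 0" using a(1) by (simp add: add_pos_nonneg)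
    fix t x assume "0 \<le> t" "t \<le> T"
    have "norm (Phi t *v x) \<le> norm x + t * norm (A_mat *v x)"
      unfolding Phi_mult_vector using norm_triangle_ineq[of x "t *\<^sub>R (A_mat *v x)"] \<open>0 \<le> t\<close> by simp
    also have "\<dots> \<le> norm x + \<bar>T\<bar> * (a * norm x)"
      using \<open>0 \<le> t\<close> \<open>t \<le> T\<close> by (intro add_left_mono mult_mono a) auto
    finally show "norm (Phi t *v x) \<le> (1 + \<bar>T\<bar> * a) * norm x" by (simp add: algebra_simps)
  qed
qed

text \<open>\<open>delta_g\<close> vanishes at the identity and is of the order of
  \<open>rot_norm\<close>, which itself grows at most linearly along the flow. Gravity therefore
  disturbs x only in proportion to the attitude error and the angular velocity.\<close>

lemma drift_bound:
  assumes "T \<ge> 0"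
  obtains c where "c > 0" "\<And>R w t. rotation_matrix R \<Longrightarrow> 0 \<le> t \<Longrightarrow> t \<le> T \<Longrightarrow>
    norm (drift g R w t) \<le> c * (rot_norm R + norm w)"
proof -
  obtain r where r: "r > 0" "\<And>R w s. rotation_matrix R \<Longrightarrow> 0 \<le> s \<Longrightarrow> rot_norm (R ** rot w s) \<le> rot_norm R + r * norm w * s"
    using rot_norm_growth by blast
  obtain d where d: "d > 0" "\<And>R. rotation_matrix R \<Longrightarrow> norm (delta_g g R) \<le> d * rot_norm R"
    using delta_g_bound by blast
  obtain a where a: "a > 0" "\<And>x. norm (A_mat *v x) \<le> a * norm x" using A_mat_bound by blast
  let ?c = "(1 + T * a) * d * (1 + r * T)"
  have c: "?c > 0" using r d a assms by (simp add: add_pos_nonneg)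
  show thesis
  \<comment> \<open>The length of the interval is at most T; T + 1 keeps the constant positive for T
    = 0 as well.\<close>
  proof (rule that[of "?c * (T + 1)"])
    show "?c * (T + 1) > 0" using c assms by simp
    fix R :: "real^3^3" and w and t :: real assume R: "rotation_matrix R" and t: "0 \<le> t" "t \<le> T"
    have rn: "rot_norm R \<ge> 0" using rot_norm_nonneg[OF R] .
    have f: "norm (forcing g R w s) \<le> ?c * (rot_norm R + norm w)" if "s \<in> {0..t}" for s
    proof -
      let ?x = "delta_g g (R ** rot w s)"
      have s: "0 \<le> s" "s \<le> T" using that t by auto
      have "norm (forcing g R w s) \<le> norm ?x + s * norm (A_mat *v ?x)"
        unfolding forcing_def using norm_triangle_ineq4[of ?x "s *\<^sub>R (A_mat *v ?x)"] s by simp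
      also have "\<dots> \<le> norm ?x + T * (a * norm ?x)"
        using s by (intro add_left_mono mult_mono a) auto
      also have "\<dots> = (1 + T * a) * norm ?x" by (simp add: algebra_simps)
      also have "\<dots> \<le> (1 + T * a) * (d * (rot_norm R + r * norm w * s))"
      proof (rule mult_left_mono)
        have "norm ?x \<le> d * rot_norm (R ** rot w s)"
          by (intro d rotation_matrix_mult R rotation_rot)
        also have "\<dots> \<le> d * (rot_norm R + r * norm w * s)"
          using d(1) by (intro mult_left_mono r R s) simp
        finally show "norm ?x \<le> d * (rot_norm R + r * norm w * s)" .
      qed (use a assms in simp)
      also have "\<dots> \<le> (1 + T * a) * (d * ((1 + r * T) * (rot_norm R + norm w)))"
      proof (intro mult_left_mono)
        have "r * norm w * s \<le> r * norm w * T" using r(1) s by (intro mult_left_mono) auto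
        moreover have "0 \<le> r * T * rot_norm R" using r(1) assms rn by simp
        ultimately show "rot_norm R + r * norm w * s \<le> (1 + r * T) * (rot_norm R + norm w)"
          unfolding distrib_left distrib_right mult_1 by (smt (verit) norm_ge_zero mult.assoc mult.commute)
      qed (use a assms d in simp_all)
      finally show ?thesis by (simp add: mult_ac)
    qed
    have "(forcing g R w has_integral drift g R w t) {0..t}"
      unfolding drift_def by (intro integrable_integral integrable_continuous_real continuous_on_forcing)
    then have "norm (drift g R w t) \<le> ?c * (rot_norm R + norm w) * measure lborel {0..t}"
      using c rn f by (intro has_integral_bound_real) (auto intro!: mult_nonneg_nonneg add_nonneg_nonneg)
    also have "\<dots> \<le> ?c * (rot_norm R + norm w) * (T + 1)"
      using c rn t a(1) d(1) r(1) by (intro mult_left_mono mult_nonneg_nonneg add_nonneg_nonneg) auto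
    finally show "norm (drift g R w t) \<le> ?c * (T + 1) * (rot_norm R + norm w)" by (simp add: mult_ac)
  qed
qed

lemma sol_growth:
  assumes "T \<ge> 0"
  obtains c where "c > 0" "\<And>z t. rotation_matrix (Rc z) \<Longrightarrow> 0 \<le> t \<Longrightarrow> t \<le> T \<Longrightarrow> comp_norm (sol g z t) \<le> c * comp_norm z"
proof -
  obtain r where r: "r > 0" "\<And>R w s. rotation_matrix R \<Longrightarrow> 0 \<le> s \<Longrightarrow> rot_norm (R ** rot w s) \<le> rot_norm R + r * norm w * s"
    using rot_norm_growth by blast
  obtain d where d: "d > 0" "\<And>R w t. rotation_matrix R \<Longrightarrow> 0 \<le> t \<Longrightarrow> t \<le> T \<Longrightarrow>
    norm (drift g R w t) \<le> d * (rot_norm R + norm w)" using drift_bound[OF assms] by blast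
  obtain p where p: "p > 0" "\<And>t x. 0 \<le> t \<Longrightarrow> t \<le> T \<Longrightarrow> norm (Phi t *v x) \<le> p * norm x"
    using Phi_bound by blast
  show thesis
  proof (rule that[of "2 + r * T + p + p * d"])
    show "2 + r * T + p + p * d > 0" using r d p assms by (simp add: add_pos_nonneg)
    fix z :: state and t :: real assume Rz: "rotation_matrix (Rc z)" and t: "0 \<le> t" "t \<le> T"
    obtain R \<eta> x \<tau> where z: "z = (R, \<eta>, x, \<tau>)" by (metis surj_pair)
    have R: "rotation_matrix R" using Rz by (simp add: z Rc_def)
    note rn = rot_norm_nonneg[OF R]
    have "rot_norm (R ** rot (- \<eta>) t) \<le> rot_norm R + r * norm \<eta> * t"
      using r(2)[OF R t(1), of "- \<eta>"] by simp
    also have "\<dots> \<le> rot_norm R + r * norm \<eta> * T"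
      using t r(1) by (intro add_left_mono mult_left_mono) auto
    finally have 1: "rot_norm (R ** rot (- \<eta>) t) \<le> rot_norm R + r * T * norm \<eta>" by (simp add: mult_ac)
    have "norm (Phi t *v (x + drift g R (- \<eta>) t)) \<le> p * norm (x + drift g R (- \<eta>) t)"
      by (rule p(2)[OF t])
    also have "\<dots> \<le> p * (norm x + d * (rot_norm R + norm \<eta>))"
      using p(1) d(2)[OF R t, of "- \<eta>"] norm_triangle_ineq[of x "drift g R (- \<eta>) t"]
      by (intro mult_left_mono) auto
    finally have 2: "norm (Phi t *v (x + drift g R (- \<eta>) t)) \<le> p * norm x + p * d * (rot_norm R + norm \<eta>)"
      by (simp add: algebra_simps)
    have "comp_norm (sol g z t) \<le> rot_norm R + r * T * norm \<eta> + norm \<eta> + (p * norm x + p * d * (rot_norm R + norm \<eta>))"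
      using 1 2 by (simp add: comp_norm_def sol_def z)
    also have "\<dots> \<le> (2 + r * T + p + p * d) * (rot_norm R + norm \<eta> + norm x)"
    proof -
      have "0 \<le> r * T * rot_norm R" "0 \<le> r * T * norm x" "0 \<le> p * norm \<eta>" "0 \<le> p * rot_norm R"
        "0 \<le> p * d * norm x" using r p d assms rn by simp_all
      then show ?thesis using rn by (simp add: algebra_simps)
    qed
    finally show "comp_norm (sol g z t) \<le> (2 + r * T + p + p * d) * comp_norm z"
      by (simp add: comp_norm_def z)
  qed
qed



section \<open>The potential along the attitude flow\<close>

lemma psi_diff_bound:
  obtains c where "c > 0" "\<And>R S. norm (psi (M ** R) - psi (M ** S)) \<le> c * norm (R - S)"
proof -
  have "linear psi" by (intro linearI) (simp_all add: mat3_simps field_simps)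
  then have "bounded_linear (\<lambda>X. psi (M ** X))"
    by (intro bounded_linear_compose[OF _ mat_mult.bounded_linear_right]) (simp add: linear_conv_bounded_linear)
  then obtain c where c: "c > 0" "\<And>X. norm (psi (M ** X)) \<le> norm X * c" and lin: "bounded_linear (\<lambda>X. psi (M ** X))"
    using bounded_linear.pos_bounded by blast
  show thesis
    by (rule that[OF c(1)]) (use c(2) in \<open>simp add: mult.commute flip: linear_diff[OF bounded_linear.linear[OF lin]]\<close>)
qed

text \<open>psi (M R) is linear in R and vanishes at the identity, because the symmetric M has no
  skew part; so it is bounded by a multiple of |I - R|.\<close>

lemma psi_bound:
  assumes "transpose M = M"
  obtains c where "c > 0" "\<And>R. rotation_matrix R \<Longrightarrow> norm (psi (M ** R)) \<le> c * rot_norm R"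
proof -
  obtain c where c: "c > 0" "\<And>R S. norm (psi (M ** R) - psi (M ** S)) \<le> c * norm (R - S)"
    using psi_diff_bound by blast
  have "M$i$j = M$j$i" for i j
    using arg_cong[OF assms, of "\<lambda>A. A$i$j"] by (simp add: transpose_def)
  then have "psi (M ** mat 1) = 0"
    by (simp add: vec_eq_iff forall_3 psi_component)
  then have "norm (psi (M ** R)) \<le> c * norm (mat 1 - R)" for R
    using c(2)[of R "mat 1"] by (simp add: norm_minus_commute)
  then show thesis
    using c(1) by (intro that[of "c * sqrt 8"]) (simp_all add: mult.assoc flip: norm_mat_1_minus_rotation_sqrt)
qed

lemma trace_mult_skew: "trace (B ** skew w) = - 2 * (psi B \<bullet> w)"
  by (simp add: mat3_simps) (simp add: field_simps)

lemma pot_has_derivative: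
  "((\<lambda>s. pot M (R ** rot w s)) has_real_derivative 2 * (psi (M ** (R ** rot w s)) \<bullet> w)) (at s)"
proof -
  have "linear (trace :: real^3^3 \<Rightarrow> real)" by (intro linearI) (simp_all add: trace_add trace_scaleR)
  then have "bounded_linear (\<lambda>X :: real^3^3. trace (M ** X))"
    by (intro bounded_linear_compose[OF _ mat_mult.bounded_linear_right]) (simp add: linear_conv_bounded_linear)
  then have "((\<lambda>s. trace (M ** (R ** rot w s))) has_vector_derivative trace (M ** (R ** (rot w s ** skew w)))) (at s)"
    by (rule bounded_linear.has_vector_derivative)
      (rule bounded_linear.has_vector_derivative[OF mat_mult.bounded_linear_right rot_has_vector_derivative])
  also have "trace (M ** (R ** (rot w s ** skew w))) = - 2 * (psi (M ** (R ** rot w s)) \<bullet> w)"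
    by (simp add: matrix_mul_assoc trace_mult_skew)
  finally show ?thesis
    unfolding pot_def has_real_derivative_iff_has_vector_derivative[symmetric]
    by (auto intro!: derivative_eq_intros)
qed

lemma pot_increment_le:
  assumes "0 \<le> t" and d: "\<And>s. 0 \<le> s \<Longrightarrow> s \<le> t \<Longrightarrow> 2 * (psi (M ** (R ** rot w s)) \<bullet> w) \<le> B"
  shows "pot M (R ** rot w t) \<le> pot M R + B * t"
proof -
  have "B * 0 - pot M (R ** rot w 0) \<le> B * t - pot M (R ** rot w t)"
  proof (rule DERIV_nonneg_imp_nondecreasing[OF \<open>0 \<le> t\<close>, of "\<lambda>s. B * s - pot M (R ** rot w s)"])
    fix s assume s: "0 \<le> s" "s \<le> t"
    have "((\<lambda>s. B * s - pot M (R ** rot w s)) has_real_derivative B - 2 * (psi (M ** (R ** rot w s)) \<bullet> w)) (at s)"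
      by (rule derivative_eq_intros pot_has_derivative refl | simp)+
    then show "\<exists>y. ((\<lambda>s. B * s - pot M (R ** rot w s)) has_real_derivative y) (at s) \<and> 0 \<le> y"
      using d[OF s] by (intro exI conjI) auto
  qed
  then show ?thesis by (simp add: matrix_mul_rid)
qed

text \<open>Meant for the first interval, where \<eta> is not yet a descent direction: psi is
  bounded on rotations, so the potential can rise only in proportion to |w|.\<close>

lemma pot_growth:
  assumes M: "transpose M = M" and "T \<ge> 0"
  obtains c where "c > 0" "\<And>R w t. rotation_matrix R \<Longrightarrow> 0 \<le> t \<Longrightarrow> t \<le> T \<Longrightarrow>
    pot M (R ** rot w t) \<le> pot M R + c * norm w"
proof -
  obtain c where c: "c > 0" "\<And>R. rotation_matrix R \<Longrightarrow> norm (psi (M ** R)) \<le> c * rot_norm R"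
    using psi_bound[OF M] by blast
  show thesis
  proof (rule that[of "2 * c * (T + 1)"])
    show "2 * c * (T + 1) > 0" using c assms by simp
    fix R :: "real^3^3" and w and t :: real assume R: "rotation_matrix R" and t: "0 \<le> t" "t \<le> T"
    have "2 * (psi (M ** (R ** rot w s)) \<bullet> w) \<le> 2 * c * norm w" for s
    proof -
      have R': "rotation_matrix (R ** rot w s)" by (intro rotation_matrix_mult R rotation_rot)
      have "psi (M ** (R ** rot w s)) \<bullet> w \<le> norm (psi (M ** (R ** rot w s))) * norm w"
        by (rule norm_cauchy_schwarz)
      also have "\<dots> \<le> c * 1 * norm w"
        using c(1) rot_norm_le_1[OF R'] by (intro mult_right_mono order.trans[OF c(2)[OF R']] mult_left_mono) auto
      finally show ?thesis by simp
    qed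
    then have "pot M (R ** rot w t) \<le> pot M R + 2 * c * norm w * t"
      by (intro pot_increment_le t)
    also have "\<dots> \<le> pot M R + 2 * c * norm w * (T + 1)"
      using c(1) t by (intro add_left_mono mult_left_mono) auto
    finally show "pot M (R ** rot w t) \<le> pot M R + 2 * c * (T + 1) * norm w" by (simp add: mult_ac)
  qed
qed

text \<open>The direction is the gradient sampled at the last jump and held since. Within time T the
  true gradient moves by at most c r k T times its sampled norm, that is, by at most half of it. The
  derivative 2 psi . w then stays below - k times the squared sampled norm.\<close>

lemma pot_descent:
  assumes "T \<ge> 0"
  obtains k\<^sub>0 where "k\<^sub>0 > 0" "\<And>R k t. rotation_matrix R \<Longrightarrow> 0 < k \<Longrightarrow> k < k\<^sub>0 \<Longrightarrow> 0 \<le> t \<Longrightarrow> t \<le> T \<Longrightarrow>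
    pot M (R ** rot (- (k *\<^sub>R psi (M ** R))) t) \<le> pot M R - k * (norm (psi (M ** R)))\<^sup>2 * t"
proof -
  obtain c where c: "c > 0" "\<And>R S. norm (psi (M ** R) - psi (M ** S)) \<le> c * norm (R - S)"
    using psi_diff_bound by blast
  obtain r where r: "r > 0" "\<And>R w s. rotation_matrix R \<Longrightarrow> 0 \<le> s \<Longrightarrow> norm (R ** rot w s - R) \<le> r * norm w * s"
    using rot_displacement by blast
  \<comment> \<open>Chosen to make 2 c r k T <= 1; T + 1 keeps the denominator positive for T =
    0.\<close>
  define k0 where "k0 = 1 / (2 * c * r * (T + 1))"
  show thesis
  proof (rule that[of k0])
    show "k0 > 0" using c r assms by (simp add: k0_def)
    fix R :: "real^3^3" and k t :: real assume R: "rotation_matrix R" and k: "0 < k" "k < k0" and t: "0 \<le> t" "t \<le> T"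
    let ?p = "psi (M ** R)"
    let ?w = "- (k *\<^sub>R ?p)"
    have kc: "2 * (c * r * k * T) \<le> 1"
    proof -
      have "0 < 2 * c * r * (T + 1)" using c(1) r(1) assms by simp
      then have "k * (2 * c * r * (T + 1)) < 1" using k(2) unfolding k0_def by (simp only: pos_less_divide_eq)
      moreover have "0 \<le> 2 * c * r * k" using c(1) r(1) k by simp
      ultimately show ?thesis by (simp add: algebra_simps)
    qed
    have "2 * (psi (M ** (R ** rot ?w s)) \<bullet> ?w) \<le> - k * (norm ?p)\<^sup>2" if s: "0 \<le> s" "s \<le> t" for s
    proof -
      let ?q = "psi (M ** (R ** rot ?w s))"
      have "norm (?q - ?p) \<le> c * (r * norm ?w * s)"
        using c(1) by (intro order.trans[OF c(2)] mult_left_mono r R s) simp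
      also have "\<dots> = c * r * k * s * norm ?p" using k by (simp add: mult_ac)
      also have "\<dots> \<le> c * r * k * T * norm ?p"
        using c r k s t by (intro mult_right_mono mult_left_mono) auto
      finally have qp: "norm (?q - ?p) \<le> c * r * k * T * norm ?p" .
      have "- (?q \<bullet> ?p) = - (norm ?p)\<^sup>2 - (?q - ?p) \<bullet> ?p"
        by (simp add: inner_diff_left dot_square_norm)
      also have "\<dots> \<le> - (norm ?p)\<^sup>2 + norm (?q - ?p) * norm ?p"
        using norm_cauchy_schwarz[of "- (?q - ?p)" ?p] by (simp add: inner_diff_left norm_minus_commute)
      also have "\<dots> \<le> - (norm ?p)\<^sup>2 + c * r * k * T * norm ?p * norm ?p"
        by (intro add_left_mono mult_right_mono qp) simp
      also have "\<dots> = (c * r * k * T - 1) * (norm ?p)\<^sup>2" by (simp add: algebra_simps power2_eq_square)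
      also have "\<dots> \<le> (- 1 / 2) * (norm ?p)\<^sup>2" using kc by (intro mult_right_mono) auto
      finally have "2 * k * - (?q \<bullet> ?p) \<le> 2 * k * ((- 1 / 2) * (norm ?p)\<^sup>2)" using k by (intro mult_left_mono) auto
      then show ?thesis by (simp add: mult_ac)
    qed
    from pot_increment_le[OF t(1) this]
    show "pot M (R ** rot ?w t) \<le> pot M R - k * (norm ?p)\<^sup>2 * t" by simp
  qed
qed

section \<open>Quadratic forms and the contraction in the norm of P\<close>

lemma sym_pos_def_bounds:
  fixes P :: "real^'n^'n"
  assumes "sym_pos_def P"
  obtains a b where "a > 0" "b > 0" "\<And>x. a * (norm x)\<^sup>2 \<le> x \<bullet> (P *v x)" "\<And>x. x \<bullet> (P *v x) \<le> b * (norm x)\<^sup>2"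
proof -
  have sym: "transpose P = P" and pos: "\<And>x. x \<noteq> 0 \<Longrightarrow> 0 < x \<bullet> (P *v x)" using assms by (auto simp: sym_pos_def_def)
  note r = symmetric_rayleigh_bounds[OF sym]
  have eig: "l > 0" if l: "l \<in> eigenvalues P" for l
  proof -
    obtain v where v: "v \<noteq> 0" "P *v v = l *\<^sub>R v" using l unfolding eigenvalues_def by blast
    have "0 < v \<bullet> v" using v(1) by simp
    moreover have "0 < l * (v \<bullet> v)" using pos[OF v(1)] v(2) by simp
    ultimately show ?thesis by (metis zero_less_mult_pos2)
  qed
  show thesis
    using eig[OF r(1)] eig[OF r(2)] r(3,4)[unfolded dot_square_norm] by (rule that)
qed

text \<open>A weighted Young inequality, obtained by expanding the nonnegative form at a u - v and
  dividing by a. A small a costs little on u and shifts the burden to v.\<close>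

lemma quadratic_form_add_le:
  fixes P :: "real^'n^'n"
  assumes "sym_pos_def P" "a > 0"
  shows "(u + v) \<bullet> (P *v (u + v)) \<le> (1 + a) * (u \<bullet> (P *v u)) + (1 + 1 / a) * (v \<bullet> (P *v v))"
proof -
  have sym: "transpose P = P" and pos: "0 \<le> x \<bullet> (P *v x)" for x
    using assms by (auto simp: sym_pos_def_def) (cases "x = 0"; force)
  let ?w = "a *\<^sub>R u - v"
  have uv: "v \<bullet> (P *v u) = u \<bullet> (P *v v)" using symmetric_matrix_inner[OF sym, of v u] by (simp add: inner_commute)
  have "0 \<le> (1 / a) * (?w \<bullet> (P *v ?w))" using pos[of ?w] \<open>a > 0\<close> by (intro mult_nonneg_nonneg) auto
  also have "?w \<bullet> (P *v ?w) = a\<^sup>2 * (u \<bullet> (P *v u)) - 2 * a * (u \<bullet> (P *v v)) + v \<bullet> (P *v v)"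
    by (simp add: matrix_vector_mult_diff_distrib matrix_vector_mult_scaleR inner_diff_left inner_diff_right uv
        power2_eq_square algebra_simps)
  finally have "0 \<le> a * (u \<bullet> (P *v u)) - 2 * (u \<bullet> (P *v v)) + (1 / a) * (v \<bullet> (P *v v))"
    using \<open>a > 0\<close> by (simp add: field_simps power2_eq_square)
  then show ?thesis
    by (simp add: matrix_vector_right_distrib inner_add_left inner_add_right uv algebra_simps)
qed

lemma Xi_form:
  "y \<bullet> (Xi k\<^sub>p k\<^sub>v P \<tau> *v y) =
    (Phi \<tau> *v (Ag_mat k\<^sub>p k\<^sub>v *v y)) \<bullet> (P *v (Phi \<tau> *v (Ag_mat k\<^sub>p k\<^sub>v *v y))) - y \<bullet> (P *v y)"
proof -
  have adj: "y \<bullet> (transpose B *v z) = (B *v y) \<bullet> z" for B :: "real^(3+3)^(3+3)" and y z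
    by (metis dot_lmul_matrix transpose_matrix_vector transpose_transpose)
  show ?thesis
    unfolding Xi_def matrix_vector_mult_diff_rdistrib inner_diff_right matrix_vector_mul_assoc[symmetric] adj ..
qed

text \<open>The form of \<Xi> is negative at each single \<tau>; continuity on the compact product
  of the timer interval and the unit sphere makes the gap d uniform, and homogeneity extends it to
  all y.\<close>

lemma jump_flow_contraction:
  assumes P: "sym_pos_def P" and neg: "\<And>\<tau>. \<tau> \<in> {T\<^sub>m..T\<^sub>M} \<Longrightarrow> sym_neg_def (Xi k\<^sub>p k\<^sub>v P \<tau>)" and "T\<^sub>m \<le> T\<^sub>M"
  obtains \<rho> where "\<rho> < 1" "0 < \<rho>" "\<And>\<tau> y. \<tau> \<in> {T\<^sub>m..T\<^sub>M} \<Longrightarrow>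
    (Phi \<tau> *v (Ag_mat k\<^sub>p k\<^sub>v *v y)) \<bullet> (P *v (Phi \<tau> *v (Ag_mat k\<^sub>p k\<^sub>v *v y))) \<le> \<rho> * (y \<bullet> (P *v y))"
proof -
  obtain a b where ab: "a > 0" "b > 0" "\<And>x. a * (norm x)\<^sup>2 \<le> x \<bullet> (P *v x)" "\<And>x. x \<bullet> (P *v x) \<le> b * (norm x)\<^sup>2"
    using sym_pos_def_bounds[OF P] by blast
  define h where "h \<tau> y = y \<bullet> (Xi k\<^sub>p k\<^sub>v P \<tau> *v y)" for \<tau> y
  let ?S = "{T\<^sub>m..T\<^sub>M} \<times> (sphere 0 1 :: (real^(3+3)) set)"
  have cont: "continuous_on ?S (\<lambda>z. h (fst z) (snd z))"
    unfolding h_def Xi_form Phi_mult_vector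
    by (intro continuous_intros bounded_linear.continuous_on[OF matrix_vector_mul_bounded_linear])
  have ne: "?S \<noteq> {}" using \<open>T\<^sub>m \<le> T\<^sub>M\<close> by (auto simp: times_eq_iff)
  have cpt: "compact ?S" by (intro compact_Times) auto
  obtain z where z: "z \<in> ?S" "\<And>w. w \<in> ?S \<Longrightarrow> h (fst w) (snd w) \<le> h (fst z) (snd z)"
    using continuous_attains_sup[OF cpt ne cont] by blast
  define d where "d = - h (fst z) (snd z)"
  have "snd z \<noteq> 0" using z(1) by auto
  then have "d > 0" using neg[of "fst z"] z(1) by (auto simp: d_def h_def sym_neg_def_def)
  have hd: "h \<tau> y \<le> - d * (norm y)\<^sup>2" if "\<tau> \<in> {T\<^sub>m..T\<^sub>M}" for \<tau> y
  proof (cases "y = 0")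
    case False
    have "h \<tau> (sgn y) \<le> - d" using z(2)[of "(\<tau>, sgn y)"] that False by (simp add: d_def norm_sgn)
    then have "(norm y)\<^sup>2 * h \<tau> (sgn y) \<le> (norm y)\<^sup>2 * - d" by (intro mult_left_mono) auto
    moreover have "(norm y)\<^sup>2 * h \<tau> (sgn y) = h \<tau> y"
      using False by (simp add: h_def sgn_div_norm matrix_vector_mult_scaleR power2_eq_square field_simps)
    ultimately show ?thesis by (simp add: mult.commute)
  qed (simp add: h_def)
  \<comment> \<open>The lower limit 1/2 keeps \<rho> positive, as it will be divided by when the
    slack is split.\<close>
  define \<rho> where "\<rho> = max (1 - d / b) (1 / 2)"
  show thesis
  proof (rule that[of \<rho>])
    show "\<rho> < 1" "0 < \<rho>" using \<open>d > 0\<close> \<open>b > 0\<close> by (auto simp: \<rho>_def)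
    fix \<tau> y assume \<tau>: "\<tau> \<in> {T\<^sub>m..T\<^sub>M}"
    let ?Q = "y \<bullet> (P *v y)"
    have "0 \<le> ?Q" using ab(3)[of y] ab(1) by (meson mult_nonneg_nonneg less_imp_le order_trans zero_le_power2)
    have "(Phi \<tau> *v (Ag_mat k\<^sub>p k\<^sub>v *v y)) \<bullet> (P *v (Phi \<tau> *v (Ag_mat k\<^sub>p k\<^sub>v *v y))) \<le> ?Q - d * (norm y)\<^sup>2"
      using hd[OF \<tau>, of y] by (simp add: h_def Xi_form)
    also have "\<dots> \<le> ?Q - (d / b) * ?Q"
    proof -
      have "(d / b) * ?Q \<le> (d / b) * (b * (norm y)\<^sup>2)"
        using \<open>d > 0\<close> \<open>b > 0\<close> by (intro mult_left_mono ab) auto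
      then show ?thesis using \<open>b > 0\<close> by simp
    qed
    also have "\<dots> = (1 - d / b) * ?Q" by (simp add: algebra_simps)
    also have "\<dots> \<le> \<rho> * ?Q" using \<open>0 \<le> ?Q\<close> by (intro mult_right_mono) (auto simp: \<rho>_def)
    finally show "(Phi \<tau> *v (Ag_mat k\<^sub>p k\<^sub>v *v y)) \<bullet> (P *v (Phi \<tau> *v (Ag_mat k\<^sub>p k\<^sub>v *v y))) \<le> \<rho> * ?Q" .
  qed
qed

section \<open>Exponential decay\<close>

lemma closed_target_set: "closed (target_set T)"
proof -
  have "rotation_matrix (mat 1 :: real^3^3)"
    using rotation_rot[of 0 0] by simp
  then have "target_set T = {mat 1} \<times> {0} \<times> {0} \<times> {0..T}"
    by (auto simp: target_set_def)
  then show ?thesis by (simp add: closed_Times)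
qed

lemma target_dist_eq_0_iff:
  assumes "rotation_matrix (Rc z)" "\<tau>c z \<in> {0..T}"
  shows "target_dist z = 0 \<longleftrightarrow> z \<in> target_set T"
proof -
  obtain R \<eta> x \<tau> where z: "z = (R, \<eta>, x, \<tau>)" by (metis surj_pair)
  have R: "rotation_matrix R" "\<tau> \<in> {0..T}" using assms by (simp_all add: z Rc_def \<tau>c_def)
  have "rot_norm R = 0 \<longleftrightarrow> R = mat 1"
    using norm_mat_1_minus_rotation_sqrt[OF R(1)] by (metis eq_iff_diff_eq_0 mult_eq_0_iff norm_eq_zero real_sqrt_eq_zero_cancel_iff zero_neq_numeral)
  then show ?thesis
    using R by (auto simp: z target_dist_def target_set_def add_nonneg_eq_0_iff)
qed

text \<open>One period, from just before a jump to just before the next: w is the angular velocity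
  set by the jump, y' the jumped and then flowed x. The bound on k is that of
  \<open>pot_descent\<close>, whereas D and \<nu> may depend on k.\<close>

lemma lyapunov_step:
  assumes M: "transpose M = M" and lm: "0 < lm" "\<And>R. rotation_matrix R \<Longrightarrow> 4 * lm * (rot_norm R)\<^sup>2 \<le> pot M R"
    and lM: "0 < lM" "\<And>R. rotation_matrix R \<Longrightarrow> pot M R \<le> 4 * lM * (rot_norm R)\<^sup>2"
    and form: "\<And>q. lm * (q \<bullet> q) \<le> q \<bullet> (bar_matrix M *v q)"
    and P: "sym_pos_def P" and T: "0 < T\<^sub>m" "T\<^sub>m \<le> T\<^sub>M"
    and neg: "\<And>\<tau>. \<tau> \<in> {T\<^sub>m..T\<^sub>M} \<Longrightarrow> sym_neg_def (Xi k\<^sub>p k\<^sub>v P \<tau>)" and r: "r < 1"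
  obtains k\<^sub>0 where "k\<^sub>0 > 0" "\<And>k. 0 < k \<Longrightarrow> k < k\<^sub>0 \<Longrightarrow> \<exists>D>0. \<exists>\<nu>. 0 < \<nu> \<and> \<nu> < 1 \<and>
    (\<forall>R y t. rotation_matrix R \<and> pot M R \<le> 4 * lm * r \<and> t \<in> {T\<^sub>m..T\<^sub>M} \<longrightarrow>
      (let w = - (k *\<^sub>R psi (M ** R)); R' = R ** rot w t; y' = Phi t *v (Ag_mat k\<^sub>p k\<^sub>v *v y + drift g R w t) in
        pot M R' \<le> 4 * lm * r \<and> y' \<bullet> (P *v y') + D * pot M R' \<le> \<nu> * (y \<bullet> (P *v y) + D * pot M R)))"
proof -
  have TM: "0 \<le> T\<^sub>M" using T by simp
  obtain k0 where k0: "k0 > 0" "\<And>R k t. rotation_matrix R \<Longrightarrow> 0 < k \<Longrightarrow> k < k0 \<Longrightarrow> 0 \<le> t \<Longrightarrow> t \<le> T\<^sub>M \<Longrightarrow>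
    pot M (R ** rot (- (k *\<^sub>R psi (M ** R))) t) \<le> pot M R - k * (norm (psi (M ** R)))\<^sup>2 * t"
    using pot_descent[OF TM] by blast
  obtain c where c: "c > 0" "\<And>R. rotation_matrix R \<Longrightarrow> norm (psi (M ** R)) \<le> c * rot_norm R"
    using psi_bound[OF M] by blast
  obtain d where d: "d > 0" "\<And>R w t. rotation_matrix R \<Longrightarrow> 0 \<le> t \<Longrightarrow> t \<le> T\<^sub>M \<Longrightarrow>
    norm (drift g R w t) \<le> d * (rot_norm R + norm w)" using drift_bound[OF TM] by blast
  obtain p where p: "p > 0" "\<And>t x. 0 \<le> t \<Longrightarrow> t \<le> T\<^sub>M \<Longrightarrow> norm (Phi t *v x) \<le> p * norm x"
    using Phi_bound by blast
  obtain a b where ab: "a > 0" "b > 0" "\<And>x. a * (norm x)\<^sup>2 \<le> x \<bullet> (P *v x)" "\<And>x. x \<bullet> (P *v x) \<le> b * (norm x)\<^sup>2"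
    using sym_pos_def_bounds[OF P] by blast
  obtain \<rho> where \<rho>: "\<rho> < 1" "0 < \<rho>" "\<And>\<tau> y. \<tau> \<in> {T\<^sub>m..T\<^sub>M} \<Longrightarrow>
    (Phi \<tau> *v (Ag_mat k\<^sub>p k\<^sub>v *v y)) \<bullet> (P *v (Phi \<tau> *v (Ag_mat k\<^sub>p k\<^sub>v *v y))) \<le> \<rho> * (y \<bullet> (P *v y))"
    using jump_flow_contraction[OF P neg T(2)] by blast
  show thesis
  proof (rule that[OF k0(1)])
    fix k assume k: "0 < k" "k < k0"
    \<comment> \<open>Solves (1 + \<alpha>) \<rho> = (1 + \<rho>) / 2, so that half of the slack of
      \<rho> pays for the mixed term.\<close>
    define \<alpha> where "\<alpha> = (1 - \<rho>) / (2 * \<rho>)"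
    have \<alpha>: "\<alpha> > 0" "(1 + \<alpha>) * \<rho> = (1 + \<rho>) / 2" using \<rho> by (simp_all add: \<alpha>_def field_simps)
    \<comment> \<open>Bounds the perturbation: |v| <= e |R|, with p for the flow, d for the drift,
      and |w| <= k c |R| from the jump. C below turns this into a multiple of V by means of 4 lm
      |R|^2 <= V.\<close>
    define e where "e = p * d * (1 + k * c)"
    have e: "e > 0" using p d k c by (simp add: e_def add_pos_pos)
    define C where "C = (1 + 1 / \<alpha>) * b * e\<^sup>2 / (4 * lm)"
    have C: "C > 0" unfolding C_def using \<alpha>(1) ab(2) e lm(1) by (intro divide_pos_pos mult_pos_pos add_pos_pos) auto
    \<comment> \<open>On the sublevel set the squared norm of psi is at least (1 - r) lm^2 / lM
      times V, and the descent lasts at least \<open>T\<^sub>m\<close>; this is the resulting factor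
      for V, kept positive by 1/2.\<close>
    define \<mu> where "\<mu> = max (1 - k * T\<^sub>m * ((1 - r) * lm\<^sup>2 / lM)) (1 / 2)"
    have "0 < k * T\<^sub>m * ((1 - r) * lm\<^sup>2 / lM)" using k T r lm lM by simp
    then have \<mu>: "1 / 2 \<le> \<mu>" "\<mu> < 1" by (auto simp: \<mu>_def)
    \<comment> \<open>With this weight the perturbation C V uses up half of the decrease of D V: C +
      D \<mu> = D (1 + \<mu>) / 2.\<close>
    define D where "D = 2 * C / (1 - \<mu>)"
    have D: "D > 0" "C = D * (1 - \<mu>) / 2" using C \<mu> by (simp_all add: D_def)
    define \<nu> where "\<nu> = max ((1 + \<rho>) / 2) ((1 + \<mu>) / 2)"
    have \<nu>: "0 < \<nu>" "\<nu> < 1" using \<rho>(1,2) \<mu> unfolding \<nu>_def less_max_iff_disj max_less_iff_conj by auto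
    have step: "pot M (R ** rot w t) \<le> 4 * lm * r \<and> y' \<bullet> (P *v y') + D * pot M (R ** rot w t) \<le> \<nu> * (y \<bullet> (P *v y) + D * pot M R)"
      if R: "rotation_matrix R" and pR: "pot M R \<le> 4 * lm * r" and t: "t \<in> {T\<^sub>m..T\<^sub>M}"
        and w: "w = - (k *\<^sub>R psi (M ** R))" and y': "y' = Phi t *v (Ag_mat k\<^sub>p k\<^sub>v *v y + drift g R w t)" for R y t w y'
    proof -
      have t0: "0 \<le> t" "t \<le> T\<^sub>M" "T\<^sub>m \<le> t" using t T by auto
      let ?n = "rot_norm R" and ?V = "pot M R"
      have n: "?n \<ge> 0" by (rule rot_norm_nonneg[OF R])
      have V: "?V \<ge> 0" using lm(2)[OF R] lm(1) by (meson mult_nonneg_nonneg order_trans zero_le_power2 less_imp_le zero_le_numeral)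
      have "4 * lm * ?n\<^sup>2 \<le> 4 * lm * r" using lm(2)[OF R] pR by simp
      then have nr: "?n\<^sup>2 \<le> r" using lm(1) by simp
      have "(1 - r) * lm\<^sup>2 / lM * ?V \<le> (1 - r) * lm\<^sup>2 / lM * (4 * lM * ?n\<^sup>2)"
        using r lM(1) by (intro mult_left_mono lM(2) R) auto
      also have "\<dots> = 4 * (1 - r) * lm\<^sup>2 * ?n\<^sup>2" using lM(1) by simp
      also have "\<dots> \<le> 4 * (1 - ?n\<^sup>2) * lm\<^sup>2 * ?n\<^sup>2" using nr by (intro mult_right_mono) auto
      also have "\<dots> \<le> (norm (psi (M ** R)))\<^sup>2" by (rule psi_lower_bound[OF M form _ R]) (use lm in auto)
      finally have psi: "(1 - r) * lm\<^sup>2 / lM * ?V \<le> (norm (psi (M ** R)))\<^sup>2" .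
      have "pot M (R ** rot w t) \<le> ?V - k * (norm (psi (M ** R)))\<^sup>2 * t"
        unfolding w by (rule k0(2)[OF R k t0(1,2)])
      also have "\<dots> \<le> ?V - k * ((1 - r) * lm\<^sup>2 / lM * ?V) * T\<^sub>m"
        using psi k t0 T V r lm(1) lM(1) by (intro diff_left_mono mult_mono mult_left_mono mult_nonneg_nonneg) auto
      also have "\<dots> = (1 - k * T\<^sub>m * ((1 - r) * lm\<^sup>2 / lM)) * ?V" by (simp add: algebra_simps)
      also have "\<dots> \<le> \<mu> * ?V" using V by (intro mult_right_mono) (auto simp: \<mu>_def)
      finally have V': "pot M (R ** rot w t) \<le> \<mu> * ?V" .
      have "\<mu> * ?V \<le> 1 * ?V" using \<mu> V by (intro mult_right_mono) auto
      then have V'': "pot M (R ** rot w t) \<le> 4 * lm * r" using V' pR by linarith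
      define u where "u = Phi t *v (Ag_mat k\<^sub>p k\<^sub>v *v y)"
      define v where "v = Phi t *v drift g R w t"
      have y'uv: "y' = u + v" by (simp add: y' u_def v_def matrix_vector_right_distrib)
      have "norm w \<le> k * (c * ?n)" unfolding w using k c(2)[OF R] by simp
      have "norm v \<le> p * (d * (?n + norm w))"
        unfolding v_def using p(1) by (intro order.trans[OF p(2)[OF t0(1,2)]] mult_left_mono d(2) R t0) auto
      also have "\<dots> \<le> p * (d * (?n + k * (c * ?n)))"
        using p(1) d(1) \<open>norm w \<le> k * (c * ?n)\<close> by (intro mult_left_mono add_left_mono) auto
      also have "\<dots> = e * ?n" by (simp add: e_def algebra_simps)
      finally have "(norm v)\<^sup>2 \<le> (e * ?n)\<^sup>2" by (intro power_mono) auto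
      then have "(norm v)\<^sup>2 \<le> e\<^sup>2 / (4 * lm) * (4 * lm * ?n\<^sup>2)" using lm(1) by (simp add: power_mult_distrib)
      also have "\<dots> \<le> e\<^sup>2 / (4 * lm) * ?V" using lm(1) by (intro mult_left_mono lm(2) R) auto
      finally have v: "(norm v)\<^sup>2 \<le> e\<^sup>2 / (4 * lm) * ?V" .
      have "y' \<bullet> (P *v y') \<le> (1 + \<alpha>) * (u \<bullet> (P *v u)) + (1 + 1 / \<alpha>) * (v \<bullet> (P *v v))"
        unfolding y'uv by (rule quadratic_form_add_le[OF P \<alpha>(1)])
      also have "\<dots> \<le> (1 + \<alpha>) * (\<rho> * (y \<bullet> (P *v y))) + (1 + 1 / \<alpha>) * (b * (e\<^sup>2 / (4 * lm) * ?V))"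
      proof (intro add_mono mult_left_mono)
        show "u \<bullet> (P *v u) \<le> \<rho> * (y \<bullet> (P *v y))" unfolding u_def by (rule \<rho>(3)[OF t])
        have "v \<bullet> (P *v v) \<le> b * (norm v)\<^sup>2" by (rule ab(4))
        also have "\<dots> \<le> b * (e\<^sup>2 / (4 * lm) * ?V)" using ab(2) v by (intro mult_left_mono) auto
        finally show "v \<bullet> (P *v v) \<le> b * (e\<^sup>2 / (4 * lm) * ?V)" .
      qed (use \<alpha> in auto)
      also have "\<dots> = (1 + \<alpha>) * \<rho> * (y \<bullet> (P *v y)) + C * ?V" by (simp add: C_def)
      finally have Q: "y' \<bullet> (P *v y') \<le> (1 + \<rho>) / 2 * (y \<bullet> (P *v y)) + C * ?V" unfolding \<alpha>(2) .
      have "D * pot M (R ** rot w t) \<le> D * (\<mu> * ?V)" using D V' by (intro mult_left_mono) auto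
      with Q have "y' \<bullet> (P *v y') + D * pot M (R ** rot w t) \<le> (1 + \<rho>) / 2 * (y \<bullet> (P *v y)) + (C + D * \<mu>) * ?V"
        by (simp add: algebra_simps)
      also have "C + D * \<mu> = (1 + \<mu>) / 2 * D" using D(2) by (simp add: field_simps)
      also have "(1 + \<rho>) / 2 * (y \<bullet> (P *v y)) + (1 + \<mu>) / 2 * D * ?V \<le> \<nu> * (y \<bullet> (P *v y)) + \<nu> * D * ?V"
      proof (intro add_mono mult_right_mono)
        show "0 \<le> y \<bullet> (P *v y)" using ab(3)[of y] ab(1) by (meson mult_nonneg_nonneg less_imp_le order_trans zero_le_power2)
      qed (use D V in \<open>auto simp: \<nu>_def\<close>)
      finally show ?thesis using V'' by (simp add: algebra_simps)
    qed
    show "\<exists>D>0. \<exists>\<nu>. 0 < \<nu> \<and> \<nu> < 1 \<and>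
    (\<forall>R y t. rotation_matrix R \<and> pot M R \<le> 4 * lm * r \<and> t \<in> {T\<^sub>m..T\<^sub>M} \<longrightarrow>
      (let w = - (k *\<^sub>R psi (M ** R)); R' = R ** rot w t; y' = Phi t *v (Ag_mat k\<^sub>p k\<^sub>v *v y + drift g R w t) in
        pot M R' \<le> 4 * lm * r \<and> y' \<bullet> (P *v y') + D * pot M R' \<le> \<nu> * (y \<bullet> (P *v y) + D * pot M R)))"
      unfolding Let_def using D(1) \<nu> step by blast
  qed
qed

definition xc :: "state \<Rightarrow> real^(3+3)" where "xc z = fst (snd (snd z))"

definition lyap :: "real^(3+3)^(3+3) \<Rightarrow> real \<Rightarrow> real^3^3 \<Rightarrow> state \<Rightarrow> real" where
  "lyap P D M z = xc z \<bullet> (P *v xc z) + D * pot M (Rc z)"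

context error_solution
begin

lemma start_Suc:
  assumes "(t, Suc j) \<in> E"
  obtains \<tau> where "\<tau> \<in> {T\<^sub>m..T\<^sub>M}"
    "start (Suc j) = (let b = x (s (Suc j)) j in (Rc b, k\<^sub>R *\<^sub>R psi (M ** Rc b), Ag_mat k\<^sub>p k\<^sub>v *v xc b, \<tau>))"
proof -
  obtain R \<eta> y \<tau> where b: "x (s (Suc j)) j = (R, \<eta>, y, \<tau>)" by (metis surj_pair)
  show thesis
    using jump_at(1)[OF assms] that unfolding b
    by (auto simp: error_system_def Rc_def xc_def Ag_mat_def)
qed

lemma time_bound: "(t, j) \<in> E \<Longrightarrow> t \<le> (real j + 1) * T\<^sub>M"
proof (induction j arbitrary: t)
  case 0
  then show ?case using on_slice(2)[OF 0] start_valid[OF 0] by (simp add: s0)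
next
  case (Suc j)
  have "(s (Suc j), j) \<in> E" using pred[OF Suc.prems] by (simp add: time_slice_def)
  from Suc.IH[OF this] show ?case
    using on_slice(2)[OF Suc.prems] start_valid[OF Suc.prems] by (simp add: algebra_simps)
qed

text \<open>The induction carries the bound v on the potential along with the decay, because the
  step is available only inside that sublevel set. It starts at the end of the first interval, whose
  \<eta> was not produced by a jump.\<close>

lemma lyap_decay:
  assumes step: "\<And>R y t. rotation_matrix R \<Longrightarrow> pot M R \<le> v \<Longrightarrow> t \<in> {T\<^sub>m..T\<^sub>M} \<Longrightarrow>
      (let w = - (k\<^sub>R *\<^sub>R psi (M ** R)); R' = R ** rot w t; y' = Phi t *v (Ag_mat k\<^sub>p k\<^sub>v *v y + drift g R w t) in
        pot M R' \<le> v \<and> y' \<bullet> (P *v y') + D * pot M R' \<le> \<nu> * (y \<bullet> (P *v y) + D * pot M R))"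
    and \<nu>: "0 \<le> \<nu>"
    and first: "pot M (Rc (sol g (start 0) (\<tau>c (start 0)))) \<le> v"
  shows "(t, Suc j) \<in> E \<Longrightarrow> rotation_matrix (Rc (x (s (Suc j)) j)) \<and> pot M (Rc (x (s (Suc j)) j)) \<le> v \<and>
    lyap P D M (x (s (Suc j)) j) \<le> \<nu> ^ j * lyap P D M (sol g (start 0) (\<tau>c (start 0)))"
proof (induction j arbitrary: t)
  case 0
  then show ?case using first jump_time(2)[OF 0] jump_at(2)[OF 0] by simp
next
  case (Suc j)
  let ?b = "x (s (Suc j)) j"
  have "(s (Suc (Suc j)), Suc j) \<in> E" using pred[OF Suc.prems] by (simp add: time_slice_def)
  note IH = Suc.IH[OF this] and E1 = this
  obtain \<tau> where \<tau>: "\<tau> \<in> {T\<^sub>m..T\<^sub>M}"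
    "start (Suc j) = (let b = ?b in (Rc b, k\<^sub>R *\<^sub>R psi (M ** Rc b), Ag_mat k\<^sub>p k\<^sub>v *v xc b, \<tau>))"
    using start_Suc[OF E1] by blast
  have next_b: "x (s (Suc (Suc j))) (Suc j) = sol g (start (Suc j)) \<tau>"
    using jump_time(2)[OF Suc.prems] \<tau>(2) by (simp add: \<tau>c_def Let_def)
  have "pot M (Rc (sol g (start (Suc j)) \<tau>)) \<le> v \<and>
      lyap P D M (sol g (start (Suc j)) \<tau>) \<le> \<nu> * lyap P D M ?b"
    using step[of "Rc ?b" \<tau> "xc ?b"] IH \<tau>(1)
    unfolding \<tau>(2) lyap_def by (simp add: Let_def sol_def Rc_def xc_def)
  moreover have "\<nu> * lyap P D M ?b \<le> \<nu> * (\<nu> ^ j * lyap P D M (sol g (start 0) (\<tau>c (start 0))))"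
    using IH \<nu> by (intro mult_left_mono) auto
  ultimately show ?case
    using jump_at(2)[OF Suc.prems] by (simp add: next_b mult.assoc)
qed

end

text \<open>Each index accounts for at most T units of t and one of j, so t + i <= (i + 1) (T + 1);
  multiplying by the negative ln q reverses the inequality.\<close>

lemma exp_rate:
  assumes q: "0 < q" "q < 1" and "T \<ge> 0" and t: "t \<le> (real i + 1) * T"
  shows "q ^ Suc i \<le> exp (- (- ln q / (T + 1)) * (t + real i))"
proof -
  have "ln q < 0" using q by simp
  have "t + real i \<le> (real i + 1) * (T + 1)" using t by (simp add: algebra_simps)
  then have "ln q * ((real i + 1) * (T + 1)) \<le> ln q * (t + real i)"
    using \<open>ln q < 0\<close> by (intro mult_left_mono_neg) auto
  then have "ln q * (real i + 1) \<le> ln q * (t + real i) / (T + 1)"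
    using \<open>T \<ge> 0\<close> by (simp add: field_simps)
  then have "exp (ln q * (real i + 1)) \<le> exp (ln q / (T + 1) * (t + real i))" by simp
  moreover have "exp (ln q * (real i + 1)) = q ^ Suc i"
    using q exp_of_nat_mult[of "Suc i" "ln q"] by (simp add: mult.commute add.commute)
  ultimately show ?thesis by simp
qed

context error_solution
begin

text \<open>The Lyapunov function is known to decay only just before jumps and does not see \<eta>.
  The jump constant h recovers \<eta> after the jump, and the growth constant c covers the rest of
  the interval. The rate is sqrt \<nu> because \<open>lyap\<close> is quadratic in the
  distance.\<close>

lemma exponential_bound:
  assumes M: "transpose M = M" and lm: "0 < lm" "\<And>R. rotation_matrix R \<Longrightarrow> 4 * lm * (rot_norm R)\<^sup>2 \<le> pot M R"
    and lM: "0 < lM" "\<And>R. rotation_matrix R \<Longrightarrow> pot M R \<le> 4 * lM * (rot_norm R)\<^sup>2"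
    and P: "a > 0" "b > 0" "\<And>x. a * (norm x)\<^sup>2 \<le> x \<bullet> (P *v x)" "\<And>x. x \<bullet> (P *v x) \<le> b * (norm x)\<^sup>2"
    and grow: "c > 0" "\<And>z t. rotation_matrix (Rc z) \<Longrightarrow> 0 \<le> t \<Longrightarrow> t \<le> T\<^sub>M \<Longrightarrow> comp_norm (sol g z t) \<le> c * comp_norm z"
    and jump: "h > 0" "\<And>R y \<tau>. rotation_matrix R \<Longrightarrow>
        comp_norm (R, k\<^sub>R *\<^sub>R psi (M ** R), Ag_mat k\<^sub>p k\<^sub>v *v y, \<tau>) \<le> h * (rot_norm R + norm y)"
    and D: "D > 0" and \<nu>: "0 < \<nu>" "\<nu> < 1"
    and step: "\<And>R y t. rotation_matrix R \<Longrightarrow> pot M R \<le> v \<Longrightarrow> t \<in> {T\<^sub>m..T\<^sub>M} \<Longrightarrow>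
      (let w = - (k\<^sub>R *\<^sub>R psi (M ** R)); R' = R ** rot w t; y' = Phi t *v (Ag_mat k\<^sub>p k\<^sub>v *v y + drift g R w t) in
        pot M R' \<le> v \<and> y' \<bullet> (P *v y') + D * pot M R' \<le> \<nu> * (y \<bullet> (P *v y) + D * pot M R))"
    and first: "pot M (Rc (sol g (start 0) (\<tau>c (start 0)))) \<le> v"
    and tj: "(t, j) \<in> E"
  defines "K \<equiv> c / sqrt \<nu> + c * h * sqrt (2 / a + 2 / (4 * lm * D)) * sqrt (b + D * (4 * lM)) * c / \<nu>"
  shows "comp_norm (x t j) \<le> K * sqrt \<nu> ^ Suc j * comp_norm (x 0 0)"
proof -
  define B where "B = 2 / a + 2 / (4 * lm * D)"
  define U where "U = b + D * (4 * lM)"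
  have BU: "B > 0" "U > 0" using P lm lM D by (simp_all add: B_def U_def add_pos_pos)
  let ?z = "x 0 0"
  have start0: "start 0 = ?z" by (simp add: s0)
  have valid0: "rotation_matrix (Rc ?z)" "0 \<le> \<tau>c ?z" "\<tau>c ?z \<le> T\<^sub>M" using start_valid[OF zero] by (simp_all add: s0)
  note z0 = comp_norm_nonneg[OF valid0(1)]
  \<comment> \<open>The part of \<open>comp_norm\<close> that \<open>lyap\<close> controls, that is,
    without \<eta>.\<close>
  let ?N = "\<lambda>z. rot_norm (Rc z) + norm (xc z)"
  have N_le: "?N z \<le> comp_norm z" for z by (simp add: comp_norm_def Rc_def xc_def case_prod_beta)
  have lyap_lower: "?N z \<le> sqrt (B * lyap P D M z)" if R: "rotation_matrix (Rc z)" for z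
  proof (rule real_le_rsqrt)
    have "(norm (xc z))\<^sup>2 \<le> xc z \<bullet> (P *v xc z) / a" using P(1) P(3)[of "xc z"] by (simp add: field_simps)
    moreover have "(rot_norm (Rc z))\<^sup>2 \<le> D * pot M (Rc z) / (4 * lm * D)" using lm(1) lm(2)[OF R] D by (simp add: field_simps)
    moreover have "(?N z)\<^sup>2 \<le> 2 * (rot_norm (Rc z))\<^sup>2 + 2 * (norm (xc z))\<^sup>2"
      using zero_le_power2[of "rot_norm (Rc z) - norm (xc z)"] by (simp add: power2_eq_square algebra_simps)
    ultimately have "(?N z)\<^sup>2 \<le> 2 / (4 * lm * D) * (D * pot M (Rc z)) + 2 / a * (xc z \<bullet> (P *v xc z))"
      using D by simp
    also have "\<dots> \<le> B * (D * pot M (Rc z)) + B * (xc z \<bullet> (P *v xc z))"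
    proof (intro add_mono mult_right_mono)
      show "0 \<le> xc z \<bullet> (P *v xc z)" using P(1) P(3)[of "xc z"] by (meson mult_nonneg_nonneg less_imp_le order_trans zero_le_power2)
      have "0 \<le> pot M (Rc z)" using lm(2)[OF R] lm(1) by (meson mult_nonneg_nonneg order_trans zero_le_power2 less_imp_le zero_le_numeral)
      then show "0 \<le> D * pot M (Rc z)" using D by simp
    qed (use P lm D in \<open>auto simp: B_def\<close>)
    finally show "(?N z)\<^sup>2 \<le> B * lyap P D M z" by (simp add: lyap_def algebra_simps)
  qed
  have lyap_upper: "lyap P D M z \<le> U * (?N z)\<^sup>2" if R: "rotation_matrix (Rc z)" for z
  proof -
    have n: "0 \<le> rot_norm (Rc z)" by (rule rot_norm_nonneg[OF R])
    have "lyap P D M z \<le> b * (norm (xc z))\<^sup>2 + D * (4 * lM * (rot_norm (Rc z))\<^sup>2)"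
      unfolding lyap_def using D by (intro add_mono P mult_left_mono lM R) auto
    also have "\<dots> \<le> b * (?N z)\<^sup>2 + D * (4 * lM * (?N z)\<^sup>2)"
      using n P(2) D lM(1) by (intro add_mono mult_left_mono power_mono) auto
    finally show ?thesis by (simp add: U_def algebra_simps)
  qed
  \<comment> \<open>The first summand serves j = 0, where dividing by sqrt \<nu> offsets the factor
    of exponent \<open>Suc 0\<close>. The second follows the chain for j = \<open>Suc i\<close>:
    first interval (c), upper bound of \<open>lyap\<close> (U), i periods, lower bound (B), jump
    (h), current interval (c). Dividing by \<nu> raises the exponent of sqrt \<nu> from i to i +
    2.\<close>
  have "K = c / sqrt \<nu> + c * h * sqrt B * sqrt U * c / \<nu>" unfolding K_def B_def U_def ..
  then have K: "c / sqrt \<nu> \<le> K" "c * h * sqrt B * sqrt U * c / \<nu> \<le> K"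
    using grow(1) jump(1) \<nu> BU by simp_all
  have sq: "sqrt \<nu> > 0" "sqrt \<nu> * sqrt \<nu> = \<nu>" using \<nu> by simp_all
  show ?thesis
  proof (cases j)
    case 0
    have tz: "0 \<le> t" "t \<le> \<tau>c ?z" using on_slice(2)[OF tj] 0 by (simp_all add: s0)
    have "comp_norm (x t j) = comp_norm (sol g ?z t)"
      using on_slice(1)[OF tj] 0 by (simp add: s0)
    also have "\<dots> \<le> c * comp_norm ?z" using tz valid0 by (intro grow) auto
    also have "\<dots> = (c / sqrt \<nu>) * sqrt \<nu> * comp_norm ?z" using sq(1) by simp
    also have "\<dots> \<le> K * sqrt \<nu> * comp_norm ?z"
      using K sq(1) z0 by (intro mult_right_mono) auto
    finally show ?thesis using 0 by simp
  next
    case (Suc i)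
    let ?b = "x (s (Suc i)) i"
    have tE: "(t, Suc i) \<in> E" using tj Suc by simp
    have st: "rotation_matrix (Rc (start (Suc i)))" "\<tau>c (start (Suc i)) \<le> T\<^sub>M" using start_valid[OF tE] by auto
    have dec: "rotation_matrix (Rc ?b)" "lyap P D M ?b \<le> \<nu> ^ i * lyap P D M (sol g (start 0) (\<tau>c (start 0)))"
      using lyap_decay[OF step less_imp_le[OF \<nu>(1)] first tE] by auto
    obtain \<tau> where \<tau>: "start (Suc i) = (Rc ?b, k\<^sub>R *\<^sub>R psi (M ** Rc ?b), Ag_mat k\<^sub>p k\<^sub>v *v xc ?b, \<tau>)"
      using start_Suc[OF tE] by (auto simp: Let_def)
    let ?e = "sol g ?z (\<tau>c ?z)"
    have Re: "rotation_matrix (Rc ?e)" using rotation_Rc_sol valid0(1) by blast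
    have "?N ?e \<le> c * comp_norm ?z"
      using N_le[of ?e] grow(2)[OF valid0] by linarith
    then have "(?N ?e)\<^sup>2 \<le> (c * comp_norm ?z)\<^sup>2"
      using rot_norm_nonneg[OF Re] by (intro power_mono) auto
    then have "lyap P D M ?e \<le> U * (c * comp_norm ?z)\<^sup>2"
      using lyap_upper[OF Re] BU(2) by (meson mult_left_mono less_imp_le order_trans)
    then have "\<nu> ^ i * lyap P D M ?e \<le> \<nu> ^ i * (U * (c * comp_norm ?z)\<^sup>2)"
      using \<nu>(1) by (intro mult_left_mono) auto
    then have "lyap P D M ?b \<le> \<nu> ^ i * (U * (c * comp_norm ?z)\<^sup>2)" using dec(2) by (simp add: start0)
    then have "sqrt (B * lyap P D M ?b) \<le> sqrt (B * (\<nu> ^ i * (U * (c * comp_norm ?z)\<^sup>2)))"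
      using BU(1) by (intro real_sqrt_le_mono mult_left_mono) auto
    also have "\<dots> = sqrt B * (sqrt \<nu> ^ i * (sqrt U * (c * comp_norm ?z)))"
    proof -
      have "sqrt ((c * comp_norm ?z)\<^sup>2) = c * comp_norm ?z"
        using z0 grow(1) by (intro real_sqrt_unique) auto
      then show ?thesis by (simp only: real_sqrt_mult real_sqrt_power[of \<nu> i])
    qed
    finally have Nb: "?N ?b \<le> sqrt B * (sqrt \<nu> ^ i * (sqrt U * (c * comp_norm ?z)))"
      using lyap_lower[OF dec(1)] by linarith
    have "comp_norm (x t j) = comp_norm (sol g (start (Suc i)) (t - s (Suc i)))"
      using on_slice(1)[OF tE] Suc by simp
    also have "\<dots> \<le> c * comp_norm (start (Suc i))"
      using on_slice(2)[OF tE] st by (intro grow) auto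
    also have "\<dots> \<le> c * (h * ?N ?b)"
      unfolding \<tau> using grow(1) by (intro mult_left_mono jump dec) auto
    also have "\<dots> \<le> c * (h * (sqrt B * (sqrt \<nu> ^ i * (sqrt U * (c * comp_norm ?z)))))"
      using grow(1) jump(1) by (intro mult_left_mono Nb) auto
    also have "\<dots> = (c * h * sqrt B * sqrt U * c / \<nu>) * (sqrt \<nu> ^ i * (sqrt \<nu> * sqrt \<nu>)) * comp_norm ?z"
      unfolding sq(2) using \<nu>(1) by (simp add: mult_ac)
    also have "\<dots> = (c * h * sqrt B * sqrt U * c / \<nu>) * sqrt \<nu> ^ Suc j * comp_norm ?z"
      using Suc by (simp add: mult_ac)
    also have "\<dots> \<le> K * sqrt \<nu> ^ Suc j * comp_norm ?z"
      using K(2) sq(1) z0 by (intro mult_right_mono) auto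
    finally show ?thesis .
  qed
qed

end

theorem theorem3:
  fixes N :: nat
    and k :: "nat \<Rightarrow> real"
    and p :: "nat \<Rightarrow> real^3"
    and g :: "real^3"
    and k\<^sub>p k\<^sub>v T\<^sub>m T\<^sub>M :: real
  assumes "N \<ge> 3"
    and "\<And>i. i \<in> {1..N} \<Longrightarrow> k i > 0"
    and "(\<Sum>i=1..N. k i) = 1"
    and "\<exists>i\<in>{1..N}. \<exists>j\<in>{1..N}. \<exists>l\<in>{1..N}. \<not> collinear {p i, p j, p l}"
    and "k\<^sub>p > 0" and "k\<^sub>v > 0"
    and "0 < T\<^sub>m" and "T\<^sub>m \<le> T\<^sub>M"
    and "\<exists>P. sym_pos_def P \<and> (\<forall>\<tau>\<in>{T\<^sub>m..T\<^sub>M}. sym_neg_def (Xi k\<^sub>p k\<^sub>v P \<tau>))"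
  shows "\<forall>\<epsilon>. 0 < \<epsilon> \<and> \<epsilon> < 1 \<longrightarrow>
    (\<exists>\<eta>\<^sub>0>0. \<exists>k\<^sub>0>0. \<forall>k\<^sub>R. 0 < k\<^sub>R \<and> k\<^sub>R < k\<^sub>0 \<longrightarrow>
       exponentially_stable_from
         (error_system (landmark_matrix N k p) g k\<^sub>R k\<^sub>p k\<^sub>v T\<^sub>m T\<^sub>M)
         (target_set T\<^sub>M)
         target_dist
         (initial_set (\<epsilon> * sqrt (eig_ratio (landmark_matrix N k p))) \<eta>\<^sub>0 T\<^sub>M))"
proof (intro allI impI)
  fix \<epsilon> :: real assume \<epsilon>: "0 < \<epsilon> \<and> \<epsilon> < 1"
  define M where "M = landmark_matrix N k p"
  have M: "transpose M = M" unfolding M_def by (rule transpose_landmark_matrix)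
  note Mb = transpose_bar_matrix[OF M]
  define lm where "lm = Min (eigenvalues (bar_matrix M))"
  define lM where "lM = Max (eigenvalues (bar_matrix M))"
  have eig_pos: "l > 0" if l: "l \<in> eigenvalues (bar_matrix M)" for l
  proof -
    obtain u where u: "u \<noteq> 0" "bar_matrix M *v u = l *\<^sub>R u" using l unfolding eigenvalues_def by blast
    have "0 < u \<bullet> (bar_matrix M *v u)" unfolding M_def by (rule bar_landmark_pos[OF assms(2,4) u(1)])
    then have "0 < l * (u \<bullet> u)" by (simp add: u(2))
    moreover have "0 < u \<bullet> u" using u(1) by simp
    ultimately show ?thesis by (metis zero_less_mult_pos2)
  qed
  have lm: "0 < lm" and lM: "0 < lM"
    unfolding lm_def lM_def by (intro eig_pos symmetric_rayleigh_bounds Mb)+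
  have form: "lm * (q \<bullet> q) \<le> q \<bullet> (bar_matrix M *v q)" for q
    unfolding lm_def by (rule symmetric_rayleigh_bounds(3)[OF Mb])
  have pot_lo: "4 * lm * (rot_norm R)\<^sup>2 \<le> pot M R" and pot_hi: "pot M R \<le> 4 * lM * (rot_norm R)\<^sup>2"
    if "rotation_matrix R" for R
    using pot_bounds[OF M that] by (simp_all add: lm_def lM_def)
  have ratio: "eig_ratio M = lm / lM" by (simp add: eig_ratio_def lm_def lM_def)
  obtain P where P: "sym_pos_def P" and neg: "\<And>\<tau>. \<tau> \<in> {T\<^sub>m..T\<^sub>M} \<Longrightarrow> sym_neg_def (Xi k\<^sub>p k\<^sub>v P \<tau>)"
    using assms(9) by blast
  note T = assms(7,8)
  have TM: "0 \<le> T\<^sub>M" using T by simp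
  \<comment> \<open>The midpoint between \<epsilon>^2 and 1: it leaves room for a rise of the
    potential on the first interval and stays below the critical level.\<close>
  define r where "r = (1 + \<epsilon>\<^sup>2) / 2"
  have "\<epsilon>\<^sup>2 < 1" using \<epsilon> by (simp add: power_less_one_iff)
  then have r: "\<epsilon>\<^sup>2 < r" "r < 1" by (simp_all add: r_def)
  obtain cp where cp: "cp > 0" "\<And>R w t. rotation_matrix R \<Longrightarrow> 0 \<le> t \<Longrightarrow> t \<le> T\<^sub>M \<Longrightarrow>
    pot M (R ** rot w t) \<le> pot M R + cp * norm w"
    using pot_growth[OF M TM] by blast
  \<comment> \<open>The rise cp |\<eta>| on the first interval then at most fills the gap between
    the levels 4 lm \<epsilon>^2 and 4 lm r.\<close>
  define \<eta>0 where "\<eta>0 = 4 * lm * (r - \<epsilon>\<^sup>2) / cp"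
  have \<eta>0: "\<eta>0 > 0" using lm r cp by (simp add: \<eta>0_def)
  obtain k0 where k0: "k0 > 0" "\<And>k. 0 < k \<Longrightarrow> k < k0 \<Longrightarrow> \<exists>D>0. \<exists>\<nu>. 0 < \<nu> \<and> \<nu> < 1 \<and>
    (\<forall>R y t. rotation_matrix R \<and> pot M R \<le> 4 * lm * r \<and> t \<in> {T\<^sub>m..T\<^sub>M} \<longrightarrow>
      (let w = - (k *\<^sub>R psi (M ** R)); R' = R ** rot w t; y' = Phi t *v (Ag_mat k\<^sub>p k\<^sub>v *v y + drift g R w t) in
        pot M R' \<le> 4 * lm * r \<and> y' \<bullet> (P *v y') + D * pot M R' \<le> \<nu> * (y \<bullet> (P *v y) + D * pot M R)))"
    using lyapunov_step[OF M lm pot_lo lM pot_hi form P T neg r(2)] by blast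
  obtain a b where ab: "a > 0" "b > 0" "\<And>x. a * (norm x)\<^sup>2 \<le> x \<bullet> (P *v x)" "\<And>x. x \<bullet> (P *v x) \<le> b * (norm x)\<^sup>2"
    using sym_pos_def_bounds[OF P] by blast
  obtain c where c: "c > 0" "\<And>z t. rotation_matrix (Rc z) \<Longrightarrow> 0 \<le> t \<Longrightarrow> t \<le> T\<^sub>M \<Longrightarrow> comp_norm (sol g z t) \<le> c * comp_norm z"
    using sol_growth[OF TM] by blast
  obtain cs where cs: "cs > 0" "\<And>R. rotation_matrix R \<Longrightarrow> norm (psi (M ** R)) \<le> cs * rot_norm R"
    using psi_bound[OF M] by blast
  obtain ca where ca: "ca > 0" "\<And>y. norm (Ag_mat k\<^sub>p k\<^sub>v *v y) \<le> norm y * ca"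
    using bounded_linear.pos_bounded[OF matrix_vector_mul_bounded_linear[of "Ag_mat k\<^sub>p k\<^sub>v"]] by blast
  have "exponentially_stable_from (error_system M g k\<^sub>R k\<^sub>p k\<^sub>v T\<^sub>m T\<^sub>M) (target_set T\<^sub>M) target_dist
         (initial_set (\<epsilon> * sqrt (eig_ratio M)) \<eta>0 T\<^sub>M)" if kR: "0 < k\<^sub>R" "k\<^sub>R < k0" for k\<^sub>R
  proof -
    obtain D \<nu> where D: "D > 0" and \<nu>: "0 < \<nu>" "\<nu> < 1" and
      step: "\<And>R y t. rotation_matrix R \<Longrightarrow> pot M R \<le> 4 * lm * r \<Longrightarrow> t \<in> {T\<^sub>m..T\<^sub>M} \<Longrightarrow>
      (let w = - (k\<^sub>R *\<^sub>R psi (M ** R)); R' = R ** rot w t; y' = Phi t *v (Ag_mat k\<^sub>p k\<^sub>v *v y + drift g R w t) in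
        pot M R' \<le> 4 * lm * r \<and> y' \<bullet> (P *v y') + D * pot M R' \<le> \<nu> * (y \<bullet> (P *v y) + D * pot M R))"
      using k0(2)[OF kR] by metis
    define h where "h = 1 + k\<^sub>R * cs + ca"
    have h: "h > 0" using kR cs ca by (simp add: h_def add_pos_pos)
    have jump: "comp_norm (R, k\<^sub>R *\<^sub>R psi (M ** R), Ag_mat k\<^sub>p k\<^sub>v *v y, \<tau>) \<le> h * (rot_norm R + norm y)"
      if R: "rotation_matrix R" for R y \<tau>
    proof -
      have "comp_norm (R, k\<^sub>R *\<^sub>R psi (M ** R), Ag_mat k\<^sub>p k\<^sub>v *v y, \<tau>) \<le> rot_norm R + k\<^sub>R * (cs * rot_norm R) + norm y * ca"
        unfolding comp_norm_def using kR cs(2)[OF R] ca(2)[of y] by (simp add: add_mono)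
      also have "\<dots> \<le> h * (rot_norm R + norm y)"
      proof -
        have "0 \<le> ca * rot_norm R" "0 \<le> k\<^sub>R * cs * norm y" "0 \<le> norm y"
          using ca cs kR rot_norm_nonneg[OF R] by simp_all
        then show ?thesis by (simp add: h_def algebra_simps)
      qed
      finally show ?thesis .
    qed
    define K where "K = c / sqrt \<nu> + c * h * sqrt (2 / a + 2 / (4 * lm * D)) * sqrt (b + D * (4 * lM)) * c / \<nu>"
    have K: "K > 0"
      unfolding K_def using c(1) h ab lm lM D \<nu>
      by (intro add_pos_nonneg divide_pos_pos mult_nonneg_nonneg divide_nonneg_pos) auto
    define \<mu> where "\<mu> = - ln (sqrt \<nu>) / (T\<^sub>M + 1)"
    have sq: "0 < sqrt \<nu>" "sqrt \<nu> < 1" using \<nu> by simp_all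
    then have \<mu>: "\<mu> > 0" unfolding \<mu>_def using TM by (intro divide_pos_pos) auto
    let ?H = "error_system M g k\<^sub>R k\<^sub>p k\<^sub>v T\<^sub>m T\<^sub>M"
    have sol: "complete_domain E \<and>
        (\<forall>(t, j)\<in>E. target_dist (x t j) \<le> (3 * K) * exp (- \<mu> * (t + real j)) * target_dist (x 0 0))"
      if max: "maximal_solution ?H E x" and init: "x 0 0 \<in> initial_set (\<epsilon> * sqrt (eig_ratio M)) \<eta>0 T\<^sub>M" for E x
    proof -
      have H: "hybrid_solution ?H E x" using max by (simp add: maximal_solution_def)
      then obtain s where "jump_times E s" by (auto simp: hybrid_solution_def hybrid_time_domain_iff)
      then interpret error_solution M g k\<^sub>R k\<^sub>p k\<^sub>v T\<^sub>m T\<^sub>M E x s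
        using H T by unfold_locales
      obtain R \<eta> y \<tau> where z: "x 0 0 = (R, \<eta>, y, \<tau>)" by (metis surj_pair)
      have R: "rotation_matrix R" and \<tau>: "0 \<le> \<tau>" "\<tau> \<le> T\<^sub>M" and rn: "rot_norm R \<le> \<epsilon> * sqrt (lm / lM)"
        and \<eta>: "norm \<eta> \<le> \<eta>0"
        using init by (simp_all add: z initial_set_def ratio)
      have "(rot_norm R)\<^sup>2 \<le> (\<epsilon> * sqrt (lm / lM))\<^sup>2"
        using rn rot_norm_nonneg[OF R] by (rule power_mono)
      also have "\<dots> = \<epsilon>\<^sup>2 * (lm / lM)" using lm lM by (simp add: power_mult_distrib)
      finally have "4 * lM * (rot_norm R)\<^sup>2 \<le> 4 * lM * (\<epsilon>\<^sup>2 * (lm / lM))" using lM by (intro mult_left_mono) auto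
      then have "pot M R \<le> 4 * lm * \<epsilon>\<^sup>2" using pot_hi[OF R] lM by (simp add: mult_ac)
      moreover have "pot M (R ** rot (- \<eta>) \<tau>) \<le> pot M R + cp * norm \<eta>"
        using cp(2)[OF R \<tau>, of "- \<eta>"] by simp
      moreover have "cp * norm \<eta> \<le> cp * \<eta>0" using \<eta> cp(1) by simp
      moreover have "cp * \<eta>0 = 4 * lm * (r - \<epsilon>\<^sup>2)" using cp(1) by (simp add: \<eta>0_def)
      ultimately have "pot M (R ** rot (- \<eta>) \<tau>) \<le> 4 * lm * r" by (simp add: algebra_simps)
      then have first: "pot M (Rc (sol g (start 0) (\<tau>c (start 0)))) \<le> 4 * lm * r"
        by (simp add: s0 z Rc_sol) (simp add: Rc_def \<tau>c_def)
      have "target_dist (x t j) \<le> (3 * K) * exp (- \<mu> * (t + real j)) * target_dist (x 0 0)" if tj: "(t, j) \<in> E" for t j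
      proof -
        have Rt: "rotation_matrix (Rc (x t j))"
          using on_slice(1)[OF tj] start_valid[OF tj] by (simp add: rotation_Rc_sol)
        have q: "sqrt \<nu> ^ Suc j \<le> exp (- \<mu> * (t + real j))"
          unfolding \<mu>_def by (rule exp_rate[OF sq TM time_bound[OF tj]])
        have "target_dist (x t j) \<le> comp_norm (x t j)" by (rule target_dist_le_comp_norm[OF Rt])
        also have "\<dots> \<le> K * sqrt \<nu> ^ Suc j * comp_norm (x 0 0)"
          unfolding K_def
          by (rule exponential_bound[OF M lm pot_lo lM pot_hi ab c h jump D \<nu> step first tj])
        also have "\<dots> \<le> K * exp (- \<mu> * (t + real j)) * (3 * target_dist (x 0 0))"
          using K sq q comp_norm_nonneg[of "x 0 0"] R
          by (intro mult_mono comp_norm_le_target_dist mult_nonneg_nonneg) (auto simp: z Rc_def)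
        finally show ?thesis by (simp add: mult_ac)
      qed
      then show ?thesis using maximal_imp_complete[OF max] by blast
    qed
    have dist: "target_dist z = 0 \<longleftrightarrow> z \<in> target_set T\<^sub>M" if "z \<in> flow_set ?H \<union> jump_set ?H" for z
      using that TM by (intro target_dist_eq_0_iff) (auto simp: error_system_simps)
    have K3: "3 * K > 0" using K by simp
    show ?thesis
      unfolding exponentially_stable_from_def
    proof (intro conjI closed_target_set ballI dist)
      show "\<exists>\<kappa>>0. \<exists>\<mu>>0. \<forall>E x. maximal_solution ?H E x \<and> x 0 0 \<in> initial_set (\<epsilon> * sqrt (eig_ratio M)) \<eta>0 T\<^sub>M \<longrightarrow>
        complete_domain E \<and> (\<forall>(t, j)\<in>E. target_dist (x t j) \<le> \<kappa> * exp (- \<mu> * (t + real j)) * target_dist (x 0 0))"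
        by (rule exI, rule conjI[OF K3], rule exI, rule conjI[OF \<mu>], intro allI impI, elim conjE, rule sol)
    qed
  qed
  then show "\<exists>\<eta>\<^sub>0>0. \<exists>k\<^sub>0>0. \<forall>k\<^sub>R. 0 < k\<^sub>R \<and> k\<^sub>R < k\<^sub>0 \<longrightarrow>
       exponentially_stable_from
         (error_system (landmark_matrix N k p) g k\<^sub>R k\<^sub>p k\<^sub>v T\<^sub>m T\<^sub>M) (target_set T\<^sub>M) target_dist
         (initial_set (\<epsilon> * sqrt (eig_ratio (landmark_matrix N k p))) \<eta>\<^sub>0 T\<^sub>M)"
    using \<eta>0 k0(1) unfolding M_def by blast
qed

end
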